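(* Let $\mu$ be a probability measure on $\{0,1\}^{\mathbb Z}$ which is translation-invariant and stationary for the stochastic six-vertex model, and which is extremal. Then $\mu=\Upsilon^{(\rho)}$ for some $\rho\in[0,1]$.
   Context: Fix $0<b_1<b_2<1$. The stochastic six-vertex model is the discrete-time Markov process $(\eta_t)_{t\ge0}$ on particle configurations $\eta\in\{0,1\}^{\mathbb Z}$ defined as follows for finitely many particles: at each step $t$ take independent $\chi_t(x)$ with $P[\chi_t(x)=1]=b_1=1-P[\chi_t(x)=0]$ and $j_t(x)$ with $P[j_t(x)=r]=(1-b_2)b_2^{r-1}$ ($r\ge1$). Label the particles at time $t-1$ as $p_{t-1}(-M)<\dots<p_{t-1}(N)$ (with $p(i)=-\infty$ for $i<-M$, $+\infty$ for $i>N$) and update $k=-M,\dots,N$ in this order: with $x=p_{t-1}(k)$, if $p_t(k-1)<x$ set $p_t(k)=x$ when $\chi_t(x)=1$ and $p_t(k)=\min\{x+j_t(x),p_{t-1}(k+1)\}$ when $\chi_t(x)=0$; if $p_t(k-1)=x$ set $p_t(k)=\min\{x+j_t(x),p_{t-1}(k+1)\}$. For infinitely many particles the dynamics over any finite time horizon is defined by the same rules via a Harris-type construction (almost surely space-time splits into finite non-interacting blocks). For a probability measure $\mu$ on $\{0,1\}^{\mathbb Z}$, $\mathfrak{M}_t\mu$ is the law of $\eta_t$ when $\eta_0\sim\mu$, and $\mathfrak{S}_m\mu$ is the law of $(\eta(x+m))_x$ when $\eta\sim\mu$. $\mu$ is translation-invariant if $\mathfrak{S}_m\mu=\mu$ for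 all $m\in\mathbb Z$, stationary if $\mathfrak{M}_t\mu=\mu$ for all $t\ge0$, and extremal if $\mu=p\mu_1+(1-p)\mu_2$ with $p\in(0,1)$ implies $\mu_1=\mu_2=\mu$. $\Upsilon^{(\rho)}$ is the product Bernoulli measure with $P[\eta(x)=1]=\rho$ for all $x$. *)

theory Defs
  imports "HOL-Probability.Probability"
begin

text \<open>Configurations: eta :: int => bool, eta x = True iff a particle sits at x.
  Measurable space of configurations: product sigma algebra on {0,1}^Z.\<close>

definition Conf :: "(int \<Rightarrow> bool) measure" where
  "Conf = (\<Pi>\<^sub>M x\<in>(UNIV::int set). count_space (UNIV::bool set))"

definition Upsilon :: "real \<Rightarrow> (int \<Rightarrow> bool) measure" where
  "Upsilon rho = (\<Pi>\<^sub>M x\<in>(UNIV::int set). measure_pmf (bernoulli_pmf rho))"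

text \<open>Noise at a single site: (chi, j - 1), chi = True (i.e. chi = 1) with probability b1,
  j - 1 geometric, so that P[j = r] = (1 - b2) b2^(r-1) for r >= 1.\<close>
definition site_noise :: "real \<Rightarrow> real \<Rightarrow> (bool \<times> nat) pmf" where
  "site_noise b1 b2 = pair_pmf (bernoulli_pmf b1) (geometric_pmf (1 - b2))"

definition Noise :: "real \<Rightarrow> real \<Rightarrow> (nat \<times> int \<Rightarrow> bool \<times> nat) measure" where
  "Noise b1 b2 = (\<Pi>\<^sub>M tx\<in>(UNIV::(nat \<times> int) set). measure_pmf (site_noise b1 b2))"

definition adjacent :: "(int \<Rightarrow> bool) \<Rightarrow> int \<Rightarrow> int \<Rightarrow> bool" where
  "adjacent \<eta> y x \<longleftrightarrow> \<eta> y \<and> \<eta> x \<and> y < x \<and> (\<forall>z. y < z \<and> z < x \<longrightarrow> \<not> \<eta> z)"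

definition next_particle :: "(int \<Rightarrow> bool) \<Rightarrow> int \<Rightarrow> int option" where
  "next_particle \<eta> x = (if \<exists>y>x. \<eta> y then Some (LEAST y. x < y \<and> \<eta> y) else None)"

text \<open>Within one time step, with chi :: int => bool and jumps j :: int => nat:
  the particle at x is pushed iff the particle immediately to its left moved and its
  jump reached x (i.e. p_t(k-1) = p_(t-1)(k)).  Least fixed point: this agrees with
  the sequential update rule whenever the chain of dependencies to the left terminates,
  which happens almost surely (Harris-type construction).\<close>
inductive pushed :: "(int \<Rightarrow> bool) \<Rightarrow> (int \<Rightarrow> bool) \<Rightarrow> (int \<Rightarrow> nat) \<Rightarrow> int \<Rightarrow> bool"
  for \<eta> :: "int \<Rightarrow> bool" and ch :: "int \<Rightarrow> bool" and j :: "int \<Rightarrow> nat" where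
  pushed_free: "adjacent \<eta> y x \<Longrightarrow> \<not> ch y \<Longrightarrow> x - y \<le> int (j y) \<Longrightarrow> pushed \<eta> ch j x"
| pushed_chain: "adjacent \<eta> y x \<Longrightarrow> pushed \<eta> ch j y \<Longrightarrow> x - y \<le> int (j y) \<Longrightarrow> pushed \<eta> ch j x"

definition moves :: "(int \<Rightarrow> bool) \<Rightarrow> (int \<Rightarrow> bool) \<Rightarrow> (int \<Rightarrow> nat) \<Rightarrow> int \<Rightarrow> bool" where
  "moves \<eta> ch j x \<longleftrightarrow> \<not> ch x \<or> pushed \<eta> ch j x"

definition new_pos :: "(int \<Rightarrow> bool) \<Rightarrow> (int \<Rightarrow> bool) \<Rightarrow> (int \<Rightarrow> nat) \<Rightarrow> int \<Rightarrow> int" where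
  "new_pos \<eta> ch j x =
     (if moves \<eta> ch j x then
        (case next_particle \<eta> x of None \<Rightarrow> x + int (j x) | Some y \<Rightarrow> min (x + int (j x)) y)
      else x)"

definition s6v_step :: "(int \<Rightarrow> bool) \<Rightarrow> (int \<Rightarrow> bool \<times> nat) \<Rightarrow> (int \<Rightarrow> bool)" where
  "s6v_step \<eta> w = (\<lambda>z. \<exists>x. \<eta> x \<and>
      new_pos \<eta> (\<lambda>y. fst (w y)) (\<lambda>y. snd (w y) + 1) x = z)"

primrec s6v_evol :: "(nat \<times> int \<Rightarrow> bool \<times> nat) \<Rightarrow> (int \<Rightarrow> bool) \<Rightarrow> nat \<Rightarrow> (int \<Rightarrow> bool)" where
  "s6v_evol \<omega> \<eta> 0 = \<eta>"
| "s6v_evol \<omega> \<eta> (Suc t) = s6v_step (s6v_evol \<omega> \<eta> t) (\<lambda>x. \<omega> (t, x))"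

definition M_t :: "real \<Rightarrow> real \<Rightarrow> nat \<Rightarrow> (int \<Rightarrow> bool) measure \<Rightarrow> (int \<Rightarrow> bool) measure" where
  "M_t b1 b2 t \<mu> = distr (\<mu> \<Otimes>\<^sub>M Noise b1 b2) Conf (\<lambda>(\<eta>, \<omega>). s6v_evol \<omega> \<eta> t)"

definition S_m :: "int \<Rightarrow> (int \<Rightarrow> bool) measure \<Rightarrow> (int \<Rightarrow> bool) measure" where
  "S_m m \<mu> = distr \<mu> Conf (\<lambda>\<eta> x. \<eta> (x + m))"

definition conf_prob :: "(int \<Rightarrow> bool) measure \<Rightarrow> bool" where
  "conf_prob \<mu> \<longleftrightarrow> prob_space \<mu> \<and> sets \<mu> = sets Conf"

definition translation_invariant :: "(int \<Rightarrow> bool) measure \<Rightarrow> bool" where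
  "translation_invariant \<mu> \<longleftrightarrow> (\<forall>m. S_m m \<mu> = \<mu>)"

definition stationary :: "real \<Rightarrow> real \<Rightarrow> (int \<Rightarrow> bool) measure \<Rightarrow> bool" where
  "stationary b1 b2 \<mu> \<longleftrightarrow> (\<forall>t. M_t b1 b2 t \<mu> = \<mu>)"

definition TIS :: "real \<Rightarrow> real \<Rightarrow> (int \<Rightarrow> bool) measure set" where
  "TIS b1 b2 = {\<mu>. conf_prob \<mu> \<and> translation_invariant \<mu> \<and> stationary b1 b2 \<mu>}"

definition extremal_in :: "(int \<Rightarrow> bool) measure set \<Rightarrow> (int \<Rightarrow> bool) measure \<Rightarrow> bool" where
  "extremal_in K \<mu> \<longleftrightarrow> \<mu> \<in> K \<and>
     (\<forall>p \<mu>1 \<mu>2. 0 < p \<and> p < 1 \<and> \<mu>1 \<in> K \<and> \<mu>2 \<in> K \<and>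
        (\<forall>A\<in>sets Conf. emeasure \<mu> A = ennreal p * emeasure \<mu>1 A + ennreal (1 - p) * emeasure \<mu>2 A)
        \<longrightarrow> \<mu>1 = \<mu> \<and> \<mu>2 = \<mu>)"

end

theory Submission
  imports Defs
begin

text \<open>
  Two configurations driven by the same vertex noise never gain discrepancies: at each vertex the
  number of discrepancies is nonincreasing, and it drops by two when a \<open>+\<close> and a \<open>-\<close> discrepancy
  merge. Take \<open>\<rho>\<close> to be the density of \<open>\<mu>\<close> and consider all translation-invariant couplings of
  \<open>\<mu>\<close> with the Bernoulli measure \<open>\<Upsilon>\<^sup>\<rho>\<close>, which is stationary as well. For a coupling whose
  discrepancy density is within \<open>\<epsilon>\<close> of the infimum, one further step can remove only a density
  \<open>\<epsilon>\<close>; as adjacent opposite discrepancies at bounded distance annihilate in one step with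
  probability bounded below, a long block carries both signs only with probability \<open>O(\<epsilon>)\<close>. With one
  sign present, the number of discrepancies is the difference of the two particle numbers, which
  is sublinear in the length of the block: for \<open>\<Upsilon>\<^sup>\<rho>\<close> by the law of large numbers, and for \<open>\<mu>\<close>
  because its upper particle density is invariant under shifts and under the conservative dynamics,
  hence constant by extremality. So the infimum is \<open>0\<close> and the two measures agree.
\<close>

section \<open>The vertex form of a time step\<close>

text \<open>The obstacle is the form of the noise: a jump length belongs to a particle, whereas
  discrepancies are compared vertex by vertex. Trading jumps for one pair of coins per vertex
  preserves the law of a step only, and does so for a configuration fixed beforehand. Hence there
  are two translations into vertex form: \<open>stop_noise\<close>, valid for every realisation,
  yields measurability and conservation of particles; i.i.d. coins yield the law. Extremality refers
  to measures invariant under shifts and dynamics at once, so ergodicity under shifts alone is not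
  given. The zero-one argument is therefore restricted to events invariant under both, and particle
  density supplies one because particles are conserved. No minimising coupling is constructed.
  Near-minimisers suffice because the probability of annihilation inside a block is bounded below in
  terms of the block length alone; the coupling approaches the infimum at a fixed block length,
  before the block length tends to infinity. Couplings need not be invariant under the joint
  dynamics; it is enough that a joint step maps couplings to couplings.\<close>

text \<open>A site with noise \<open>u x = (\<chi>, \<psi>)\<close> is a vertex of the six-vertex model: a lone vertical path
  continues upwards iff \<open>\<chi>\<close>, a lone horizontal path continues to the right iff \<open>\<psi>\<close>.
  \<open>hflux \<eta> u x\<close> says that a horizontal path leaves \<open>x\<close>; it is the least solution of the vertex
  recursion \<open>hflux_rec\<close>.\<close>

definition hflux :: "(int \<Rightarrow> bool) \<Rightarrow> (int \<Rightarrow> bool \<times> bool) \<Rightarrow> int \<Rightarrow> bool" where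
  "hflux \<eta> u x \<longleftrightarrow>
     (\<exists>y\<le>x. \<eta> y \<and> \<not> fst (u y) \<and> (\<forall>z. y < z \<and> z \<le> x \<longrightarrow> \<eta> z \<or> snd (u z)))"

text \<open>A vertex entered by both paths emits both, whatever its coins. In particle language the
  arriving particle stops at \<open>x\<close> and the one sitting there is pushed out.\<close>

definition vstep :: "(int \<Rightarrow> bool) \<Rightarrow> (int \<Rightarrow> bool \<times> bool) \<Rightarrow> int \<Rightarrow> bool" where
  "vstep \<eta> u x \<longleftrightarrow>
     (if \<eta> x then hflux \<eta> u (x - 1) \<or> fst (u x) else hflux \<eta> u (x - 1) \<and> \<not> snd (u x))"

text \<open>On an infinite line the recursion alone does not determine the flux, since a path might
  come in from minus infinity. The closed form demands an actual source \<open>y\<close> and so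
  selects the solution without such a path.\<close>

lemma hflux_rec:
  "hflux \<eta> u x \<longleftrightarrow>
     (if \<eta> x then hflux \<eta> u (x - 1) \<or> \<not> fst (u x) else hflux \<eta> u (x - 1) \<and> snd (u x))"
proof
  assume "hflux \<eta> u x"
  then obtain y where y: "y \<le> x" "\<eta> y" "\<not> fst (u y)" "\<forall>z. y < z \<and> z \<le> x \<longrightarrow> \<eta> z \<or> snd (u z)"
    unfolding hflux_def by blast
  show "if \<eta> x then hflux \<eta> u (x - 1) \<or> \<not> fst (u x) else hflux \<eta> u (x - 1) \<and> snd (u x)"
  proof (cases "y = x")
    case False
    then have "hflux \<eta> u (x - 1)"
      unfolding hflux_def using y by (intro exI[of _ y]) auto
    then show ?thesis using y(1) y(4)[rule_format, of x] False by auto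
  qed (use y in auto)
next
  assume *: "if \<eta> x then hflux \<eta> u (x - 1) \<or> \<not> fst (u x) else hflux \<eta> u (x - 1) \<and> snd (u x)"
  show "hflux \<eta> u x"
  proof (cases "hflux \<eta> u (x - 1)")
    case True
    then obtain y where y: "y \<le> x - 1" "\<eta> y" "\<not> fst (u y)"
      "\<forall>z. y < z \<and> z \<le> x - 1 \<longrightarrow> \<eta> z \<or> snd (u z)"
      unfolding hflux_def by blast
    have "\<eta> z \<or> snd (u z)" if "y < z" "z \<le> x" for z
      using y(4) that * by (cases "z = x") (auto split: if_splits)
    with y show ?thesis unfolding hflux_def by (intro exI[of _ y]) auto
  next
    case False
    with * have "\<eta> x" "\<not> fst (u x)" by (auto split: if_splits)
    then show ?thesis unfolding hflux_def by (intro exI[of _ x]) auto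
  qed
qed

text \<open>The ice rule of the six-vertex model: as many paths leave a vertex as enter it.\<close>

lemma vstep_conservation:
  "of_bool (vstep \<eta> u x) + of_bool (hflux \<eta> u x)
    = of_bool (\<eta> x) + (of_bool (hflux \<eta> u (x - 1)) :: real)"
  by (subst hflux_rec[of \<eta> u x]) (auto simp: vstep_def)

lemma hflux_shift: "hflux (\<lambda>x. \<eta> (x + m)) (\<lambda>x. u (x + m)) x = hflux \<eta> u (x + m)"
proof
  assume "hflux (\<lambda>x. \<eta> (x + m)) (\<lambda>x. u (x + m)) x"
  then obtain y where y: "y \<le> x" "\<eta> (y + m)" "\<not> fst (u (y + m))"
    "\<forall>z. y < z \<and> z \<le> x \<longrightarrow> \<eta> (z + m) \<or> snd (u (z + m))"
    unfolding hflux_def by blast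
  have "\<eta> z \<or> snd (u z)" if "y + m < z" "z \<le> x + m" for z
    using y(4)[rule_format, of "z - m"] that by simp
  with y show "hflux \<eta> u (x + m)" unfolding hflux_def by (intro exI[of _ "y + m"]) auto
next
  assume "hflux \<eta> u (x + m)"
  then obtain y where y: "y \<le> x + m" "\<eta> y" "\<not> fst (u y)"
    "\<forall>z. y < z \<and> z \<le> x + m \<longrightarrow> \<eta> z \<or> snd (u z)"
    unfolding hflux_def by blast
  then show "hflux (\<lambda>x. \<eta> (x + m)) (\<lambda>x. u (x + m)) x"
    unfolding hflux_def by (intro exI[of _ "y - m"]) auto
qed

lemma vstep_shift: "vstep (\<lambda>x. \<eta> (x + m)) (\<lambda>x. u (x + m)) = (\<lambda>x. vstep \<eta> u (x + m))"
proof
  fix x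
  show "vstep (\<lambda>x. \<eta> (x + m)) (\<lambda>x. u (x + m)) x = vstep \<eta> u (x + m)"
    unfolding vstep_def hflux_shift by (simp add: algebra_simps)
qed

lemma hflux_cong_left:
  assumes "\<And>y. y \<le> x \<Longrightarrow> \<eta> y = \<eta>' y" "\<And>y. y \<le> x \<Longrightarrow> u y = u' y"
  shows "hflux \<eta> u x = hflux \<eta>' u' x"
  unfolding hflux_def using assms by (intro ex_cong1) auto

lemma vstep_cong_left:
  assumes "\<And>y. y \<le> x \<Longrightarrow> \<eta> y = \<eta>' y" "\<And>y. y \<le> x \<Longrightarrow> u y = u' y"
  shows "vstep \<eta> u x = vstep \<eta>' u' x"
  unfolding vstep_def using assms hflux_cong_left[of "x - 1" \<eta> \<eta>' u u'] by simp

section \<open>Matching the particle rule with the vertex rule\<close>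

lemma hflux_empty_stretch:
  assumes "y \<le> x" "\<And>z. y < z \<Longrightarrow> z \<le> x \<Longrightarrow> \<not> \<eta> z"
  shows "hflux \<eta> u x \<longleftrightarrow> hflux \<eta> u y \<and> (\<forall>z. y < z \<and> z \<le> x \<longrightarrow> snd (u z))"
  using assms
proof (induction x rule: int_ge_induct)
  case (step i)
  have "\<not> \<eta> (i + 1)" using step by simp
  then have "hflux \<eta> u (i + 1) \<longleftrightarrow> hflux \<eta> u i \<and> snd (u (i + 1))"
    by (subst hflux_rec) simp
  moreover have "y < z \<and> z \<le> i + 1 \<longleftrightarrow> y < z \<and> z \<le> i \<or> z = i + 1" for z
    using step(1) by auto
  ultimately show ?case using step by auto
qed auto

lemma last_particle_before:
  assumes "\<eta> y" "y < (x::int)"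
  obtains z where "\<eta> z" "y \<le> z" "z < x" "\<And>v. z < v \<Longrightarrow> v < x \<Longrightarrow> \<not> \<eta> v"
proof -
  let ?S = "{z. \<eta> z \<and> y \<le> z \<and> z < x}"
  have fin: "finite ?S" by (rule finite_subset[of _ "{y..<x}"]) auto
  have ne: "y \<in> ?S" using assms by auto
  define z where "z = Max ?S"
  have "z \<in> ?S" unfolding z_def using Max_in[OF fin] ne by blast
  moreover have "\<not> \<eta> v" if "z < v" "v < x" for v
  proof
    assume "\<eta> v"
    then have "v \<in> ?S" using that \<open>z \<in> ?S\<close> by auto
    then have "v \<le> z" unfolding z_def using fin by simp
    with that show False by simp
  qed
  ultimately show thesis using that by blast
qed

lemma next_particle_eq_SomeI:
  assumes "adjacent \<eta> x y" shows "next_particle \<eta> x = Some y"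
proof -
  have "(LEAST y. x < y \<and> \<eta> y) = y"
    using assms by (intro Least_equality) (auto simp: adjacent_def intro: leI)
  moreover have "\<exists>y>x. \<eta> y" using assms by (auto simp: adjacent_def)
  ultimately show ?thesis by (simp add: next_particle_def)
qed

lemma next_particle_SomeD:
  assumes "next_particle \<eta> x = Some y" "\<eta> x" shows "adjacent \<eta> x y"
proof -
  have "\<exists>v>x. \<eta> v" using assms unfolding next_particle_def by (meson option.distinct(1))
  then obtain v where v: "x < v" "\<eta> v" by blast
  let ?S = "{z. \<eta> z \<and> x < z \<and> z \<le> v}"
  have fin: "finite ?S" by (rule finite_subset[of _ "{x..v}"]) auto
  have ne: "v \<in> ?S" using v by auto
  define m where "m = Min ?S"
  have m: "m \<in> ?S" unfolding m_def using Min_in[OF fin] ne by blast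
  have "\<not> \<eta> z" if "x < z" "z < m" for z
  proof
    assume "\<eta> z"
    then have "z \<in> ?S" using that m by auto
    then have "m \<le> z" unfolding m_def by (rule Min_le[OF fin])
    with that show False by simp
  qed
  then have "adjacent \<eta> x m" unfolding adjacent_def using assms m by auto
  then show ?thesis using next_particle_eq_SomeI[of \<eta> x m] assms by simp
qed

lemma next_particle_NoneD: "next_particle \<eta> x = None \<Longrightarrow> x < y \<Longrightarrow> \<not> \<eta> y"
  unfolding next_particle_def by (cases "\<exists>y>x. \<eta> y") auto

text \<open>The assumptions compare \<open>w\<close> and \<open>u\<close> only where the dynamics
  can see a difference: \<chi> at occupied sites, and jump lengths up to the next particle. This is
  what lets two very different vertex noises, \<open>stop_noise\<close> and \<open>coin_u\<close>,
  satisfy them. The inequality in \<open>reach\<close> is strict because \<open>snd (u z)\<close>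
  means going beyond \<open>z\<close>, whereas a jump of length exactly \<open>z - x\<close> ends
  there.\<close>

context
  fixes \<eta> :: "int \<Rightarrow> bool" and w :: "int \<Rightarrow> bool \<times> nat" and u :: "int \<Rightarrow> bool \<times> bool"
  assumes ch_eq: "\<And>x. \<eta> x \<Longrightarrow> fst (u x) = fst (w x)"
    and reach: "\<And>x z. \<eta> x \<Longrightarrow> x < z \<Longrightarrow> (\<And>y. x < y \<Longrightarrow> y \<le> z \<Longrightarrow> \<not> \<eta> y) \<Longrightarrow>
      z - x < int (snd (w x) + 1) \<longleftrightarrow> (\<forall>y. x < y \<and> y \<le> z \<longrightarrow> snd (u y))"
begin

private abbreviation "ch \<equiv> \<lambda>y. fst (w y)"
private abbreviation "j \<equiv> \<lambda>y. snd (w y) + 1"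

text \<open>To arrive at the next particle only the empty sites in front of it have to be passed;
  its own coin is not consulted. This turns the strict inequality of \<open>reach\<close> into a
  non-strict one.\<close>

private lemma reach_next:
  assumes "adjacent \<eta> y x"
  shows "x - y \<le> int (j y) \<longleftrightarrow> (\<forall>z. y < z \<and> z < x \<longrightarrow> snd (u z))"
proof (cases "x = y + 1")
  case False
  then have "x - 1 - y < int (j y) \<longleftrightarrow> (\<forall>z. y < z \<and> z \<le> x - 1 \<longrightarrow> snd (u z))"
    using assms by (intro reach) (auto simp: adjacent_def)
  then show ?thesis by auto
qed auto

private lemma hflux_before:
  assumes "adjacent \<eta> y x"
  shows "hflux \<eta> u (x - 1) \<longleftrightarrow> hflux \<eta> u y \<and> x - y \<le> int (j y)"
proof -
  have "hflux \<eta> u (x - 1) \<longleftrightarrow> hflux \<eta> u y \<and> (\<forall>z. y < z \<and> z \<le> x - 1 \<longrightarrow> snd (u z))"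
    using assms by (intro hflux_empty_stretch) (auto simp: adjacent_def)
  also have "(\<forall>z. y < z \<and> z \<le> x - 1 \<longrightarrow> snd (u z)) \<longleftrightarrow> x - y \<le> int (j y)"
    unfolding reach_next[OF assms] by auto
  finally show ?thesis .
qed

private lemma pushed_imp_hflux: "pushed \<eta> ch j x \<Longrightarrow> hflux \<eta> u (x - 1)"
proof (induction rule: pushed.induct)
  case (pushed_free y x)
  then have "hflux \<eta> u y" using ch_eq[of y] by (subst hflux_rec) (auto simp: adjacent_def)
  then show ?case using hflux_before pushed_free by blast
next
  case (pushed_chain y x)
  then have "hflux \<eta> u y" by (subst hflux_rec) (auto simp: adjacent_def)
  then show ?case using hflux_before pushed_chain by blast
qed

text \<open>Strong induction on the distance to the source: the last particle \<open>y\<close>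
  before \<open>x\<close> is the source itself or is pushed by induction, and in both cases the
  coins between \<open>y\<close> and \<open>x\<close> let it arrive.\<close>

private lemma source_imp_pushed:
  assumes "\<eta> s" "\<not> fst (u s)" "\<eta> x" "s < x" "\<And>z. s < z \<Longrightarrow> z < x \<Longrightarrow> \<eta> z \<or> snd (u z)"
  shows "pushed \<eta> ch j x"
  using assms
proof (induction "nat (x - s)" arbitrary: x rule: less_induct)
  case less
  obtain y where y: "\<eta> y" "s \<le> y" "y < x" "\<And>v. y < v \<Longrightarrow> v < x \<Longrightarrow> \<not> \<eta> v"
    using last_particle_before[of \<eta>, OF less(2,5)] by blast
  have adj: "adjacent \<eta> y x" using y less by (auto simp: adjacent_def)
  have near: "x - y \<le> int (j y)"
    unfolding reach_next[OF adj] using less(6) y by (meson le_less_trans)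
  show ?case
  proof (cases "y = s")
    case True
    then show ?thesis using pushed_free[OF adj] near ch_eq[of s] less by auto
  next
    case False
    then have "pushed \<eta> ch j y"
      using y less by (intro less.hyps) auto
    then show ?thesis using pushed_chain[OF adj] near by simp
  qed
qed

text \<open>Both sides are least fixed points: a derivation of \<open>pushed\<close> is a finite
  chain of pushes starting at a particle with \<chi> = 0, and such a particle is exactly a source in
  \<open>hflux\<close>.\<close>

private lemma pushed_iff_hflux:
  assumes "\<eta> x" shows "pushed \<eta> ch j x \<longleftrightarrow> hflux \<eta> u (x - 1)"
proof
  assume "hflux \<eta> u (x - 1)"
  then obtain s where "s \<le> x - 1" "\<eta> s" "\<not> fst (u s)"
     "\<forall>z. s < z \<and> z \<le> x - 1 \<longrightarrow> \<eta> z \<or> snd (u z)"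
    unfolding hflux_def by blast
  then show "pushed \<eta> ch j x" by (intro source_imp_pushed[of s]) (use assms in auto)
qed (rule pushed_imp_hflux)

private lemma moves_iff_hflux: "\<eta> x \<Longrightarrow> moves \<eta> ch j x \<longleftrightarrow> hflux \<eta> u x"
  unfolding moves_def using pushed_iff_hflux[of x] ch_eq[of x] hflux_rec[of \<eta> u x] by auto

private lemma new_pos_cases:
  assumes "\<eta> x"
  shows "new_pos \<eta> ch j x = z \<longleftrightarrow>
    (z = x \<and> \<not> moves \<eta> ch j x) \<or>
    (moves \<eta> ch j x \<and> adjacent \<eta> x z \<and> z - x \<le> int (j x)) \<or>
    (moves \<eta> ch j x \<and> z = x + int (j x) \<and> (\<forall>v. x < v \<and> v \<le> z \<longrightarrow> \<not> \<eta> v))"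
proof (cases "next_particle \<eta> x")
  case None
  then have emp: "\<not> \<eta> v" if "x < v" for v using next_particle_NoneD that by blast
  then have adj: "\<not> adjacent \<eta> x z" unfolding adjacent_def by blast
  have "\<forall>v. x < v \<and> v \<le> z \<longrightarrow> \<not> \<eta> v" using emp by blast
  with adj show ?thesis unfolding new_pos_def None option.case
    by (cases "moves \<eta> ch j x") auto
next
  case (Some y)
  then have y: "adjacent \<eta> x y" using next_particle_SomeD assms by blast
  have adj: "adjacent \<eta> x z \<longleftrightarrow> z = y"
  proof
    assume "adjacent \<eta> x z"
    from next_particle_eq_SomeI[OF this] Some show "z = y" by simp
  qed (use y in simp)
  have emp: "(\<forall>v. x < v \<and> v \<le> z \<longrightarrow> \<not> \<eta> v) \<longleftrightarrow> z < y"
  proof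
    assume *: "\<forall>v. x < v \<and> v \<le> z \<longrightarrow> \<not> \<eta> v"
    show "z < y"
    proof (rule ccontr)
      assume "\<not> z < y"
      with y * show False unfolding adjacent_def by (meson not_less)
    qed
  next
    assume "z < y"
    with y show "\<forall>v. x < v \<and> v \<le> z \<longrightarrow> \<not> \<eta> v"
      unfolding adjacent_def by (meson le_less_trans)
  qed
  have "x < y" using y by (simp add: adjacent_def)
  show ?thesis unfolding adj emp new_pos_def Some option.case
    using \<open>x < y\<close> by (cases "moves \<eta> ch j x") (auto simp: min_def)
qed

text \<open>At an occupied \<open>z\<close> a particle is found afterwards iff the old one stays or
  its left neighbour lands on it, and that landing is what \<open>pushed\<close> records. At an
  empty \<open>z\<close> a moving particle must complete its jump exactly there, which means that
  the flux arrives at \<open>z - 1\<close> and the coin at \<open>z\<close> stops it.\<close>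

lemma s6v_step_eq_vstep: "s6v_step \<eta> w = vstep \<eta> u"
proof
  fix z
  show "s6v_step \<eta> w z = vstep \<eta> u z"
  proof (cases "\<eta> z")
    case True
    have "s6v_step \<eta> w z \<longleftrightarrow>
      (\<not> moves \<eta> ch j z \<or> (\<exists>x. adjacent \<eta> x z \<and> moves \<eta> ch j x \<and> z - x \<le> int (j x)))"
    proof
      assume "s6v_step \<eta> w z"
      then obtain x where x: "\<eta> x" "new_pos \<eta> ch j x = z" unfolding s6v_step_def by blast
      then show "\<not> moves \<eta> ch j z \<or> (\<exists>x. adjacent \<eta> x z \<and> moves \<eta> ch j x \<and> z - x \<le> int (j x))"
        using new_pos_cases[OF x(1), of z] True by auto
    next
      assume "\<not> moves \<eta> ch j z \<or> (\<exists>x. adjacent \<eta> x z \<and> moves \<eta> ch j x \<and> z - x \<le> int (j x))"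
      then show "s6v_step \<eta> w z"
      proof
        assume "\<not> moves \<eta> ch j z"
        then show ?thesis unfolding s6v_step_def using new_pos_cases[OF True, of z] True by blast
      next
        assume "\<exists>x. adjacent \<eta> x z \<and> moves \<eta> ch j x \<and> z - x \<le> int (j x)"
        then obtain x where x: "adjacent \<eta> x z" "moves \<eta> ch j x" "z - x \<le> int (j x)" by blast
        then have "\<eta> x" by (simp add: adjacent_def)
        then show ?thesis unfolding s6v_step_def using new_pos_cases[OF \<open>\<eta> x\<close>, of z] x by blast
      qed
    qed
    \<comment> \<open>The two introduction rules of \<open>pushed\<close> correspond to the two
      alternatives in \<open>moves\<close> for the left neighbour.\<close>
    also have "(\<exists>x. adjacent \<eta> x z \<and> moves \<eta> ch j x \<and> z - x \<le> int (j x)) \<longleftrightarrow> pushed \<eta> ch j z"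
      unfolding moves_def by (subst pushed.simps) blast
    finally show ?thesis
      unfolding moves_def using True pushed_iff_hflux[OF True] ch_eq[OF True]
      by (auto simp: vstep_def)
  next
    case False
    have "s6v_step \<eta> w z \<longleftrightarrow> (\<exists>x. \<eta> x \<and> moves \<eta> ch j x \<and> z = x + int (j x) \<and> (\<forall>v. x < v \<and> v \<le> z \<longrightarrow> \<not> \<eta> v))"
      unfolding s6v_step_def
    proof (intro ex_cong1 conj_cong refl)
      fix x assume x: "\<eta> x"
      show "new_pos \<eta> ch j x = z \<longleftrightarrow>
        moves \<eta> ch j x \<and> z = x + int (j x) \<and> (\<forall>v. x < v \<and> v \<le> z \<longrightarrow> \<not> \<eta> v)"
        using new_pos_cases[OF x, of z] x False by (auto simp: adjacent_def)
    qed
    also have "\<dots> \<longleftrightarrow> hflux \<eta> u (z - 1) \<and> \<not> snd (u z)"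
    proof safe
      fix x assume x: "\<eta> x" "moves \<eta> ch j x" "z = x + int (j x)"
        "\<forall>v. x < v \<and> v \<le> x + int (j x) \<longrightarrow> \<not> \<eta> v"
      have before: "\<forall>y. x < y \<and> y \<le> z - 1 \<longrightarrow> snd (u y)"
      proof (cases "z - 1 = x")
        case False
        then show ?thesis using reach[of x "z - 1"] x by auto
      qed auto
      have "hflux \<eta> u x" using x moves_iff_hflux by blast
      then show "hflux \<eta> u (x + int (j x) - 1)"
        using hflux_empty_stretch[of x "z - 1" \<eta> u] before x by auto
      assume s: "snd (u (x + int (j x)))"
      have "\<forall>y. x < y \<and> y \<le> z \<longrightarrow> snd (u y)"
      proof safe
        fix y assume "x < y" "y \<le> z"
        then show "snd (u y)" using before s x(3) by (cases "y = z") auto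
      qed
      then show False using reach[of x z] x by auto
    next
      assume h: "hflux \<eta> u (z - 1)" and s: "\<not> snd (u z)"
      from h obtain y where "y \<le> z - 1" "\<eta> y" unfolding hflux_def by blast
      then obtain x where x: "\<eta> x" "x < z" "\<And>v. x < v \<Longrightarrow> v < z \<Longrightarrow> \<not> \<eta> v"
        using last_particle_before[of \<eta> y z] by auto
      have h2: "hflux \<eta> u x" "\<forall>y. x < y \<and> y \<le> z - 1 \<longrightarrow> snd (u y)"
        using hflux_empty_stretch[of x "z - 1" \<eta> u] x h by auto
      have emp: "\<not> \<eta> v" if "x < v" "v \<le> z" for v
        using that x(3)[of v] False by (cases "v = z") auto
      \<comment> \<open>The failing coin at \<open>z\<close> bounds the jump from above and the
        passed coins before \<open>z\<close> bound it from below, so its length is exactly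
        \<open>z - x\<close>.\<close>
      have "z - x \<ge> int (j x)" using reach[of x z] x s emp by force
      moreover have "z - 1 - x < int (j x)"
      proof (cases "z - 1 = x")
        case False
        then show ?thesis using reach[of x "z - 1"] x h2 emp by auto
      qed auto
      ultimately show "\<exists>x. \<eta> x \<and> moves \<eta> ch j x \<and> z = x + int (j x) \<and> (\<forall>v. x < v \<and> v \<le> z \<longrightarrow> \<not> \<eta> v)"
        using x(1) emp h2(1) moves_iff_hflux[OF x(1)] by (intro exI[of _ x]) auto
    qed
    finally show ?thesis using False by (simp add: vstep_def)
  qed
qed

end

text \<open>The \<psi> coin at \<open>z\<close> is reconstructed from the jump of the last particle
  before \<open>z\<close>: it says whether that jump goes beyond \<open>z\<close>, and it is False
  if there is no such particle. This noise depends on \<open>\<eta>\<close> and is not i.i.d., but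
  the resulting identity has no exceptional set.\<close>

definition stop_noise :: "(int \<Rightarrow> bool) \<Rightarrow> (int \<Rightarrow> bool \<times> nat) \<Rightarrow> int \<Rightarrow> bool \<times> bool" where
  "stop_noise \<eta> w z = (fst (w z),
     \<exists>x<z. \<eta> x \<and> (\<forall>y. x < y \<and> y < z \<longrightarrow> \<not> \<eta> y) \<and> z - x < int (snd (w x) + 1))"

text \<open>Along an empty stretch behind \<open>x\<close> the last particle is always
  \<open>x\<close>, and a jump that goes beyond \<open>z\<close> goes beyond every earlier
  site.\<close>

lemma s6v_step_vstep_stop_noise: "s6v_step \<eta> w = vstep \<eta> (stop_noise \<eta> w)"
proof (rule s6v_step_eq_vstep)
  fix x z assume x: "\<eta> x" "x < z" and emp: "\<And>y. x < y \<Longrightarrow> y \<le> z \<Longrightarrow> \<not> \<eta> y"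
  have "snd (stop_noise \<eta> w y) \<longleftrightarrow> y - x < int (snd (w x) + 1)" if y: "x < y" "y \<le> z" for y
  proof
    assume "snd (stop_noise \<eta> w y)"
    then obtain v where v: "v < y" "\<eta> v" "\<forall>t. v < t \<and> t < y \<longrightarrow> \<not> \<eta> t" "y - v < int (snd (w v) + 1)"
      unfolding stop_noise_def by auto
    have "\<not> v < x" using v(3) x(1) y(1) by blast
    moreover have "\<not> x < v" using emp[of v] v(1,2) y(2) by auto
    ultimately have "v = x" by simp
    with v show "y - x < int (snd (w x) + 1)" by simp
  next
    assume "y - x < int (snd (w x) + 1)"
    then show "snd (stop_noise \<eta> w y)" unfolding stop_noise_def using x emp y by auto
  qed
  then have "(\<forall>y. x < y \<and> y \<le> z \<longrightarrow> snd (stop_noise \<eta> w y)) \<longleftrightarrow>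
    (\<forall>y. x < y \<and> y \<le> z \<longrightarrow> y - x < int (snd (w x) + 1))" by blast
  also have "\<dots> \<longleftrightarrow> z - x < int (snd (w x) + 1)"
    using x by auto
  finally show "z - x < int (snd (w x) + 1) \<longleftrightarrow> (\<forall>y. x < y \<and> y \<le> z \<longrightarrow> snd (stop_noise \<eta> w y))"
    by blast
qed (simp add: stop_noise_def)

section \<open>Product measures over countable alphabets\<close>

abbreviation discrete_fun_space :: "('i \<Rightarrow> 'a) measure" where
  "discrete_fun_space \<equiv> PiM UNIV (\<lambda>_. count_space UNIV)"

abbreviation iid :: "'a pmf \<Rightarrow> ('i \<Rightarrow> 'a) measure" where
  "iid p \<equiv> PiM UNIV (\<lambda>_. measure_pmf p)"

lemma space_PiM_pmf [simp]: "space (PiM UNIV (\<lambda>i. measure_pmf (p i))) = UNIV"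
  by (simp add: space_PiM)

lemma sets_PiM_pmf [simp, measurable_cong]:
  "sets (PiM UNIV (\<lambda>i. measure_pmf (p i))) = sets discrete_fun_space"
  by (rule sets_PiM_cong) auto

lemma space_discrete_fun_space [simp]: "space discrete_fun_space = UNIV"
  by (simp add: space_PiM)

lemma prob_space_PiM_pmf: "prob_space (PiM UNIV (\<lambda>i. measure_pmf (p i)))"
  by (rule prob_space_PiM) (rule measure_pmf.prob_space_axioms)

lemma measure_PiM_pmf_rectangle:
  assumes "finite J"
  shows "measure (PiM UNIV (\<lambda>i. measure_pmf (p i))) {\<omega>. \<forall>i\<in>J. \<omega> i \<in> F i}
    = (\<Prod>i\<in>J. measure_pmf.prob (p i) (F i))"
proof -
  interpret product_prob_space "\<lambda>i. measure_pmf (p i)" UNIV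
    by unfold_locales
  interpret P: prob_space "PiM UNIV (\<lambda>i. measure_pmf (p i))"
    by (rule prob_space_PiM_pmf)
  have "emeasure (PiM UNIV (\<lambda>i. measure_pmf (p i))) {\<omega>. \<forall>i\<in>J. \<omega> i \<in> F i}
    = (\<Prod>i\<in>J. emeasure (measure_pmf (p i)) (F i))"
    using emeasure_PiM_Collect[of J F] assms unfolding space_PiM_pmf by simp
  also have "\<dots> = ennreal (\<Prod>i\<in>J. measure_pmf.prob (p i) (F i))"
    unfolding measure_pmf.emeasure_eq_measure by (rule prod_ennreal) simp
  finally show ?thesis
    unfolding P.emeasure_eq_measure by (subst (asm) ennreal_inj) (auto intro: prod_nonneg)
qed

lemma measure_PiM_pmf_cylinder:
  assumes "finite J"
  shows "measure (PiM UNIV (\<lambda>i. measure_pmf (p i))) {\<omega>. \<forall>i\<in>J. \<omega> i = a i}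
    = (\<Prod>i\<in>J. pmf (p i) (a i))"
  using measure_PiM_pmf_rectangle[OF assms, of p "\<lambda>i. {a i}"] by (simp add: measure_pmf_single)

lemma sets_discrete_cylinder [measurable]:
  assumes "finite J"
  shows "{\<omega>. \<forall>i\<in>J. \<omega> i = a i} \<in> sets discrete_fun_space"
proof -
  have "{\<omega> \<in> space discrete_fun_space. \<forall>i\<in>J. \<omega> i = a i} \<in> sets discrete_fun_space"
    using assms by measurable
  then show ?thesis by simp
qed

text \<open>Cylinders with prescribed values are stable under intersection once the empty set is
  added for contradictory prescriptions. They generate the product sigma-algebra because the
  alphabet is countable, so that a condition \<open>f i \<in> A\<close> is a countable union of
  cylinders.\<close>

lemma discrete_fun_space_measure_eqI:
  fixes P Q :: "('i \<Rightarrow> 'a::countable) measure"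
  assumes "prob_space P" "prob_space Q"
    and sets: "sets P = sets discrete_fun_space" "sets Q = sets discrete_fun_space"
    and eq: "\<And>J a. finite J \<Longrightarrow>
      measure P {\<omega>. \<forall>i\<in>J. \<omega> i = a i} = measure Q {\<omega>. \<forall>i\<in>J. \<omega> i = a i}"
  shows "P = Q"
proof -
  interpret P: prob_space P by fact
  interpret Q: prob_space Q by fact
  define E :: "('i \<Rightarrow> 'a) set set" where
    "E = insert {} {{\<omega>. \<forall>i\<in>J. \<omega> i = a i} | J a. finite J}"
  have inE: "{\<omega>. \<forall>i\<in>J. \<omega> i = a i} \<in> E" if "finite J" for J a
    using that unfolding E_def by blast
  have "sets (discrete_fun_space :: ('i \<Rightarrow> 'a) measure) = sigma_sets UNIV E"
  proof (rule antisym)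
    show "sigma_sets UNIV E \<subseteq> sets (discrete_fun_space :: ('i \<Rightarrow> 'a) measure)"
    proof -
      have "E \<subseteq> sets discrete_fun_space"
        unfolding E_def using sets_discrete_cylinder by auto
      then show ?thesis
        using sets.sigma_sets_subset[of E discrete_fun_space] by simp
    qed
    have "{f. f i \<in> A} \<in> sigma_sets UNIV E" for i :: 'i and A :: "'a set"
    proof -
      have "{f. f i \<in> A} = (\<Union>x\<in>A. {f. \<forall>k\<in>{i}. f k = x})" by auto
      also have "\<dots> \<in> sigma_sets UNIV E"
      proof (rule sigma_sets_UNION)
        show "countable ((\<lambda>x. {f. \<forall>k\<in>{i}. f k = x}) ` A)" by simp
        fix B assume "B \<in> (\<lambda>x. {f. \<forall>k\<in>{i}. f k = x}) ` A"
        then obtain x where "B = {f. \<forall>k\<in>{i}. f k = x}" by blast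
        then show "B \<in> sigma_sets UNIV E" using inE[of "{i}" "\<lambda>_. x"] by (auto intro: sigma_sets.Basic)
      qed
      finally show ?thesis .
    qed
    then have "{{f \<in> UNIV. f i \<in> A} |i A. i \<in> UNIV \<and> A \<in> sets (count_space UNIV)}
      \<subseteq> sigma_sets UNIV E"
      by auto
    then show "sets (discrete_fun_space :: ('i \<Rightarrow> 'a) measure) \<subseteq> sigma_sets UNIV E"
      unfolding sets_PiM_single space_count_space PiE_UNIV_domain Pi_UNIV
      by (rule sigma_sets_mono)
  qed
  then have sE: "sets P = sigma_sets UNIV E" "sets Q = sigma_sets UNIV E"
    using sets by simp_all
  show ?thesis
  proof (rule measure_eqI_generator_eq[where E=E and \<Omega>=UNIV and A="\<lambda>_. UNIV"])
    show "Int_stable E"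
    proof (rule Int_stableI)
      fix A B assume "A \<in> E" "B \<in> E"
      show "A \<inter> B \<in> E"
      proof (cases "A \<inter> B = {}")
        case True then show ?thesis by (simp add: E_def)
      next
        case False
        then obtain J a K b f where A: "finite J" "A = {\<omega>. \<forall>i\<in>J. \<omega> i = a i}"
          and B: "finite K" "B = {\<omega>. \<forall>i\<in>K. \<omega> i = b i}" and f: "f \<in> A" "f \<in> B"
          using \<open>A \<in> E\<close> \<open>B \<in> E\<close> unfolding E_def by blast
        have "A \<inter> B = {\<omega>. \<forall>i\<in>J \<union> K. \<omega> i = f i}" using A B f by auto
        then show ?thesis using inE[of "J \<union> K" f] A B by simp
      qed
    qed
    have "{\<omega>::'i \<Rightarrow> 'a. \<forall>i\<in>{}. \<omega> i = undefined} \<in> E" by (rule inE) simp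
    then show "range (\<lambda>_::nat. UNIV) \<subseteq> E" by auto
    show "emeasure P X = emeasure Q X" if "X \<in> E" for X
      using that eq unfolding E_def P.emeasure_eq_measure Q.emeasure_eq_measure by auto
  qed (use sE P.emeasure_finite in auto)
qed

lemma PiM_pmf_eqI:
  fixes P :: "('i \<Rightarrow> 'a::countable) measure"
  assumes "prob_space P" "sets P = sets discrete_fun_space"
    and "\<And>J a. finite J \<Longrightarrow> measure P {\<omega>. \<forall>i\<in>J. \<omega> i = a i} = (\<Prod>i\<in>J. pmf (p i) (a i))"
  shows "P = PiM UNIV (\<lambda>i. measure_pmf (p i))"
  using assms
  by (intro discrete_fun_space_measure_eqI) (auto simp: measure_PiM_pmf_cylinder intro: prob_space_PiM_pmf)

text \<open>By Fubini only the law for each fixed \<open>x\<close> matters. The passage from one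
  noise to the other may therefore depend on the configuration, as it does for the coins
  below.\<close>

lemma distr_pair_measure_kernel_cong:
  assumes "sigma_finite_measure A" "sigma_finite_measure B"
    and [measurable]: "case_prod f \<in> M \<Otimes>\<^sub>M A \<rightarrow>\<^sub>M C" "case_prod g \<in> M \<Otimes>\<^sub>M B \<rightarrow>\<^sub>M C"
    and eq: "\<And>x. x \<in> space M \<Longrightarrow> distr A C (f x) = distr B C (g x)"
  shows "distr (M \<Otimes>\<^sub>M A) C (case_prod f) = distr (M \<Otimes>\<^sub>M B) C (case_prod g)"
proof (rule measure_eqI)
  interpret A: sigma_finite_measure A by fact
  interpret B: sigma_finite_measure B by fact
  fix X assume "X \<in> sets (distr (M \<Otimes>\<^sub>M A) C (case_prod f))"
  then have [measurable]: "X \<in> sets C" by simp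
  have "emeasure A (Pair x -` (case_prod f -` X \<inter> space (M \<Otimes>\<^sub>M A)))
      = emeasure B (Pair x -` (case_prod g -` X \<inter> space (M \<Otimes>\<^sub>M B)))" if "x \<in> space M" for x
  proof -
    have [measurable]: "f x \<in> A \<rightarrow>\<^sub>M C" "g x \<in> B \<rightarrow>\<^sub>M C"
      using measurable_compose[OF measurable_Pair1'[OF that] assms(3)]
        measurable_compose[OF measurable_Pair1'[OF that] assms(4)] by simp_all
    have "emeasure (distr A C (f x)) X = emeasure (distr B C (g x)) X"
      using eq[OF that] by simp
    then have "emeasure A (f x -` X \<inter> space A) = emeasure B (g x -` X \<inter> space B)"
      by (simp add: emeasure_distr)
    moreover have "Pair x -` (case_prod f -` X \<inter> space (M \<Otimes>\<^sub>M A)) = f x -` X \<inter> space A"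
      "Pair x -` (case_prod g -` X \<inter> space (M \<Otimes>\<^sub>M B)) = g x -` X \<inter> space B"
      using that by (auto simp: space_pair_measure)
    ultimately show ?thesis by simp
  qed
  then have "(\<integral>\<^sup>+x. emeasure A (Pair x -` (case_prod f -` X \<inter> space (M \<Otimes>\<^sub>M A))) \<partial>M) =
    (\<integral>\<^sup>+x. emeasure B (Pair x -` (case_prod g -` X \<inter> space (M \<Otimes>\<^sub>M B))) \<partial>M)"
    by (rule nn_integral_cong)
  then show "emeasure (distr (M \<Otimes>\<^sub>M A) C (case_prod f)) X = emeasure (distr (M \<Otimes>\<^sub>M B) C (case_prod g)) X"
    by (subst (1 2) emeasure_distr) (simp_all add: A.emeasure_pair_measure_alt B.emeasure_pair_measure_alt)
qed simp

section \<open>Vertex noise and measurability of the dynamics\<close>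

abbreviation vsite :: "real \<Rightarrow> real \<Rightarrow> (bool \<times> bool) pmf" where
  "vsite b1 b2 \<equiv> pair_pmf (bernoulli_pmf b1) (bernoulli_pmf b2)"

abbreviation vnoise :: "real \<Rightarrow> real \<Rightarrow> (int \<Rightarrow> bool \<times> bool) measure" where
  "vnoise b1 b2 \<equiv> iid (vsite b1 b2)"

lemma space_Conf [simp]: "space Conf = UNIV"
  by (simp add: Conf_def)

lemma measurable_site [measurable (raw)]:
  "f \<in> M \<rightarrow>\<^sub>M Conf \<Longrightarrow> Measurable.pred M (\<lambda>\<omega>. f \<omega> x)"
  unfolding Conf_def using measurable_compose[OF _ measurable_component_singleton[of x UNIV]] by auto

lemma measurable_ConfI:
  assumes "\<And>x. Measurable.pred M (\<lambda>\<omega>. f \<omega> x)" shows "f \<in> M \<rightarrow>\<^sub>M Conf"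
  unfolding Conf_def using assms by (intro measurable_PiM_single') (auto simp: measurable_def)

lemma measurable_coord [measurable (raw)]:
  assumes "f \<in> M \<rightarrow>\<^sub>M discrete_fun_space"
  shows "(\<lambda>\<omega>. f \<omega> x) \<in> M \<rightarrow>\<^sub>M count_space UNIV"
  using measurable_compose[OF assms measurable_component_singleton[of x UNIV]] by simp

lemma measurable_hflux [measurable (raw)]:
  assumes [measurable]: "f \<in> M \<rightarrow>\<^sub>M Conf" "g \<in> M \<rightarrow>\<^sub>M discrete_fun_space"
  shows "Measurable.pred M (\<lambda>\<omega>. hflux (f \<omega>) (g \<omega>) x)"
  unfolding hflux_def by measurable

lemma measurable_vstep [measurable (raw)]:
  assumes [measurable]: "f \<in> M \<rightarrow>\<^sub>M Conf" "g \<in> M \<rightarrow>\<^sub>M discrete_fun_space"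
  shows "(\<lambda>\<omega>. vstep (f \<omega>) (g \<omega>)) \<in> M \<rightarrow>\<^sub>M Conf"
  by (rule measurable_ConfI) (unfold vstep_def, measurable)

lemma measurable_discreteI:
  fixes f :: "'b \<Rightarrow> 'i \<Rightarrow> 'a"
  assumes "\<And>x. (\<lambda>\<omega>. f \<omega> x) \<in> M \<rightarrow>\<^sub>M count_space UNIV" shows "f \<in> M \<rightarrow>\<^sub>M discrete_fun_space"
  using assms by (intro measurable_PiM_single') (auto simp: measurable_def)

lemma measurable_stop_noise [measurable (raw)]:
  assumes [measurable]: "f \<in> M \<rightarrow>\<^sub>M Conf" "g \<in> M \<rightarrow>\<^sub>M discrete_fun_space"
  shows "(\<lambda>\<omega>. stop_noise (f \<omega>) (g \<omega>)) \<in> M \<rightarrow>\<^sub>M discrete_fun_space"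
proof (rule measurable_discreteI)
  fix x
  have "(\<lambda>\<omega>. fst (g \<omega> x)) \<in> M \<rightarrow>\<^sub>M count_space UNIV"
    by measurable
  then show "(\<lambda>\<omega>. stop_noise (f \<omega>) (g \<omega>) x) \<in> M \<rightarrow>\<^sub>M count_space UNIV"
    unfolding stop_noise_def by measurable
qed

lemma measurable_s6v_step [measurable (raw)]:
  assumes [measurable]: "f \<in> M \<rightarrow>\<^sub>M Conf" "g \<in> M \<rightarrow>\<^sub>M discrete_fun_space"
  shows "(\<lambda>\<omega>. s6v_step (f \<omega>) (g \<omega>)) \<in> M \<rightarrow>\<^sub>M Conf"
  unfolding s6v_step_vstep_stop_noise by measurable

lemma measurable_s6v_evol [measurable (raw)]:
  assumes [measurable]: "f \<in> M \<rightarrow>\<^sub>M Conf" "g \<in> M \<rightarrow>\<^sub>M discrete_fun_space"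
  shows "(\<lambda>\<omega>. s6v_evol (g \<omega>) (f \<omega>) t) \<in> M \<rightarrow>\<^sub>M Conf"
proof (induction t)
  case (Suc t)
  have [measurable]: "(\<lambda>\<omega> x. g \<omega> (t, x)) \<in> M \<rightarrow>\<^sub>M discrete_fun_space"
    by (rule measurable_discreteI) measurable
  from Suc show ?case by simp
qed simp

section \<open>The law of a time step\<close>

lemma pmf_pair_fst_snd: "pmf (pair_pmf p q) z = pmf p (fst z) * pmf q (snd z)"
  by (cases z) (simp add: pmf_pair)

lemma distr_iid_reindex:
  assumes "inj f"
  shows "distr (iid p) discrete_fun_space (\<lambda>\<omega> n. \<omega> (f n)) = iid p"
proof -
  have "distr (iid p) (iid p) (\<lambda>\<omega>. \<lambda>n\<in>UNIV. \<omega> (f n)) = iid p"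
    using distr_PiM_reindex[of UNIV "\<lambda>_. measure_pmf p" f UNIV] assms
    by (simp add: measure_pmf.prob_space_axioms)
  moreover have "distr (iid p) (iid p) (\<lambda>\<omega>. \<lambda>n\<in>UNIV. \<omega> (f n))
      = distr (iid p) discrete_fun_space (\<lambda>\<omega> n. \<omega> (f n))"
    by (rule distr_cong) auto
  ultimately show ?thesis by simp
qed

context
  fixes \<eta> :: "int \<Rightarrow> bool"
begin

text \<open>The jump length of the particle at \<open>x\<close> is read off from the coins \<open>coin x 0, coin x 1, \<dots>\<close>. Up to the
  next particle these are the coins \<open>\<psi>\<close> of the vertices passed, afterwards private coins of \<open>x\<close>.
  Since \<open>coin\<close> is injective, the jump lengths are independent and geometric.\<close>

private definition coin :: "int \<Rightarrow> nat \<Rightarrow> int + int + int \<times> nat" where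
  "coin x n = Inr (if \<eta> x \<and> (\<forall>y. x < y \<and> y \<le> x + 1 + int n \<longrightarrow> \<not> \<eta> y)
     then Inl (x + 1 + int n) else Inr (x, n))"

text \<open>A vertex coin is read only by the last particle before the vertex: if two particles
  shared it, the right one would block the empty stretch required of the left one. Private coins
  carry the label of their owner.\<close>

private lemma coin_eqD:
  assumes "coin x n = coin x' n'" shows "x = x'" "n = n'"
proof -
  consider "\<eta> x" "\<eta> x'" "x + 1 + int n = x' + 1 + int n'"
      "\<forall>y. x < y \<and> y \<le> x + 1 + int n \<longrightarrow> \<not> \<eta> y" "\<forall>y. x' < y \<and> y \<le> x' + 1 + int n' \<longrightarrow> \<not> \<eta> y"
    | "x = x'" "n = n'"
    using assms unfolding coin_def by (auto split: if_splits)
  then have "x = x' \<and> n = n'"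
  proof cases
    case 1
    then have "x = x'" by (smt (verit) of_nat_0_le_iff)
    with 1 show ?thesis by auto
  qed auto
  then show "x = x'" "n = n'" by auto
qed

text \<open>\<open>Inl\<close> holds the \<chi> of a site, \<open>Inr (Inl _)\<close> the \<psi> of
  a vertex and \<open>Inr (Inr _)\<close> a private coin; the last two kinds share one law, so
  switching between them does not affect a jump length.\<close>

private definition coins :: "real \<Rightarrow> real \<Rightarrow> (int + int + int \<times> nat \<Rightarrow> bool) measure" where
  "coins b1 b2 = PiM UNIV (\<lambda>i. measure_pmf (case i of Inl _ \<Rightarrow> bernoulli_pmf b1 | Inr _ \<Rightarrow> bernoulli_pmf b2))"

text \<open>The second component counts successes before the first failure, that is, the jump length
  minus one. If no coin fails, \<open>LEAST\<close> has no meaning; that event is null by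
  \<open>coin_fails\<close>.\<close>

private definition coin_w :: "(int + int + int \<times> nat \<Rightarrow> bool) \<Rightarrow> int \<Rightarrow> bool \<times> nat" where
  "coin_w \<omega> x = (\<omega> (Inl x), LEAST n. \<not> \<omega> (coin x n))"

private definition coin_u :: "(int + int + int \<times> nat \<Rightarrow> bool) \<Rightarrow> int \<Rightarrow> bool \<times> bool" where
  "coin_u \<omega> x = (\<omega> (Inl x), \<omega> (Inr (Inl x)))"

text \<open>On an empty stretch the \<open>n\<close>-th coin of \<open>x\<close> is the \<psi> of
  the vertex \<open>x + 1 + n\<close>, so the first failure is precisely the vertex at which the
  path turns upwards.\<close>

private lemma step_coins:
  assumes "\<And>x. \<exists>n. \<not> \<omega> (coin x n)"
  shows "s6v_step \<eta> (coin_w \<omega>) = vstep \<eta> (coin_u \<omega>)"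
proof (rule s6v_step_eq_vstep)
  fix x z assume x: "\<eta> x" "x < z" and emp: "\<And>y. x < y \<Longrightarrow> y \<le> z \<Longrightarrow> \<not> \<eta> y"
  define k where "k = (LEAST n. \<not> \<omega> (coin x n))"
  have k: "\<not> \<omega> (coin x k)" unfolding k_def using assms by (rule LeastI_ex)
  have k': "\<omega> (coin x n)" if "n < k" for n using that not_less_Least unfolding k_def by blast
  have c: "coin x n = Inr (Inl (x + 1 + int n))" if "x + 1 + int n \<le> z" for n
    unfolding coin_def using x emp that by auto
  have "z - x < int (k + 1) \<longleftrightarrow> nat (z - x) \<le> k" using x by auto
  also have "\<dots> \<longleftrightarrow> (\<forall>n<nat (z - x). \<omega> (coin x n))"
    using k k' by (metis le_less_trans linorder_not_less)
  also have "\<dots> \<longleftrightarrow> (\<forall>y. x < y \<and> y \<le> z \<longrightarrow> \<omega> (Inr (Inl y)))"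
  proof safe
    fix y assume *: "\<forall>n<nat (z - x). \<omega> (coin x n)" and y: "x < y" "y \<le> z"
    have "\<omega> (coin x (nat (y - x - 1)))" using * y by auto
    then show "\<omega> (Inr (Inl y))" using c[of "nat (y - x - 1)"] y by simp
  next
    fix n assume *: "\<forall>y. x < y \<and> y \<le> z \<longrightarrow> \<omega> (Inr (Inl y))" and n: "n < nat (z - x)"
    show "\<omega> (coin x n)" using * c[of n] n by auto
  qed
  finally show "z - x < int (snd (coin_w \<omega> x) + 1) \<longleftrightarrow> (\<forall>y. x < y \<and> y \<le> z \<longrightarrow> snd (coin_u \<omega> y))"
    unfolding coin_w_def coin_u_def k_def by simp
qed (simp add: coin_w_def coin_u_def)

private lemma coin_fails:
  assumes "0 < b2" "b2 < 1"
  shows "AE \<omega> in coins b1 b2. \<forall>x. \<exists>n. \<not> \<omega> (coin x n)"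
proof (subst AE_all_countable, rule allI)
  fix x
  interpret prob_space "coins b1 b2" unfolding coins_def by (rule prob_space_PiM_pmf)
  have [measurable]: "(\<lambda>\<omega>. \<omega> i) \<in> coins b1 b2 \<rightarrow>\<^sub>M count_space UNIV" for i
    unfolding coins_def by measurable
  have sp: "space (coins b1 b2) = UNIV" by (simp add: coins_def)
  let ?A = "{\<omega>. \<forall>n. \<omega> (coin x n)}"
  have "{\<omega> \<in> space (coins b1 b2). \<forall>n. \<omega> (coin x n)} \<in> events" by measurable
  then have A: "?A \<in> events" by (simp add: sp)
  have le: "prob ?A \<le> b2 ^ N" for N
  proof -
    let ?J = "coin x ` {..<N}"
    have inj: "inj_on (coin x) {..<N}" using coin_eqD by (auto intro: inj_onI)
    have "{\<omega> \<in> space (coins b1 b2). \<forall>i\<in>?J. \<omega> i = True} \<in> events" by measurable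
    then have B: "{\<omega>. \<forall>i\<in>?J. \<omega> i = True} \<in> events" by (simp add: sp)
    have "prob ?A \<le> prob {\<omega>. \<forall>i\<in>?J. \<omega> i = True}"
      using B by (intro finite_measure_mono) auto
    also have "\<dots> = (\<Prod>i\<in>?J. pmf (case i of Inl _ \<Rightarrow> bernoulli_pmf b1 | Inr _ \<Rightarrow> bernoulli_pmf b2) True)"
      unfolding coins_def by (subst measure_PiM_pmf_cylinder) auto
    also have "\<dots> = (\<Prod>n<N. b2)"
      unfolding prod.reindex[OF inj] using assms by (intro prod.cong) (auto simp: coin_def)
    finally show ?thesis by simp
  qed
  have "(\<lambda>N. b2 ^ N) \<longlonglongrightarrow> 0" using assms by (intro LIMSEQ_realpow_zero) auto
  then have "prob ?A \<le> 0" by (rule LIMSEQ_le_const) (use le in auto)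
  then have "prob ?A = 0" using measure_nonneg[of "coins b1 b2" ?A] by linarith
  then have "AE \<omega> in coins b1 b2. \<omega> \<notin> ?A" using prob_eq_0[OF A] by simp
  then show "AE \<omega> in coins b1 b2. \<exists>n. \<not> \<omega> (coin x n)" by simp
qed

private lemma distr_coin_u:
  "distr (coins b1 b2) discrete_fun_space coin_u = vnoise b1 b2"
proof (rule PiM_pmf_eqI)
  interpret prob_space "coins b1 b2" unfolding coins_def by (rule prob_space_PiM_pmf)
  have [measurable]: "(\<lambda>\<omega>. \<omega> i) \<in> coins b1 b2 \<rightarrow>\<^sub>M count_space UNIV" for i
    unfolding coins_def by measurable
  have [measurable]: "coin_u \<in> coins b1 b2 \<rightarrow>\<^sub>M discrete_fun_space"
    by (rule measurable_discreteI) (unfold coin_u_def, measurable)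
  show "prob_space (distr (coins b1 b2) discrete_fun_space coin_u)" by (rule prob_space_distr) measurable
  fix J :: "int set" and a :: "int \<Rightarrow> bool \<times> bool" assume J: "finite J"
  define K where "K = Inl ` J \<union> Inr ` (Inl ` J :: (int + int \<times> nat) set)"
  define v where "v i = (case i of Inl x \<Rightarrow> fst (a x) | Inr (Inl x) \<Rightarrow> snd (a x) | Inr (Inr _) \<Rightarrow> False)"
    for i :: "int + int + int \<times> nat"
  have "finite K" using J by (simp add: K_def)
  have "measure (distr (coins b1 b2) discrete_fun_space coin_u) {u. \<forall>x\<in>J. u x = a x}
    = prob (coin_u -` {u. \<forall>x\<in>J. u x = a x} \<inter> space (coins b1 b2))"
    by (rule measure_distr[OF _ sets_discrete_cylinder[OF J]]) measurable
  also have "coin_u -` {u. \<forall>x\<in>J. u x = a x} \<inter> space (coins b1 b2) = {\<omega>. \<forall>i\<in>K. \<omega> i = v i}"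
  proof -
    have "(\<forall>x\<in>J. coin_u \<omega> x = a x) \<longleftrightarrow> (\<forall>i\<in>K. \<omega> i = v i)" for \<omega>
      unfolding K_def ball_Un ball_simps by (simp add: v_def coin_u_def prod_eq_iff ball_conj_distrib)
    then show ?thesis by (simp add: coins_def vimage_def)
  qed
  also have "prob \<dots> = (\<Prod>i\<in>K. pmf (case i of Inl _ \<Rightarrow> bernoulli_pmf b1 | Inr _ \<Rightarrow> bernoulli_pmf b2) (v i))"
    unfolding coins_def using \<open>finite K\<close> by (rule measure_PiM_pmf_cylinder)
  also have "\<dots> = (\<Prod>x\<in>J. pmf (bernoulli_pmf b1) (fst (a x))) * (\<Prod>x\<in>J. pmf (bernoulli_pmf b2) (snd (a x)))"
    unfolding K_def using J
    by (subst prod.union_disjoint) (auto simp: prod.reindex v_def inj_on_def o_def)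
  also have "\<dots> = (\<Prod>x\<in>J. pmf (vsite b1 b2) (a x))"
    unfolding prod.distrib[symmetric] by (intro prod.cong) (simp_all add: pmf_pair_fst_snd)
  finally show "measure (distr (coins b1 b2) discrete_fun_space coin_u) {u. \<forall>x\<in>J. u x = a x}
    = (\<Prod>x\<in>J. pmf (vsite b1 b2) (a x))" .
qed simp

private lemma measurable_coin_w:
  "coin_w \<in> coins b1 b2 \<rightarrow>\<^sub>M discrete_fun_space"
proof -
  have [measurable]: "(\<lambda>\<omega>. \<omega> i) \<in> coins b1 b2 \<rightarrow>\<^sub>M count_space UNIV" for i
    unfolding coins_def by measurable
  have "(\<lambda>\<omega>. LEAST n. \<not> \<omega> (coin x n)) \<in> coins b1 b2 \<rightarrow>\<^sub>M count_space UNIV" for x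
    by measurable
  then show ?thesis
    by (intro measurable_discreteI) (unfold coin_w_def, measurable)
qed

text \<open>Almost surely, prescribing \<open>coin_w\<close> on \<open>J\<close> amounts to
  prescribing finitely many coins: for each site its \<chi>, the successes, and the failure that
  ends them. Injectivity of \<open>coin\<close> makes these coins distinct, so the probability
  factorises into geometric weights.\<close>

private lemma distr_coin_w:
  assumes b: "0 < b2" "b2 < 1"
  shows "distr (coins b1 b2) discrete_fun_space coin_w = iid (site_noise b1 b2)"
proof (rule PiM_pmf_eqI)
  interpret prob_space "coins b1 b2" unfolding coins_def by (rule prob_space_PiM_pmf)
  have [measurable]: "(\<lambda>\<omega>. \<omega> i) \<in> coins b1 b2 \<rightarrow>\<^sub>M count_space UNIV" for i
    unfolding coins_def by measurable
  note measurable_coin_w[measurable]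
  have sp: "space (coins b1 b2) = UNIV" by (simp add: coins_def)
  show "prob_space (distr (coins b1 b2) discrete_fun_space coin_w)" by (rule prob_space_distr) measurable
  fix J :: "int set" and a :: "int \<Rightarrow> bool \<times> nat" assume J: "finite J"
  define C where "C = (\<lambda>(x, n). coin x n) ` (SIGMA x:J. {..snd (a x)})"
  \<comment> \<open>Among the coins in \<open>C\<close> exactly the last one read by each site has
    to fail. That this prescription is consistent across sites is the injectivity of
    \<open>coin\<close>.\<close>
  define v where "v i = (case i of Inl x \<Rightarrow> fst (a x) | Inr _ \<Rightarrow> i \<notin> (\<lambda>x. coin x (snd (a x))) ` J)"
    for i :: "int + int + int \<times> nat"
  have fin: "finite C" using J by (simp add: C_def)
  have v_coin: "v (coin x n) \<longleftrightarrow> n < snd (a x)" if "x \<in> J" "n \<le> snd (a x)" for x n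
  proof -
    have "v (coin x n) \<longleftrightarrow> coin x n \<notin> (\<lambda>x. coin x (snd (a x))) ` J"
      by (simp add: v_def coin_def)
    also have "coin x n \<in> (\<lambda>x. coin x (snd (a x))) ` J \<longleftrightarrow> n = snd (a x)"
      using coin_eqD that by (auto simp: image_iff) metis
    finally show ?thesis using that by auto
  qed
  have ev: "coin_w \<omega> x = a x \<longleftrightarrow> \<omega> (Inl x) = fst (a x) \<and> (\<forall>n\<le>snd (a x). \<omega> (coin x n) = (n < snd (a x)))"
    if "\<exists>n. \<not> \<omega> (coin x n)" for \<omega> x
  proof -
    have "(LEAST n. \<not> \<omega> (coin x n)) = snd (a x) \<longleftrightarrow> (\<forall>n\<le>snd (a x). \<omega> (coin x n) = (n < snd (a x)))"
    proof
      assume *: "(LEAST n. \<not> \<omega> (coin x n)) = snd (a x)"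
      have "\<not> \<omega> (coin x (snd (a x)))" using LeastI_ex[OF that] * by simp
      moreover have "\<omega> (coin x n)" if "n < snd (a x)" for n 
        using not_less_Least[of n "\<lambda>n. \<not> \<omega> (coin x n)"] that * by simp
      ultimately show "\<forall>n\<le>snd (a x). \<omega> (coin x n) = (n < snd (a x))"
        by (metis le_neq_implies_less less_irrefl)
    next
      assume *: "\<forall>n\<le>snd (a x). \<omega> (coin x n) = (n < snd (a x))"
      show "(LEAST n. \<not> \<omega> (coin x n)) = snd (a x)"
        using * by (intro Least_equality) (auto intro: leI)
    qed
    then show ?thesis by (auto simp: coin_w_def prod_eq_iff)
  qed
  have "measure (distr (coins b1 b2) discrete_fun_space coin_w) {w. \<forall>x\<in>J. w x = a x}
    = prob (coin_w -` {w. \<forall>x\<in>J. w x = a x} \<inter> space (coins b1 b2))"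
    by (rule measure_distr[OF _ sets_discrete_cylinder[OF J]]) measurable
  also have "coin_w -` {w. \<forall>x\<in>J. w x = a x} \<inter> space (coins b1 b2)
      = {\<omega> \<in> space (coins b1 b2). \<forall>x\<in>J. coin_w \<omega> x = a x}" by auto
  also have "prob \<dots> = prob {\<omega> \<in> space (coins b1 b2). \<forall>i\<in>Inl ` J \<union> C. \<omega> i = v i}"
  proof (rule measure_eq_AE)
    show "AE \<omega> in coins b1 b2. \<omega> \<in> {\<omega> \<in> space (coins b1 b2). \<forall>x\<in>J. coin_w \<omega> x = a x} \<longleftrightarrow>
      \<omega> \<in> {\<omega> \<in> space (coins b1 b2). \<forall>i\<in>Inl ` J \<union> C. \<omega> i = v i}"
      using coin_fails[OF b, of b1]
    proof eventually_elim
      case (elim \<omega>)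
      have "(\<forall>x\<in>J. coin_w \<omega> x = a x) \<longleftrightarrow>
        (\<forall>x\<in>J. \<omega> (Inl x) = fst (a x) \<and> (\<forall>n\<le>snd (a x). \<omega> (coin x n) = (n < snd (a x))))"
        by (intro ball_cong refl ev) (use elim in blast)
      also have "\<dots> \<longleftrightarrow> (\<forall>i\<in>Inl ` J \<union> C. \<omega> i = v i)"
      proof -
        have "(\<forall>i\<in>C. \<omega> i = v i) \<longleftrightarrow> (\<forall>x\<in>J. \<forall>n\<le>snd (a x). \<omega> (coin x n) = v (coin x n))"
          unfolding C_def by fastforce
        also have "\<dots> \<longleftrightarrow> (\<forall>x\<in>J. \<forall>n\<le>snd (a x). \<omega> (coin x n) = (n < snd (a x)))"
          by (intro ball_cong refl all_cong) (simp add: v_coin)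
        finally have "(\<forall>i\<in>C. \<omega> i = v i) \<longleftrightarrow> (\<forall>x\<in>J. \<forall>n\<le>snd (a x). \<omega> (coin x n) = (n < snd (a x)))" .
        moreover have "(\<forall>i\<in>Inl ` J. \<omega> i = v i) \<longleftrightarrow> (\<forall>x\<in>J. \<omega> (Inl x) = fst (a x))"
          by (simp add: v_def)
        ultimately show ?thesis unfolding ball_Un ball_conj_distrib by blast
      qed
      finally show ?case using sp by simp
    qed
    show "{\<omega> \<in> space (coins b1 b2). \<forall>x\<in>J. coin_w \<omega> x = a x} \<in> events"
      using J by measurable
    show "{\<omega> \<in> space (coins b1 b2). \<forall>i\<in>Inl ` J \<union> C. \<omega> i = v i} \<in> events"
      using J fin by measurable
  qed
  also have "\<dots> = (\<Prod>i\<in>Inl ` J \<union> C. pmf (case i of Inl _ \<Rightarrow> bernoulli_pmf b1 | Inr _ \<Rightarrow> bernoulli_pmf b2) (v i))"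
    unfolding coins_def space_PiM_pmf using J fin by (subst measure_PiM_pmf_cylinder[symmetric]) auto
  also have "\<dots> = (\<Prod>i\<in>Inl ` J. pmf (case i of Inl _ \<Rightarrow> bernoulli_pmf b1 | Inr _ \<Rightarrow> bernoulli_pmf b2) (v i))
      * (\<Prod>i\<in>C. pmf (case i of Inl _ \<Rightarrow> bernoulli_pmf b1 | Inr _ \<Rightarrow> bernoulli_pmf b2) (v i))"
    using J fin by (intro prod.union_disjoint) (auto simp: C_def coin_def)
  also have "(\<Prod>i\<in>Inl ` J. pmf (case i of Inl _ \<Rightarrow> bernoulli_pmf b1 | Inr _ \<Rightarrow> bernoulli_pmf b2) (v i))
      = (\<Prod>x\<in>J. pmf (bernoulli_pmf b1) (fst (a x)))"
    by (subst prod.reindex) (auto simp: v_def)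
  also have "(\<Prod>i\<in>C. pmf (case i of Inl _ \<Rightarrow> bernoulli_pmf b1 | Inr _ \<Rightarrow> bernoulli_pmf b2) (v i))
      = (\<Prod>(x, n)\<in>(SIGMA x:J. {..snd (a x)}). if n < snd (a x) then b2 else 1 - b2)"
    unfolding C_def
  proof (subst prod.reindex)
    show "inj_on (\<lambda>(x, n). coin x n) (SIGMA x:J. {..snd (a x)})"
      using coin_eqD by (auto simp: inj_on_def)
    have "pmf (case coin x n of Inl _ \<Rightarrow> bernoulli_pmf b1 | Inr _ \<Rightarrow> bernoulli_pmf b2) (v (coin x n))
      = (if n < snd (a x) then b2 else 1 - b2)" if "x \<in> J" "n \<le> snd (a x)" for x n
      using v_coin[OF that] b by (simp add: coin_def)
    then show "prod ((\<lambda>i. pmf (case i of Inl _ \<Rightarrow> bernoulli_pmf b1 | Inr _ \<Rightarrow> bernoulli_pmf b2) (v i))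
        \<circ> (\<lambda>(x, n). coin x n)) (SIGMA x:J. {..snd (a x)}) =
      (\<Prod>(x, n)\<in>(SIGMA x:J. {..snd (a x)}). if n < snd (a x) then b2 else 1 - b2)"
      by (intro prod.cong) auto
  qed
  also have "\<dots> = (\<Prod>x\<in>J. \<Prod>n\<le>snd (a x). if n < snd (a x) then b2 else 1 - b2)"
    using J by (subst prod.Sigma) auto
  also have "\<dots> = (\<Prod>x\<in>J. pmf (geometric_pmf (1 - b2)) (snd (a x)))"
  proof (intro prod.cong refl)
    fix x
    have "(\<Prod>n\<le>snd (a x). if n < snd (a x) then b2 else 1 - b2) = (\<Prod>n<snd (a x). b2) * (1 - b2)"
      unfolding lessThan_Suc_atMost[symmetric] prod.lessThan_Suc by simp
    then show "(\<Prod>n\<le>snd (a x). if n < snd (a x) then b2 else 1 - b2) = pmf (geometric_pmf (1 - b2)) (snd (a x))"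
      using b by simp
  qed
  also have "(\<Prod>x\<in>J. pmf (bernoulli_pmf b1) (fst (a x))) * (\<Prod>x\<in>J. pmf (geometric_pmf (1 - b2)) (snd (a x)))
      = (\<Prod>x\<in>J. pmf (site_noise b1 b2) (a x))"
    unfolding prod.distrib[symmetric] site_noise_def
    by (intro prod.cong) (simp_all add: pmf_pair_fst_snd)
  finally show "measure (distr (coins b1 b2) discrete_fun_space coin_w) {w. \<forall>x\<in>J. w x = a x}
    = (\<Prod>x\<in>J. pmf (site_noise b1 b2) (a x))" .
qed simp

text \<open>Both laws are images of \<open>coins\<close> under maps that agree almost surely by
  \<open>step_coins\<close>. The map \<open>coin_w\<close> is built from \<open>\<eta>\<close>,
  hence the equality is one of laws for each fixed configuration and not one of processes.\<close>

lemma s6v_step_law: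
  assumes b: "0 < b2" "b2 < 1"
  shows "distr (iid (site_noise b1 b2)) Conf (s6v_step \<eta>) = distr (vnoise b1 b2) Conf (vstep \<eta>)"
proof -
  note measurable_coin_w[measurable]
  have [measurable]: "(\<lambda>\<omega>. \<omega> i) \<in> coins b1 b2 \<rightarrow>\<^sub>M count_space UNIV" for i
    unfolding coins_def by measurable
  have [measurable]: "coin_u \<in> coins b1 b2 \<rightarrow>\<^sub>M discrete_fun_space"
    by (rule measurable_discreteI) (unfold coin_u_def, measurable)
  have const: "(\<lambda>_. \<eta>) \<in> M \<rightarrow>\<^sub>M Conf" for M :: "'z measure" by (rule measurable_const) simp
  have s [measurable]: "s6v_step \<eta> \<in> discrete_fun_space \<rightarrow>\<^sub>M Conf"
    by (rule measurable_s6v_step[OF const]) simp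
  have v [measurable]: "vstep \<eta> \<in> discrete_fun_space \<rightarrow>\<^sub>M Conf"
    by (rule measurable_vstep[OF const]) simp
  have "distr (iid (site_noise b1 b2)) Conf (s6v_step \<eta>) = distr (coins b1 b2) Conf (s6v_step \<eta> \<circ> coin_w)"
    unfolding distr_coin_w[OF b, symmetric] by (rule distr_distr) measurable
  also have "\<dots> = distr (coins b1 b2) Conf (vstep \<eta> \<circ> coin_u)"
  proof (rule distr_cong_AE)
    show "AE \<omega> in coins b1 b2. (s6v_step \<eta> \<circ> coin_w) \<omega> = (vstep \<eta> \<circ> coin_u) \<omega>"
      using coin_fails[OF b, of b1] by eventually_elim (simp add: step_coins)
  qed (auto intro!: measurable_comp[OF _ s] measurable_comp[OF _ v])
  also have "\<dots> = distr (vnoise b1 b2) Conf (vstep \<eta>)"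
    unfolding distr_coin_u[symmetric] by (rule distr_distr[symmetric]) measurable
  finally show ?thesis .
qed

end

text \<open>The noise on the right no longer refers to \<open>\<eta>\<close>, so the same
  realisation can drive two configurations at once.\<close>

lemma M_t_1_eq_vstep:
  assumes b: "0 < b2" "b2 < 1" and sets [measurable_cong]: "sets \<mu> = sets Conf"
  shows "M_t b1 b2 1 \<mu> = distr (\<mu> \<Otimes>\<^sub>M vnoise b1 b2) Conf (\<lambda>(\<eta>, u). vstep \<eta> u)"
  unfolding M_t_def
proof (rule distr_pair_measure_kernel_cong)
  have N[measurable_cong]: "sets (Noise b1 b2) = sets discrete_fun_space" by (simp add: Noise_def)
  have ps: "prob_space (Noise b1 b2)" "prob_space (vnoise b1 b2)"
    unfolding Noise_def by (rule prob_space_PiM_pmf)+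
  then show "sigma_finite_measure (Noise b1 b2)" "sigma_finite_measure (vnoise b1 b2)"
    using prob_space_imp_sigma_finite by blast+
  show "(\<lambda>(\<eta>, \<omega>). s6v_evol \<omega> \<eta> 1) \<in> \<mu> \<Otimes>\<^sub>M Noise b1 b2 \<rightarrow>\<^sub>M Conf"
    unfolding split_beta by measurable
  show "(\<lambda>(\<eta>, u). vstep \<eta> u) \<in> \<mu> \<Otimes>\<^sub>M vnoise b1 b2 \<rightarrow>\<^sub>M Conf"
    unfolding split_beta by measurable
  fix \<eta>
  have [measurable]: "(\<lambda>_. \<eta>) \<in> M \<rightarrow>\<^sub>M Conf" for M :: "'z measure" by (rule measurable_const) simp
  have slice: "distr (Noise b1 b2) discrete_fun_space (\<lambda>\<omega> x. \<omega> (0, x)) = iid (site_noise b1 b2)"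
    unfolding Noise_def by (rule distr_iid_reindex) (simp add: inj_on_def)
  have [measurable]: "(\<lambda>\<omega> x. \<omega> (0, x)) \<in> Noise b1 b2 \<rightarrow>\<^sub>M discrete_fun_space"
    by (rule measurable_discreteI) measurable
  have "distr (Noise b1 b2) Conf (\<lambda>\<omega>. s6v_evol \<omega> \<eta> 1)
      = distr (distr (Noise b1 b2) discrete_fun_space (\<lambda>\<omega> x. \<omega> (0, x))) Conf (s6v_step \<eta>)"
    by (subst distr_distr) (auto simp: o_def intro!: measurable_s6v_step)
  then show "distr (Noise b1 b2) Conf (\<lambda>\<omega>. s6v_evol \<omega> \<eta> 1) = distr (vnoise b1 b2) Conf (vstep \<eta>)"
    unfolding slice s6v_step_law[OF b] .
qed

section \<open>Stationarity of Bernoulli measures\<close>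

lemma measure_pair_Times:
  assumes "prob_space N" "A \<in> sets M" "B \<in> sets N"
  shows "measure (M \<Otimes>\<^sub>M N) (A \<times> B) = measure M A * measure N B"
proof -
  interpret N: prob_space N by fact
  show ?thesis
    using assms by (simp add: measure_def N.emeasure_pair_measure_Times enn2real_mult)
qed

lemma measurable_fun_upd_pair:
  "(\<lambda>(\<omega>, z). fun_upd \<omega> i z) \<in> iid p \<Otimes>\<^sub>M measure_pmf p \<rightarrow>\<^sub>M discrete_fun_space"
proof (rule measurable_discreteI)
  fix x
  show "(\<lambda>\<omega>. (case \<omega> of (\<omega>, z) \<Rightarrow> fun_upd \<omega> i z) x) \<in> iid p \<Otimes>\<^sub>M measure_pmf p \<rightarrow>\<^sub>M count_space UNIV"
    by (cases "x = i") (simp_all add: split_beta)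
qed

lemma distr_iid_resample:
  fixes p :: "'a::countable pmf" and i :: 'i
  shows "distr (iid p \<Otimes>\<^sub>M measure_pmf p) discrete_fun_space (\<lambda>(\<omega>, z). fun_upd \<omega> i z) = iid p"
proof (rule PiM_pmf_eqI)
  interpret I: prob_space "iid p :: ('i \<Rightarrow> 'a) measure" by (rule prob_space_PiM_pmf)
  interpret P: pair_prob_space "iid p :: ('i \<Rightarrow> 'a) measure" "measure_pmf p" by unfold_locales
  note m = measurable_fun_upd_pair[of i p]
  show "prob_space (distr (iid p \<Otimes>\<^sub>M measure_pmf p) discrete_fun_space (\<lambda>(\<omega>, z). fun_upd \<omega> i z))"
    by (rule P.prob_space_distr) (rule m)
  fix J :: "'i set" and a :: "'i \<Rightarrow> 'a" assume J: "finite J"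
  have "measure (distr (iid p \<Otimes>\<^sub>M measure_pmf p) discrete_fun_space (\<lambda>(\<omega>, z). fun_upd \<omega> i z)) {\<omega>. \<forall>i\<in>J. \<omega> i = a i}
    = measure (iid p \<Otimes>\<^sub>M measure_pmf p) ((\<lambda>(\<omega>, z). fun_upd \<omega> i z) -` {\<omega>. \<forall>i\<in>J. \<omega> i = a i} \<inter> space (iid p \<Otimes>\<^sub>M measure_pmf p))"
    by (rule measure_distr[OF m sets_discrete_cylinder[OF J]])
  also have "(\<lambda>(\<omega>, z). fun_upd \<omega> i z) -` {\<omega>. \<forall>i\<in>J. \<omega> i = a i} \<inter> space (iid p \<Otimes>\<^sub>M measure_pmf p)
    = {\<omega>. \<forall>k\<in>J - {i}. \<omega> k = a k} \<times> (if i \<in> J then {a i} else UNIV)"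
    by (auto simp: space_pair_measure split: if_splits)
  also have "measure (iid p \<Otimes>\<^sub>M measure_pmf p) \<dots>
    = measure (iid p) {\<omega>. \<forall>k\<in>J - {i}. \<omega> k = a k} * measure (measure_pmf p) (if i \<in> J then {a i} else UNIV)"
    using J by (intro measure_pair_Times) (auto intro: measure_pmf.prob_space_axioms prob_space_PiM_pmf)
  also have "\<dots> = (\<Prod>k\<in>J - {i}. pmf p (a k)) * (if i \<in> J then pmf p (a i) else 1)"
    using J by (subst measure_PiM_pmf_cylinder) (auto simp: measure_pmf_single)
  also have "\<dots> = (\<Prod>k\<in>J. pmf p (a k))"
    using J by (auto simp: prod.remove)
  finally show "measure (distr (iid p \<Otimes>\<^sub>M measure_pmf p) discrete_fun_space (\<lambda>(\<omega>, z). fun_upd \<omega> i z)) {\<omega>. \<forall>i\<in>J. \<omega> i = a i}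
    = (\<Prod>k\<in>J. pmf p (a k))" .
qed simp

text \<open>Independence by resampling: replacing coordinate \<open>i\<close> by a fresh copy does
  not change the law, and since \<open>A\<close> does not look at this coordinate the event becomes
  a product set.\<close>

lemma iid_coordinate_indep:
  fixes p :: "'a::countable pmf" and i :: 'i
  assumes [measurable]: "Measurable.pred (iid p) A" and local: "\<And>\<omega> z. A (fun_upd \<omega> i z) = A \<omega>"
  shows "measure (iid p) {\<omega>. A \<omega> \<and> \<omega> i = z} = measure (iid p) {\<omega>. A \<omega>} * pmf p z"
proof -
  interpret I: prob_space "iid p :: ('i \<Rightarrow> 'a) measure" by (rule prob_space_PiM_pmf)
  interpret P: pair_prob_space "iid p :: ('i \<Rightarrow> 'a) measure" "measure_pmf p" by unfold_locales
  note m = measurable_fun_upd_pair[of i p]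
  have "{\<omega> \<in> space (iid p). A \<omega> \<and> \<omega> i = z} \<in> sets (iid p)" "{\<omega> \<in> space (iid p). A \<omega>} \<in> sets (iid p)"
    by measurable
  then have ev: "{\<omega>. A \<omega> \<and> \<omega> i = z} \<in> sets discrete_fun_space" "{\<omega>. A \<omega>} \<in> sets discrete_fun_space"
    by auto
  have "measure (iid p) {\<omega>. A \<omega> \<and> \<omega> i = z}
    = measure (iid p \<Otimes>\<^sub>M measure_pmf p) ((\<lambda>(\<omega>, z). fun_upd \<omega> i z) -` {\<omega>. A \<omega> \<and> \<omega> i = z} \<inter> space (iid p \<Otimes>\<^sub>M measure_pmf p))"
    by (subst distr_iid_resample[of p i, symmetric], rule measure_distr[OF m ev(1)])
  also have "(\<lambda>(\<omega>, z). fun_upd \<omega> i z) -` {\<omega>. A \<omega> \<and> \<omega> i = z} \<inter> space (iid p \<Otimes>\<^sub>M measure_pmf p)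
    = {\<omega>. A \<omega>} \<times> {z}"
    by (auto simp: space_pair_measure local)
  also have "measure (iid p \<Otimes>\<^sub>M measure_pmf p) \<dots> = measure (iid p) {\<omega>. A \<omega>} * pmf p z"
    using ev by (subst measure_pair_Times) (auto simp: measure_pmf_single intro: measure_pmf.prob_space_axioms prob_space_PiM_pmf)
  finally show ?thesis .
qed

lemma distr_iid_pair_zip:
  fixes p :: "'a::countable pmf" and q :: "'b::countable pmf"
  shows "distr (iid p \<Otimes>\<^sub>M iid q) discrete_fun_space (\<lambda>(f, g) x::'i. (f x, g x))
    = (iid (pair_pmf p q) :: ('i \<Rightarrow> 'a \<times> 'b) measure)"
proof (rule PiM_pmf_eqI)
  interpret I: prob_space "iid p :: ('i \<Rightarrow> 'a) measure" by (rule prob_space_PiM_pmf)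
  interpret J: prob_space "iid q :: ('i \<Rightarrow> 'b) measure" by (rule prob_space_PiM_pmf)
  interpret P: pair_prob_space "iid p :: ('i \<Rightarrow> 'a) measure" "iid q :: ('i \<Rightarrow> 'b) measure" by unfold_locales
  have m: "(\<lambda>(f, g) x::'i. (f x, g x)) \<in> iid p \<Otimes>\<^sub>M iid q \<rightarrow>\<^sub>M discrete_fun_space"
    by (rule measurable_discreteI) (simp add: split_beta)
  show "prob_space (distr (iid p \<Otimes>\<^sub>M iid q) discrete_fun_space (\<lambda>(f, g) x::'i. (f x, g x)))"
    by (rule P.prob_space_distr) (rule m)
  fix J :: "'i set" and a :: "'i \<Rightarrow> 'a \<times> 'b" assume J: "finite J"
  have "measure (distr (iid p \<Otimes>\<^sub>M iid q) discrete_fun_space (\<lambda>(f, g) x::'i. (f x, g x))) {\<omega>. \<forall>i\<in>J. \<omega> i = a i}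
    = measure (iid p \<Otimes>\<^sub>M iid q) ((\<lambda>(f, g) x::'i. (f x, g x)) -` {\<omega>. \<forall>i\<in>J. \<omega> i = a i} \<inter> space (iid p \<Otimes>\<^sub>M iid q))"
    by (rule measure_distr[OF m sets_discrete_cylinder[OF J]])
  also have "(\<lambda>(f, g) x::'i. (f x, g x)) -` {\<omega>. \<forall>i\<in>J. \<omega> i = a i} \<inter> space (iid p \<Otimes>\<^sub>M iid q)
    = {f. \<forall>i\<in>J. f i = fst (a i)} \<times> {g. \<forall>i\<in>J. g i = snd (a i)}"
    by (simp add: space_pair_measure vimage_def set_eq_iff prod_eq_iff ball_conj_distrib)
  also have "measure (iid p \<Otimes>\<^sub>M iid q) \<dots>
    = measure (iid p) {f. \<forall>i\<in>J. f i = fst (a i)} * measure (iid q) {g. \<forall>i\<in>J. g i = snd (a i)}"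
    using J by (intro measure_pair_Times) (auto intro: measure_pmf.prob_space_axioms prob_space_PiM_pmf)
  also have "\<dots> = (\<Prod>i\<in>J. pmf (pair_pmf p q) (a i))"
    using J by (simp add: measure_PiM_pmf_cylinder pmf_pair_fst_snd prod.distrib)
  finally show "measure (distr (iid p \<Otimes>\<^sub>M iid q) discrete_fun_space (\<lambda>(f, g) x::'i. (f x, g x))) {\<omega>. \<forall>i\<in>J. \<omega> i = a i}
    = (\<Prod>i\<in>J. pmf (pair_pmf p q) (a i))" .
qed simp

section \<open>A row of vertices fed with Bernoulli input\<close>

context
  fixes b1 b2 r :: real
  assumes b: "0 < b1" "b1 < 1" "0 < b2" "b2 < 1" and r: "0 \<le> r" "r \<le> 1"
begin

text \<open>\<open>kap\<close> is the density of horizontal paths for which (vertical, horizontal) Bernoulli input of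
  densities \<open>(r, kap)\<close> at a vertex reproduces itself as output.\<close>

private definition kap :: real where
  "kap = r * (1 - b1) / (r * (1 - b1) + (1 - r) * (1 - b2))"

private lemma denom_pos: "0 < r * (1 - b1) + (1 - r) * (1 - b2)"
proof (cases "r = 0")
  case False
  then have "0 < r * (1 - b1)" "0 \<le> (1 - r) * (1 - b2)" using b r by auto
  then show ?thesis by linarith
qed (use b in simp)

private lemma kap_range: "0 \<le> kap" "kap \<le> 1"
proof -
  have "0 \<le> r * (1 - b1)" "0 \<le> (1 - r) * (1 - b2)" using b r by auto
  then show "0 \<le> kap" "kap \<le> 1"
    unfolding kap_def using denom_pos by (auto simp: divide_le_eq)
qed

text \<open>A lone vertical path turns right as often as a lone horizontal path turns up. The other
  two inputs, no path and both paths, pass through unchanged.\<close>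

private lemma detailed_balance: "r * (1 - kap) * (1 - b1) = (1 - r) * kap * (1 - b2)"
  unfolding kap_def using denom_pos by (simp add: field_simps)

private abbreviation site where "site \<equiv> pair_pmf (bernoulli_pmf r) (vsite b1 b2)"
private abbreviation Z :: "(int \<Rightarrow> bool \<times> bool \<times> bool) measure" where "Z \<equiv> iid site"
private abbreviation V where "V \<zeta> x \<equiv> vstep (\<lambda>y. fst (\<zeta> y)) (\<lambda>y. snd (\<zeta> y)) x"
private abbreviation H where "H \<zeta> x \<equiv> hflux (\<lambda>y. fst (\<zeta> y)) (\<lambda>y. snd (\<zeta> y)) x"

private definition vout :: "bool \<Rightarrow> bool \<times> bool \<times> bool \<Rightarrow> bool" where
  "vout h z = (if fst z then h \<or> fst (snd z) else h \<and> \<not> snd (snd z))"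
private definition hout :: "bool \<Rightarrow> bool \<times> bool \<times> bool \<Rightarrow> bool" where
  "hout h z = (if fst z then h \<or> \<not> fst (snd z) else h \<and> snd (snd z))"

private lemma V_out: "V \<zeta> x = vout (H \<zeta> (x - 1)) (\<zeta> x)"
  by (simp add: vstep_def vout_def)

private lemma H_out: "H \<zeta> x = hout (H \<zeta> (x - 1)) (\<zeta> x)"
  by (subst hflux_rec) (simp add: hout_def)

private lemma meas_Z [measurable]:
  "(\<lambda>\<zeta> y. fst (\<zeta> y)) \<in> Z \<rightarrow>\<^sub>M Conf" "(\<lambda>\<zeta> y. snd (\<zeta> y)) \<in> Z \<rightarrow>\<^sub>M discrete_fun_space"
  by (auto intro!: measurable_ConfI measurable_discreteI)

private lemma pred_V [measurable]: "Measurable.pred Z (\<lambda>\<zeta>. V \<zeta> x)"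
  by measurable

private lemma pred_H [measurable]: "Measurable.pred Z (\<lambda>\<zeta>. H \<zeta> x)"
  by measurable

text \<open>Both \<open>A\<close> and the flux into \<open>x\<close> are functions of the sites to
  the left of \<open>x\<close>, so the data at \<open>x\<close> are independent of them; what
  remains is a finite sum over the local input.\<close>

private lemma out_prob:
  assumes [measurable]: "Measurable.pred Z A"
    and local: "\<And>\<zeta> \<zeta>'. (\<And>y. y \<le> x - 1 \<Longrightarrow> \<zeta> y = \<zeta>' y) \<Longrightarrow> A \<zeta> = A \<zeta>'"
  shows "measure Z {\<zeta>. A \<zeta> \<and> V \<zeta> x \<in> F \<and> H \<zeta> x = g} =
    (\<Sum>h\<in>UNIV. \<Sum>z\<in>UNIV. of_bool (vout h z \<in> F \<and> hout h z = g) * pmf site z *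
       measure Z {\<zeta>. A \<zeta> \<and> H \<zeta> (x - 1) = h})"
proof -
  interpret prob_space Z by (rule prob_space_PiM_pmf)
  define S where "S = {(h, z). vout h z \<in> F \<and> hout h z = g}"
  define B where "B = (\<lambda>(h, z). {\<zeta>. (A \<zeta> \<and> H \<zeta> (x - 1) = h) \<and> \<zeta> x = z})"
  have B_ev: "B i \<in> sets Z" for i
  proof -
    have "{\<zeta> \<in> space Z. (A \<zeta> \<and> H \<zeta> (x - 1) = fst i) \<and> \<zeta> x = snd i} \<in> sets Z" by measurable
    then show ?thesis by (simp add: B_def split_beta)
  qed
  have "{\<zeta>. A \<zeta> \<and> V \<zeta> x \<in> F \<and> H \<zeta> x = g} = (\<Union>i\<in>S. B i)"
    unfolding V_out[of _ x] H_out[of _ x] S_def B_def by auto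
  then have "measure Z {\<zeta>. A \<zeta> \<and> V \<zeta> x \<in> F \<and> H \<zeta> x = g} = (\<Sum>i\<in>S. measure Z (B i))"
    using B_ev by (subst finite_measure_finite_Union[symmetric])
      (auto simp: disjoint_family_on_def B_def)
  also have "\<dots> = (\<Sum>i\<in>UNIV. of_bool (i \<in> S) * measure Z (B i))"
    by (intro sum.mono_neutral_cong_left) auto
  also have "\<dots> = (\<Sum>h\<in>UNIV. \<Sum>z\<in>UNIV. of_bool ((h, z) \<in> S) * measure Z (B (h, z)))"
    unfolding sum.cartesian_product UNIV_Times_UNIV by (intro sum.cong) auto
  finally have sum: "measure Z {\<zeta>. A \<zeta> \<and> V \<zeta> x \<in> F \<and> H \<zeta> x = g}
    = (\<Sum>h\<in>UNIV. \<Sum>z\<in>UNIV. of_bool ((h, z) \<in> S) * measure Z (B (h, z)))" .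
  have ind: "measure Z (B (h, z)) = measure Z {\<zeta>. A \<zeta> \<and> H \<zeta> (x - 1) = h} * pmf site z" for h z
    unfolding B_def prod.case
  proof (rule iid_coordinate_indep)
    fix \<zeta> z
    have "A (fun_upd \<zeta> x z) = A \<zeta>" by (rule local) simp
    moreover have "H (fun_upd \<zeta> x z) (x - 1) = H \<zeta> (x - 1)"
      by (rule hflux_cong_left) auto
    ultimately show "(A (fun_upd \<zeta> x z) \<and> H (fun_upd \<zeta> x z) (x - 1) = h) = (A \<zeta> \<and> H \<zeta> (x - 1) = h)"
      by simp
  qed measurable
  show ?thesis unfolding sum ind by (intro sum.cong refl) (simp add: S_def mult_ac)
qed

private lemma sum_site:
  "(\<Sum>z\<in>UNIV. f z * pmf site z) = (\<Sum>e\<in>UNIV. \<Sum>c\<in>UNIV. \<Sum>p\<in>UNIV.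
     f (e, c, p) * (pmf (bernoulli_pmf r) e * (pmf (bernoulli_pmf b1) c * pmf (bernoulli_pmf b2) p)))"
  unfolding sum.cartesian_product UNIV_Times_UNIV by (intro sum.cong) (auto simp: pmf_pair)

text \<open>By shift invariance the flux into \<open>x\<close> and the flux out of \<open>x\<close>
  have the same probability. The vertex recursion turns this into a linear equation, and positivity
  of the denominator of \<open>kap\<close> makes the solution unique.\<close>

private lemma H_prob: "measure Z {\<zeta>. H \<zeta> x = g} = pmf (bernoulli_pmf kap) g"
proof -
  interpret prob_space Z by (rule prob_space_PiM_pmf)
  define k where "k = measure Z {\<zeta>. H \<zeta> x}"
  have ev: "{\<zeta>. H \<zeta> y} \<in> sets Z" for y
  proof -
    have "{\<zeta> \<in> space Z. H \<zeta> y} \<in> sets Z" by measurable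
    then show ?thesis by simp
  qed
  have compl: "measure Z {\<zeta>. \<not> H \<zeta> y} = 1 - measure Z {\<zeta>. H \<zeta> y}" for y
    using prob_compl[OF ev[of y]] by (simp add: Compl_eq_Diff_UNIV[symmetric] Collect_neg_eq)
  have sh: "measure Z {\<zeta>. H \<zeta> (x - 1)} = k"
  proof -
    have m: "(\<lambda>\<zeta> y. \<zeta> (y + (-1))) \<in> Z \<rightarrow>\<^sub>M discrete_fun_space"
      by (rule measurable_discreteI) measurable
    have "k = measure (distr Z discrete_fun_space (\<lambda>\<zeta> y. \<zeta> (y + (-1)))) {\<zeta>. H \<zeta> x}"
      unfolding k_def by (subst distr_iid_reindex) (auto simp: inj_on_def)
    also have "\<dots> = measure Z ((\<lambda>\<zeta> y. \<zeta> (y + (-1))) -` {\<zeta>. H \<zeta> x} \<inter> space Z)"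
      using ev by (intro measure_distr[OF m]) simp
    also have "(\<lambda>\<zeta> y. \<zeta> (y + (-1))) -` {\<zeta>. H \<zeta> x} \<inter> space Z = {\<zeta>. H \<zeta> (x - 1)}"
    proof -
      have "H (\<lambda>y. \<zeta> (y + (-1))) x = H \<zeta> (x - 1)" for \<zeta>
        using hflux_shift[of "\<lambda>y. fst (\<zeta> y)" "-1" "\<lambda>y. snd (\<zeta> y)" x] by simp
      then show ?thesis by (simp add: vimage_def)
    qed
    finally show ?thesis by simp
  qed
  have "k = measure Z {\<zeta>. True \<and> V \<zeta> x \<in> UNIV \<and> H \<zeta> x = True}" by (simp add: k_def)
  also have "\<dots> = (\<Sum>h\<in>UNIV. \<Sum>z\<in>UNIV. of_bool (vout h z \<in> UNIV \<and> hout h z = True) * pmf site z *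
       measure Z {\<zeta>. True \<and> H \<zeta> (x - 1) = h})"
    by (rule out_prob) auto
  also have "\<dots> = (\<Sum>h\<in>UNIV. (\<Sum>z\<in>UNIV. of_bool (hout h z) * pmf site z) * measure Z {\<zeta>. H \<zeta> (x - 1) = h})"
    unfolding sum_distrib_right by (intro sum.cong refl) simp
  also have "\<dots> = (1 - k) * r * (1 - b1) + k * (r + (1 - r) * b2)"
    using sh compl[of "x - 1"] b r unfolding sum_site
    by (simp add: UNIV_bool hout_def) (simp add: algebra_simps)
  finally have "k * (r * (1 - b1) + (1 - r) * (1 - b2)) = r * (1 - b1)"
    by (simp add: algebra_simps)
  then have k: "k = kap" unfolding kap_def using denom_pos by (simp add: field_simps)
  show ?thesis
    using k k_def compl[of x] kap_range by (cases g) auto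
qed

text \<open>One vertex maps independent inputs of densities \<open>r\<close> and \<open>kap\<close>
  to independent outputs of the same densities. Arbitrary sets \<open>F\<close> are allowed so that
  a site may also be left unconstrained.\<close>

private lemma local_identity:
  "(\<Sum>h\<in>UNIV. \<Sum>z\<in>UNIV. of_bool (vout h z \<in> F \<and> hout h z = g) * pmf site z * pmf (bernoulli_pmf kap) h)
    = measure_pmf.prob (bernoulli_pmf r) F * pmf (bernoulli_pmf kap) g"
proof -
  have F: "measure_pmf.prob (bernoulli_pmf r) F = of_bool (True \<in> F) * r + of_bool (False \<in> F) * (1 - r)"
  proof -
    have "measure_pmf.prob (bernoulli_pmf r) F = (\<Sum>e\<in>F. pmf (bernoulli_pmf r) e)"
      by (rule measure_measure_pmf_finite) simp
    also have "\<dots> = (\<Sum>e\<in>UNIV. of_bool (e \<in> F) * pmf (bernoulli_pmf r) e)"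
      by (intro sum.mono_neutral_cong_left) auto
    finally show ?thesis using r by (simp add: UNIV_bool)
  qed
  have db: "r * (1 - kap) * (1 - b1) = (1 - r) * kap * (1 - b2)" by (rule detailed_balance)
  have "(\<Sum>h\<in>UNIV. \<Sum>z\<in>UNIV. of_bool (vout h z \<in> F \<and> hout h z = g) * pmf site z * pmf (bernoulli_pmf kap) h)
    = (\<Sum>h\<in>UNIV. (\<Sum>z\<in>UNIV. of_bool (vout h z \<in> F \<and> hout h z = g) * pmf site z) * pmf (bernoulli_pmf kap) h)"
    unfolding sum_distrib_right ..
  also have "\<dots> = measure_pmf.prob (bernoulli_pmf r) F * pmf (bernoulli_pmf kap) g"
    unfolding sum_site F using b r kap_range db
    by (cases g; cases "True \<in> F"; cases "False \<in> F")
      (simp_all add: UNIV_bool hout_def vout_def, (simp add: algebra_simps; fail)+)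
  finally show ?thesis .
qed

text \<open>A Burke-type property, obtained by sweeping from left to right. The statement includes
  the outgoing flux, independent of all outputs of the window, because the next vertex takes it as
  input.\<close>

private lemma window_prob:
  "measure Z {\<zeta>. (\<forall>i\<in>{a<..a + int n}. V \<zeta> i \<in> F i) \<and> H \<zeta> (a + int n) = g}
    = (\<Prod>i\<in>{a<..a + int n}. measure_pmf.prob (bernoulli_pmf r) (F i)) * pmf (bernoulli_pmf kap) g"
proof (induction n arbitrary: g)
  case 0
  then show ?case using H_prob by simp
next
  case (Suc n)
  let ?x = "a + int (Suc n)"
  let ?A = "\<lambda>\<zeta>. \<forall>i\<in>{a<..a + int n}. V \<zeta> i \<in> F i"
  have x: "?x - 1 = a + int n" by simp
  have ins: "{a<..?x} = insert ?x {a<..a + int n}" by auto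
  have "measure Z {\<zeta>. (\<forall>i\<in>{a<..?x}. V \<zeta> i \<in> F i) \<and> H \<zeta> ?x = g}
    = measure Z {\<zeta>. ?A \<zeta> \<and> V \<zeta> ?x \<in> F ?x \<and> H \<zeta> ?x = g}"
    unfolding ins by (rule arg_cong[where f="measure Z"]) auto
  also have "\<dots> = (\<Sum>h\<in>UNIV. \<Sum>z\<in>UNIV. of_bool (vout h z \<in> F ?x \<and> hout h z = g) * pmf site z *
       measure Z {\<zeta>. ?A \<zeta> \<and> H \<zeta> (?x - 1) = h})"
  proof (rule out_prob)
    show "Measurable.pred Z ?A" by measurable
    fix \<zeta> \<zeta>' :: "int \<Rightarrow> bool \<times> bool \<times> bool" assume *: "\<And>y. y \<le> ?x - 1 \<Longrightarrow> \<zeta> y = \<zeta>' y"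
    have "V \<zeta> i = V \<zeta>' i" if "i \<in> {a<..a + int n}" for i
      by (rule vstep_cong_left) (use that * in auto)
    then show "?A \<zeta> = ?A \<zeta>'" by simp
  qed
  also have "\<dots> = (\<Prod>i\<in>{a<..a + int n}. measure_pmf.prob (bernoulli_pmf r) (F i)) *
    (\<Sum>h\<in>UNIV. \<Sum>z\<in>UNIV. of_bool (vout h z \<in> F ?x \<and> hout h z = g) * pmf site z * pmf (bernoulli_pmf kap) h)"
    unfolding x Suc.IH by (simp add: sum_distrib_left mult_ac)
  also have "\<dots> = (\<Prod>i\<in>{a<..?x}. measure_pmf.prob (bernoulli_pmf r) (F i)) * pmf (bernoulli_pmf kap) g"
    unfolding local_identity ins by simp
  finally show ?case .
qed

lemma vstep_Upsilon:
  "distr (Upsilon r \<Otimes>\<^sub>M vnoise b1 b2) Conf (\<lambda>(\<eta>, u). vstep \<eta> u) = Upsilon r"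
proof -
  interpret prob_space Z by (rule prob_space_PiM_pmf)
  have V_m: "(\<lambda>\<zeta>. vstep (\<lambda>y. fst (\<zeta> y)) (\<lambda>y. snd (\<zeta> y))) \<in> Z \<rightarrow>\<^sub>M Conf" by measurable
  have zip_m: "(\<lambda>(f, g) x. (f x, g x)) \<in> Upsilon r \<Otimes>\<^sub>M vnoise b1 b2 \<rightarrow>\<^sub>M discrete_fun_space"
    unfolding Upsilon_def by (rule measurable_discreteI) (simp add: split_beta)
  have "distr (Upsilon r \<Otimes>\<^sub>M vnoise b1 b2) Conf (\<lambda>(\<eta>, u). vstep \<eta> u)
    = distr (distr (Upsilon r \<Otimes>\<^sub>M vnoise b1 b2) discrete_fun_space (\<lambda>(f, g) x. (f x, g x))) Conf
        (\<lambda>\<zeta>. vstep (\<lambda>y. fst (\<zeta> y)) (\<lambda>y. snd (\<zeta> y)))"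
    using V_m by (subst distr_distr[OF _ zip_m]) (auto simp: o_def split_beta cong: distr_cong)
  also have "\<dots> = distr Z Conf (\<lambda>\<zeta>. vstep (\<lambda>y. fst (\<zeta> y)) (\<lambda>y. snd (\<zeta> y)))"
    unfolding Upsilon_def distr_iid_pair_zip ..
  also have "\<dots> = Upsilon r"
    unfolding Upsilon_def
  proof (rule PiM_pmf_eqI)
    show "prob_space (distr Z Conf (\<lambda>\<zeta>. vstep (\<lambda>y. fst (\<zeta> y)) (\<lambda>y. snd (\<zeta> y))))"
      by (rule prob_space_distr[OF V_m])
    show "sets (distr Z Conf (\<lambda>\<zeta>. vstep (\<lambda>y. fst (\<zeta> y)) (\<lambda>y. snd (\<zeta> y)))) = sets discrete_fun_space"
      by (simp add: Conf_def)
    fix J :: "int set" and e :: "int \<Rightarrow> bool" assume J: "finite J"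
    obtain a n where an: "J \<subseteq> {a<..a + int n}"
    proof -
      obtain m where "\<forall>j\<in>J. \<bar>j\<bar> \<le> m" using J
        by (metis finite_imageI Max_ge image_eqI)
      then have "J \<subseteq> {- m - 1<..- m - 1 + int (nat (2 * m + 1))}" by force
      then show thesis by (rule that)
    qed
    \<comment> \<open>Sites of the window outside \<open>J\<close> are left free. This extends an
      arbitrary finite set of sites to the contiguous window that the sweep requires.\<close>
    define F where "F i = (if i \<in> J then {e i} else UNIV)" for i
    have evw: "{\<zeta>. (\<forall>i\<in>{a<..a + int n}. V \<zeta> i \<in> F i) \<and> H \<zeta> (a + int n) = g} \<in> sets Z" for g
    proof -
      have "{\<zeta> \<in> space Z. (\<forall>i\<in>{a<..a + int n}. V \<zeta> i \<in> F i) \<and> H \<zeta> (a + int n) = g} \<in> sets Z" by measurable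
      then show ?thesis by simp
    qed
    have "measure (distr Z Conf (\<lambda>\<zeta>. vstep (\<lambda>y. fst (\<zeta> y)) (\<lambda>y. snd (\<zeta> y)))) {\<eta>. \<forall>i\<in>J. \<eta> i = e i}
      = measure Z {\<zeta>. \<forall>i\<in>J. V \<zeta> i = e i}"
      by (subst measure_distr[OF V_m]) (use J in \<open>auto simp: Conf_def vimage_def\<close>)
    also have "{\<zeta>. \<forall>i\<in>J. V \<zeta> i = e i} =
        {\<zeta>. (\<forall>i\<in>{a<..a + int n}. V \<zeta> i \<in> F i) \<and> H \<zeta> (a + int n) = True} \<union>
        {\<zeta>. (\<forall>i\<in>{a<..a + int n}. V \<zeta> i \<in> F i) \<and> H \<zeta> (a + int n) = False}"
    proof -
      have "(\<forall>i\<in>J. V \<zeta> i = e i) \<longleftrightarrow> (\<forall>i\<in>{a<..a + int n}. V \<zeta> i \<in> F i)" for \<zeta>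
      proof
        assume *: "\<forall>i\<in>J. V \<zeta> i = e i"
        show "\<forall>i\<in>{a<..a + int n}. V \<zeta> i \<in> F i"
        proof
          fix i show "V \<zeta> i \<in> F i" using * by (cases "i \<in> J") (simp_all add: F_def)
        qed
      next
        assume *: "\<forall>i\<in>{a<..a + int n}. V \<zeta> i \<in> F i"
        show "\<forall>i\<in>J. V \<zeta> i = e i"
        proof
          fix i assume i: "i \<in> J"
          then have "V \<zeta> i \<in> F i" using * an by blast
          with i show "V \<zeta> i = e i" by (simp add: F_def)
        qed
      qed
      then have "{\<zeta>. \<forall>i\<in>J. V \<zeta> i = e i} = {\<zeta>. \<forall>i\<in>{a<..a + int n}. V \<zeta> i \<in> F i}" by (rule Collect_cong)
      then show ?thesis by blast
    qed
    also have "measure Z \<dots> =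
        measure Z {\<zeta>. (\<forall>i\<in>{a<..a + int n}. V \<zeta> i \<in> F i) \<and> H \<zeta> (a + int n) = True} +
        measure Z {\<zeta>. (\<forall>i\<in>{a<..a + int n}. V \<zeta> i \<in> F i) \<and> H \<zeta> (a + int n) = False}"
      by (rule finite_measure_Union[OF evw evw]) auto
    also have "\<dots> = (\<Prod>i\<in>{a<..a + int n}. measure_pmf.prob (bernoulli_pmf r) (F i))"
      unfolding window_prob using kap_range by (simp add: algebra_simps)
    also have "\<dots> = (\<Prod>i\<in>J. pmf (bernoulli_pmf r) (e i))"
      using an by (intro prod.mono_neutral_cong_right) (auto simp: F_def measure_pmf_single)
    finally show "measure (distr Z Conf (\<lambda>\<zeta>. vstep (\<lambda>y. fst (\<zeta> y)) (\<lambda>y. snd (\<zeta> y)))) {\<eta>. \<forall>i\<in>J. \<eta> i = e i}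
      = (\<Prod>i\<in>J. pmf (bernoulli_pmf r) (e i))" .
  qed
  finally show ?thesis .
qed

end

section \<open>Spatial averages under an extremal measure\<close>

lemma measurable_shift [measurable]: "(\<lambda>\<eta> x. \<eta> (x + m)) \<in> Conf \<rightarrow>\<^sub>M Conf"
  by (rule measurable_ConfI) measurable

text \<open>Conditioning commutes with an evolution that preserves \<open>B\<close> for every
  realisation of the noise: the event that the evolved configuration lies in \<open>B\<close> and in
  \<open>X\<close> is the event that the initial one lies in \<open>B\<close> and the evolved one in
  \<open>X\<close>.\<close>

lemma uniform_measure_TIS:
  assumes \<mu>: "\<mu> \<in> TIS b1 b2" and B: "B \<in> sets Conf" and pos: "emeasure \<mu> B \<noteq> 0"
    and shift: "\<And>m \<eta>. (\<lambda>x. \<eta> (x + m)) \<in> B \<longleftrightarrow> \<eta> \<in> B"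
    and step: "\<And>\<eta> w. s6v_step \<eta> w \<in> B \<longleftrightarrow> \<eta> \<in> B"
  shows "uniform_measure \<mu> B \<in> TIS b1 b2"
proof -
  have "prob_space \<mu>" and sets [measurable_cong]: "sets \<mu> = sets Conf"
    and ti: "\<And>m. S_m m \<mu> = \<mu>" and st: "\<And>t. M_t b1 b2 t \<mu> = \<mu>"
    using \<mu> by (auto simp: TIS_def conf_prob_def translation_invariant_def stationary_def)
  interpret prob_space \<mu> by fact
  interpret N: prob_space "Noise b1 b2" unfolding Noise_def by (rule prob_space_PiM_pmf)
  have [measurable_cong]: "sets (Noise b1 b2) = sets discrete_fun_space" by (simp add: Noise_def)
  have sp [simp]: "space \<mu> = UNIV" using sets_eq_imp_space_eq[OF sets] by simp
  have spN [simp]: "space (Noise b1 b2) = UNIV" by (simp add: Noise_def)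
  let ?U = "uniform_measure \<mu> B"
  have setsU [measurable_cong]: "sets ?U = sets Conf" by (simp add: sets)
  have "prob_space ?U"
    using pos emeasure_finite by (intro prob_space_uniform_measure) auto
  moreover have "S_m m ?U = ?U" for m
  proof (rule measure_eqI)
    fix X assume "X \<in> sets (S_m m ?U)"
    then have X [measurable]: "X \<in> sets Conf" by (simp add: S_m_def)
    have m: "(\<lambda>\<eta> x. \<eta> (x + m)) \<in> \<mu> \<rightarrow>\<^sub>M Conf" by measurable
    have Ev: "(\<lambda>\<eta> x. \<eta> (x + m)) -` X \<inter> space ?U \<in> sets \<mu>"
      using measurable_sets[OF m X] by simp
    have "emeasure (S_m m ?U) X = emeasure ?U ((\<lambda>\<eta> x. \<eta> (x + m)) -` X \<inter> space ?U)"
      unfolding S_m_def by (rule emeasure_distr) measurable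
    also have "\<dots> = emeasure \<mu> (B \<inter> ((\<lambda>\<eta> x. \<eta> (x + m)) -` X \<inter> space ?U)) / emeasure \<mu> B"
      using B Ev sets by (subst emeasure_uniform_measure) auto
    also have "B \<inter> ((\<lambda>\<eta> x. \<eta> (x + m)) -` X \<inter> space ?U) = (\<lambda>\<eta> x. \<eta> (x + m)) -` (B \<inter> X) \<inter> space \<mu>"
      using shift by auto
    also have "emeasure \<mu> \<dots> = emeasure (S_m m \<mu>) (B \<inter> X)"
      unfolding S_m_def by (rule emeasure_distr[symmetric, OF m sets.Int[OF B X]])
    also have "\<dots> / emeasure \<mu> B = emeasure ?U X"
      unfolding ti using B X sets by (subst emeasure_uniform_measure) simp_all
    finally show "emeasure (S_m m ?U) X = emeasure ?U X" .
  qed (simp add: S_m_def sets)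
  moreover have "M_t b1 b2 t ?U = ?U" for t
  proof (rule measure_eqI)
    fix X assume "X \<in> sets (M_t b1 b2 t ?U)"
    then have X [measurable]: "X \<in> sets Conf" by (simp add: M_t_def)
    have evol: "s6v_evol \<omega> \<eta> t \<in> B \<longleftrightarrow> \<eta> \<in> B" for \<omega> \<eta>
      by (induction t) (simp_all add: step)
    let ?f = "\<lambda>(\<eta>, \<omega>). s6v_evol \<omega> \<eta> t"
    have f1 [measurable]: "?f \<in> ?U \<Otimes>\<^sub>M Noise b1 b2 \<rightarrow>\<^sub>M Conf" unfolding split_beta by measurable
    have f2 [measurable]: "?f \<in> \<mu> \<Otimes>\<^sub>M Noise b1 b2 \<rightarrow>\<^sub>M Conf" unfolding split_beta by measurable
    define A where "A = ?f -` X"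
    define A' where "A' = ?f -` (B \<inter> X)"
    have spp: "space (?U \<Otimes>\<^sub>M Noise b1 b2) = UNIV" "space (\<mu> \<Otimes>\<^sub>M Noise b1 b2) = UNIV"
      by (simp_all add: space_pair_measure)
    have AU: "A \<in> sets (?U \<Otimes>\<^sub>M Noise b1 b2)"
      using measurable_sets[OF f1 X] unfolding A_def spp Int_UNIV_right .
    have AM: "A \<in> sets (\<mu> \<Otimes>\<^sub>M Noise b1 b2)"
      using measurable_sets[OF f2 X] unfolding A_def spp Int_UNIV_right .
    have AM': "A' \<in> sets (\<mu> \<Otimes>\<^sub>M Noise b1 b2)"
      using measurable_sets[OF f2 sets.Int[OF B X]] unfolding A'_def spp Int_UNIV_right .
    have "emeasure (M_t b1 b2 t ?U) X = emeasure (?U \<Otimes>\<^sub>M Noise b1 b2) A"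
      unfolding M_t_def emeasure_distr[OF f1 X] A_def spp Int_UNIV_right ..
    also have "\<dots> = (\<integral>\<^sup>+\<eta>. emeasure (Noise b1 b2) (Pair \<eta> -` A) \<partial>?U)"
      by (rule N.emeasure_pair_measure_alt[OF AU])
    also have "\<dots> = (\<integral>\<^sup>+\<eta>. emeasure (Noise b1 b2) (Pair \<eta> -` A) * indicator B \<eta> \<partial>\<mu>) / emeasure \<mu> B"
      by (rule nn_integral_uniform_measure[OF N.measurable_emeasure_Pair[OF AM]]) (simp only: sets B)
    also have "(\<integral>\<^sup>+\<eta>. emeasure (Noise b1 b2) (Pair \<eta> -` A) * indicator B \<eta> \<partial>\<mu>)
      = (\<integral>\<^sup>+\<eta>. emeasure (Noise b1 b2) (Pair \<eta> -` A') \<partial>\<mu>)"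
    proof (rule nn_integral_cong)
      fix \<eta>
      have "Pair \<eta> -` A' = (if \<eta> \<in> B then Pair \<eta> -` A else {})"
        unfolding A_def A'_def using evol by auto
      then show "emeasure (Noise b1 b2) (Pair \<eta> -` A) * indicator B \<eta> = emeasure (Noise b1 b2) (Pair \<eta> -` A')"
        by (simp add: indicator_def)
    qed
    also have "\<dots> = emeasure (\<mu> \<Otimes>\<^sub>M Noise b1 b2) A'"
      by (rule N.emeasure_pair_measure_alt[OF AM', symmetric])
    also have "\<dots> = emeasure (M_t b1 b2 t \<mu>) (B \<inter> X)"
      unfolding M_t_def emeasure_distr[OF f2 sets.Int[OF B X]] A'_def spp Int_UNIV_right ..
    also have "\<dots> / emeasure \<mu> B = emeasure ?U X"
      unfolding st using B X sets by (subst emeasure_uniform_measure) simp_all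
    finally show "emeasure (M_t b1 b2 t ?U) X = emeasure ?U X" .
  qed (simp add: M_t_def sets)
  ultimately show ?thesis
    using setsU by (simp add: TIS_def conf_prob_def translation_invariant_def stationary_def)
qed

text \<open>Otherwise \<open>\<mu>\<close> is a proper mixture of its conditionings on
  \<open>B\<close> and on the complement. Both belong to \<open>TIS\<close>, so extremality
  identifies the conditioning on \<open>B\<close> with \<open>\<mu>\<close>, which gives
  \<open>B\<close> full measure.\<close>

lemma extremal_invariant_event:
  assumes ext: "extremal_in (TIS b1 b2) \<mu>" and B: "B \<in> sets Conf"
    and shift: "\<And>m \<eta>. (\<lambda>x. \<eta> (x + m)) \<in> B \<longleftrightarrow> \<eta> \<in> B"
    and step: "\<And>\<eta> w. s6v_step \<eta> w \<in> B \<longleftrightarrow> \<eta> \<in> B"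
  shows "measure \<mu> B = 0 \<or> measure \<mu> B = 1"
proof (rule ccontr)
  assume *: "\<not> (measure \<mu> B = 0 \<or> measure \<mu> B = 1)"
  have \<mu>: "\<mu> \<in> TIS b1 b2" using ext by (simp add: extremal_in_def)
  then have "prob_space \<mu>" and sets: "sets \<mu> = sets Conf" by (auto simp: TIS_def conf_prob_def)
  interpret prob_space \<mu> by fact
  have sp [simp]: "space \<mu> = UNIV" using sets_eq_imp_space_eq[OF sets] by simp
  let ?p = "measure \<mu> B"
  have p: "0 < ?p" "?p < 1" using * prob_le_1[of B] measure_nonneg[of \<mu> B] by linarith+
  have B': "- B \<in> sets Conf" using sets.compl_sets[OF B] by (simp add: Compl_eq_Diff_UNIV)
  have pc: "measure \<mu> (- B) = 1 - ?p" using prob_compl[of B] B sets by (simp add: Compl_eq_Diff_UNIV)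
  have 1: "uniform_measure \<mu> B \<in> TIS b1 b2"
    using p by (intro uniform_measure_TIS[OF \<mu> B _ shift step]) (simp add: emeasure_eq_measure)
  have 2: "uniform_measure \<mu> (- B) \<in> TIS b1 b2"
    using p by (intro uniform_measure_TIS[OF \<mu> B']) (simp_all add: emeasure_eq_measure pc shift step)
  have "emeasure \<mu> A = ennreal ?p * emeasure (uniform_measure \<mu> B) A
      + ennreal (1 - ?p) * emeasure (uniform_measure \<mu> (- B)) A" if A: "A \<in> sets Conf" for A
  proof -
    have eqs: "emeasure (uniform_measure \<mu> B) A = ennreal (measure \<mu> (B \<inter> A) / ?p)"
      "emeasure (uniform_measure \<mu> (- B)) A = ennreal (measure \<mu> (- B \<inter> A) / (1 - ?p))"
      using A B B' sets p pc by (simp_all add: emeasure_eq_measure divide_ennreal)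
    have "measure \<mu> A = measure \<mu> (B \<inter> A) + measure \<mu> (- B \<inter> A)"
      using A B B' sets by (subst finite_measure_Union[symmetric]) (auto intro!: arg_cong[where f="measure \<mu>"])
    also have "\<dots> = ?p * (measure \<mu> (B \<inter> A) / ?p) + (1 - ?p) * (measure \<mu> (- B \<inter> A) / (1 - ?p))"
      using p by simp
    finally show ?thesis
      unfolding eqs emeasure_eq_measure using p
      by (simp add: ennreal_mult[symmetric] ennreal_plus[symmetric] del: ennreal_plus)
  qed
  with ext 1 2 p have "uniform_measure \<mu> B = \<mu>"
    unfolding extremal_in_def by blast
  then have "emeasure \<mu> B = 1"
    using emeasure_uniform_measure_1[of \<mu> B] p by (simp add: emeasure_eq_measure)
  then show False using p by (simp add: emeasure_eq_measure)
qed

section \<open>Upper densities of particles and holes\<close>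

definition site_count :: "bool \<Rightarrow> nat \<Rightarrow> (int \<Rightarrow> bool) \<Rightarrow> real" where
  "site_count s n \<eta> = (\<Sum>k<n. of_bool (\<eta> (int k) = s))"

text \<open>A limsup is defined for every configuration, so invariance can be stated without null
  sets. The value for holes (\<open>s\<close> False) replaces a lower density of particles.\<close>

definition upper_density :: "bool \<Rightarrow> (int \<Rightarrow> bool) \<Rightarrow> ereal" where
  "upper_density s \<eta> = limsup (\<lambda>n. ereal (site_count s n \<eta> / n))"

lemma site_count_False: "site_count False n \<eta> = n - site_count True n \<eta>"
proof -
  have "site_count False n \<eta> + site_count True n \<eta> = (\<Sum>k<n. 1)"
    unfolding site_count_def sum.distrib[symmetric] by (intro sum.cong) auto
  then show ?thesis by simp
qed

lemma site_count_bounds: "0 \<le> site_count s n \<eta>" "site_count s n \<eta> \<le> n"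
proof -
  have "site_count s n \<eta> \<le> (\<Sum>k<n. 1)" unfolding site_count_def by (intro sum_mono) auto
  then show "site_count s n \<eta> \<le> n" by simp
qed (auto simp: site_count_def intro: sum_nonneg)

lemma measurable_site_count [measurable (raw)]:
  assumes [measurable]: "f \<in> M \<rightarrow>\<^sub>M Conf"
  shows "(\<lambda>\<omega>. site_count s n (f \<omega>)) \<in> borel_measurable M"
  unfolding site_count_def by measurable

lemma upper_density_eqI:
  assumes "\<And>n. \<bar>site_count s n \<eta> - site_count s n \<xi>\<bar> \<le> C"
  shows "upper_density s \<eta> = upper_density s \<xi>"
proof -
  have bd: "norm ((site_count s n \<eta> - site_count s n \<xi>) / n) \<le> C / n" for n
    unfolding real_norm_def abs_divide abs_of_nat by (rule divide_right_mono[OF assms]) (rule of_nat_0_le_iff)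
  have "(\<lambda>n. (site_count s n \<eta> - site_count s n \<xi>) / n) \<longlonglongrightarrow> 0"
    by (rule Lim_null_comparison[OF always_eventually[OF allI[OF bd]] lim_const_over_n])
  then have lim: "(\<lambda>n. ereal ((site_count s n \<eta> - site_count s n \<xi>) / n)) \<longlonglongrightarrow> 0"
    unfolding zero_ereal_def by (rule tendsto_ereal)
  have "upper_density s \<eta> = limsup (\<lambda>n. ereal ((site_count s n \<eta> - site_count s n \<xi>) / n) + ereal (site_count s n \<xi> / n))"
    unfolding upper_density_def by (simp add: diff_divide_distrib)
  also have "\<dots> = 0 + upper_density s \<xi>"
    unfolding upper_density_def by (rule ereal_limsup_lim_add[OF lim]) simp
  finally show ?thesis by simp
qed

lemma upper_density_shift: "upper_density s (\<lambda>x. \<eta> (x + m)) = upper_density s \<eta>"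
proof -
  have 1: "upper_density s (\<lambda>x. \<eta> (x + 1)) = upper_density s \<eta>" for \<eta>
  proof (rule upper_density_eqI)
    fix n
    have "site_count s n (\<lambda>x. \<eta> (x + 1)) - site_count s n \<eta>
        = (\<Sum>k<n. of_bool (\<eta> (int (Suc k)) = s) - of_bool (\<eta> (int k) = s))"
      unfolding site_count_def sum_subtractf by (simp add: add.commute)
    also have "\<dots> = of_bool (\<eta> (int n) = s) - of_bool (\<eta> 0 = s)"
      by (subst sum_lessThan_telescope) simp
    finally show "\<bar>site_count s n (\<lambda>x. \<eta> (x + 1)) - site_count s n \<eta>\<bar> \<le> 1" by auto
  qed
  show ?thesis
  proof (induction m rule: int_induct[where k=0])
    case (step1 i)
    have "upper_density s (\<lambda>x. \<eta> (x + (i + 1))) = upper_density s (\<lambda>x. \<eta> (x + i))"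
      using 1[of "\<lambda>x. \<eta> (x + i)"] by (simp add: algebra_simps)
    with step1 show ?case by simp
  next
    case (step2 i)
    have "upper_density s (\<lambda>x. \<eta> (x + i)) = upper_density s (\<lambda>x. \<eta> (x + (i - 1)))"
      using 1[of "\<lambda>x. \<eta> (x + (i - 1))"] by (simp add: algebra_simps)
    with step2 show ?case by simp
  qed simp
qed

text \<open>The ice rule telescopes: the count in a window changes only through the two boundary
  fluxes, hence by at most one however long the window is.\<close>

lemma site_count_vstep:
  "site_count True n (vstep \<eta> u) - site_count True n \<eta>
    = of_bool (hflux \<eta> u (-1)) - of_bool (hflux \<eta> u (int n - 1))"
proof (induction n)
  case (Suc n)
  then show ?case
    using vstep_conservation[of \<eta> u "int n"] by (simp add: site_count_def)
qed (simp add: site_count_def)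

lemma upper_density_s6v_step: "upper_density s (s6v_step \<eta> w) = upper_density s \<eta>"
proof (rule upper_density_eqI)
  fix n
  have "\<bar>site_count True n (s6v_step \<eta> w) - site_count True n \<eta>\<bar> \<le> 1"
    unfolding s6v_step_vstep_stop_noise site_count_vstep by auto
  then show "\<bar>site_count s n (s6v_step \<eta> w) - site_count s n \<eta>\<bar> \<le> 1"
    by (cases s) (simp_all add: site_count_False)
qed

context
  fixes \<mu> :: "(int \<Rightarrow> bool) measure"
  assumes conf: "conf_prob \<mu>" and ti: "translation_invariant \<mu>"
begin

interpretation prob_space \<mu> using conf by (simp add: conf_prob_def)

lemma TI_measure_shift:
  assumes "B \<in> sets Conf"
  shows "measure \<mu> {\<eta>. (\<lambda>x. \<eta> (x + m)) \<in> B} = measure \<mu> B"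
proof -
  have sets [measurable_cong]: "sets \<mu> = sets Conf" using conf by (simp add: conf_prob_def)
  have sp: "space \<mu> = UNIV" using sets_eq_imp_space_eq[OF sets] by simp
  have m: "(\<lambda>\<eta> x. \<eta> (x + m)) \<in> \<mu> \<rightarrow>\<^sub>M Conf" by measurable
  have "measure \<mu> B = measure (S_m m \<mu>) B" using ti by (simp add: translation_invariant_def)
  also have "\<dots> = measure \<mu> {\<eta>. (\<lambda>x. \<eta> (x + m)) \<in> B}"
    unfolding S_m_def using measure_distr[OF m assms] by (simp add: sp vimage_def)
  finally show ?thesis by simp
qed

text \<open>Cover \<open>{0..<L}\<close> greedily by intervals of length at most \<open>M\<close> on which the average is at least \<open>a\<close>,
  spending a single site wherever no such interval starts.\<close>

lemma covering_density_bound: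
  assumes a: "0 \<le> a" "a \<le> 1" and ae: "AE \<eta> in \<mu>. \<exists>n\<ge>1. a * real n \<le> site_count s n \<eta>"
  shows "a \<le> measure \<mu> {\<eta>. \<eta> 0 = s}"
proof -
  have sets [measurable_cong]: "sets \<mu> = sets Conf" using conf by (simp add: conf_prob_def)
  have sp: "space \<mu> = UNIV" using sets_eq_imp_space_eq[OF sets] by simp
  define G where "G M = {\<eta>. \<exists>n\<in>{1..M}. a * real n \<le> site_count s n \<eta>}" for M :: nat
  have G [measurable]: "G M \<in> sets Conf" for M
  proof -
    have "{\<eta> \<in> space Conf. \<exists>n\<in>{1..M}. a * real n \<le> site_count s n \<eta>} \<in> sets Conf" by measurable
    then show ?thesis by (simp add: G_def)
  qed
  \<comment> \<open>The loss \<open>a * real M\<close> pays for a final piece of length at most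
    \<open>M\<close> on which the greedy choice might overshoot \<open>L\<close>.\<close>
  have cover: "a * (real L - real M) \<le>
      (\<Sum>i<L. of_bool (\<eta> (k + int i) = s) + of_bool ((\<lambda>x. \<eta> (x + (k + int i))) \<notin> G M))" for M L k \<eta>
  proof (induction L arbitrary: k rule: less_induct)
    case (less L)
    let ?f = "\<lambda>k i. of_bool (\<eta> (k + int i) = s) + of_bool ((\<lambda>x. \<eta> (x + (k + int i))) \<notin> G M) :: real"
    show ?case
    proof (cases "L \<le> M")
      case True
      then have "a * (real L - real M) \<le> 0" using a by (intro mult_nonneg_nonpos) auto
      also have "0 \<le> (\<Sum>i<L. ?f k i)" by (intro sum_nonneg) auto
      finally show ?thesis .
    next
      case False
      have "\<exists>n\<ge>1. n \<le> L \<and> a * real n \<le> (\<Sum>i<n. ?f k i)"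
      proof (cases "(\<lambda>x. \<eta> (x + k)) \<in> G M")
        case True
        then obtain n where n: "n \<ge> 1" "n \<le> M" "a * real n \<le> site_count s n (\<lambda>x. \<eta> (x + k))"
          unfolding G_def by auto
        have "site_count s n (\<lambda>x. \<eta> (x + k)) \<le> (\<Sum>i<n. ?f k i)"
          unfolding site_count_def by (intro sum_mono) (auto simp: add.commute)
        then show ?thesis using n False by (intro exI[of _ n]) auto
      next
        case False
        \<comment> \<open>A site at which no good interval starts contributes at least one to the
          right-hand side, which is at least \<open>a\<close>.\<close>
        then show ?thesis using a \<open>\<not> L \<le> M\<close> by (intro exI[of _ 1]) auto
      qed
      then obtain n where n: "n \<ge> 1" "n \<le> L" "a * real n \<le> (\<Sum>i<n. ?f k i)" by blast
      have "a * (real (L - n) - real M) \<le> (\<Sum>i<L - n. ?f (k + int n) i)"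
        using n by (intro less.IH) auto
      moreover have "(\<Sum>i<L. ?f k i) = (\<Sum>i<n. ?f k i) + (\<Sum>i<L - n. ?f (k + int n) i)"
      proof -
        have "(\<Sum>i<L. ?f k i) = (\<Sum>i<n. ?f k i) + (\<Sum>i=n..<L. ?f k i)"
          using n by (simp add: lessThan_atLeast0 sum.atLeastLessThan_concat)
        also have "(\<Sum>i=n..<L. ?f k i) = (\<Sum>i<L - n. ?f k (i + n))"
          using sum.shift_bounds_nat_ivl[of "?f k" 0 n "L - n"] n by (simp add: lessThan_atLeast0)
        finally show ?thesis by (simp add: add_ac)
      qed
      ultimately show ?thesis using n by (simp add: of_nat_diff algebra_simps)
    qed
  qed
  \<comment> \<open>Expectations of the covering inequality; translation invariance makes every
    summand the same.\<close>
  have bound: "a * (real L - real M) \<le> real L * (measure \<mu> {\<eta>. \<eta> 0 = s} + measure \<mu> (- G M))" for L M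
  proof -
    have sing: "{\<eta>. \<eta> x = s} \<in> sets Conf" for x
    proof -
      have "{\<eta> \<in> space Conf. \<eta> x = s} \<in> sets Conf" by measurable
      then show ?thesis by simp
    qed
    have cG: "- G M \<in> sets Conf" using sets.compl_sets[OF G[of M]] by (simp add: Compl_eq_Diff_UNIV)
    have cGs: "{\<eta>. (\<lambda>x. \<eta> (x + m)) \<notin> G M} \<in> sets Conf" for m
    proof -
      have "{\<eta>. (\<lambda>x. \<eta> (x + m)) \<notin> G M} = (\<lambda>\<eta> x. \<eta> (x + m)) -` (- G M) \<inter> space Conf"
        by (auto simp: vimage_def)
      also have "\<dots> \<in> sets Conf" by (rule measurable_sets[OF measurable_shift cG])
      finally show ?thesis .
    qed
    have "a * (real L - real M) \<le>
        (\<integral>\<eta>. (\<Sum>i<L. indicator {\<eta>. \<eta> (int i) = s} \<eta> + indicator {\<eta>. (\<lambda>x. \<eta> (x + int i)) \<notin> G M} \<eta>) \<partial>\<mu>)"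
    proof (rule integral_ge_const)
      show "integrable \<mu> (\<lambda>\<eta>. \<Sum>i<L. indicator {\<eta>. \<eta> (int i) = s} \<eta> + indicator {\<eta>. (\<lambda>x. \<eta> (x + int i)) \<notin> G M} \<eta> :: real)"
        using sing cGs sets by (intro Bochner_Integration.integrable_sum Bochner_Integration.integrable_add integrable_real_indicator) (auto simp: less_top[symmetric])
      show "AE \<eta> in \<mu>. a * (real L - real M) \<le>
        (\<Sum>i<L. indicator {\<eta>. \<eta> (int i) = s} \<eta> + indicator {\<eta>. (\<lambda>x. \<eta> (x + int i)) \<notin> G M} \<eta>)"
        using cover[of L M _ 0] by (intro AE_I2) (simp add: indicator_def of_bool_def)
    qed
    also have "\<dots> = (\<Sum>i<L. measure \<mu> {\<eta>. \<eta> (int i) = s} + measure \<mu> {\<eta>. (\<lambda>x. \<eta> (x + int i)) \<notin> G M})"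
      using sing cGs sets
      by (subst Bochner_Integration.integral_sum) (auto simp: less_top[symmetric] sp)
    also have "\<dots> = (\<Sum>i<L. measure \<mu> {\<eta>. \<eta> 0 = s} + measure \<mu> (- G M))"
    proof (intro sum.cong refl)
      fix i
      have "measure \<mu> {\<eta>. \<eta> (int i) = s} = measure \<mu> {\<eta>. \<eta> 0 = s}"
        using TI_measure_shift[OF sing[of 0], of "int i"] by simp
      moreover have "measure \<mu> {\<eta>. (\<lambda>x. \<eta> (x + int i)) \<notin> G M} = measure \<mu> (- G M)"
        using TI_measure_shift[OF cG, of "int i"] by simp
      ultimately show "measure \<mu> {\<eta>. \<eta> (int i) = s} + measure \<mu> {\<eta>. (\<lambda>x. \<eta> (x + int i)) \<notin> G M}
        = measure \<mu> {\<eta>. \<eta> 0 = s} + measure \<mu> (- G M)" by simp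
    qed
    finally show ?thesis by simp
  qed
  \<comment> \<open>Letting \<open>L\<close> grow at fixed \<open>M\<close> removes the boundary
    loss. Afterwards the events \<open>G M\<close> increase to an event of full measure, so the
    penalty for bad sites vanishes as well.\<close>
  have lim_L: "a \<le> measure \<mu> {\<eta>. \<eta> 0 = s} + measure \<mu> (- G M)" for M
  proof (rule LIMSEQ_le_const2)
    have "(\<lambda>L. a * real M / real L) \<longlonglongrightarrow> 0" by (rule lim_const_over_n)
    from tendsto_diff[OF tendsto_const[of a] this]
    show "(\<lambda>L. a - a * real M / real L) \<longlonglongrightarrow> a" by simp
    have "a - a * real M / real L \<le> measure \<mu> {\<eta>. \<eta> 0 = s} + measure \<mu> (- G M)" if "L \<ge> 1" for L
      using bound[of L M] that by (simp add: field_simps)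
    then show "\<exists>N. \<forall>n\<ge>N. a - a * real M / real n \<le> measure \<mu> {\<eta>. \<eta> 0 = s} + measure \<mu> (- G M)"
      by blast
  qed
  have "(\<lambda>M. measure \<mu> (G M)) \<longlonglongrightarrow> measure \<mu> (\<Union>M. G M)"
  proof (rule finite_Lim_measure_incseq)
    show "range G \<subseteq> sets \<mu>" using G unfolding sets by blast
    show "incseq G"
    proof (rule monoI)
      fix m n :: nat assume "m \<le> n"
      then have "{1..m} \<subseteq> {1..n}" by simp
      then show "G m \<subseteq> G n" unfolding G_def by blast
    qed
  qed
  moreover have "measure \<mu> (\<Union>M. G M) = 1"
  proof -
    have U: "(\<Union>M. G M) \<in> sets \<mu>" unfolding sets by (rule sets.countable_UN) (use G in blast)
    have "AE \<eta> in \<mu>. \<eta> \<in> (\<Union>M. G M)"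
      using ae
    proof eventually_elim
      case (elim \<eta>)
      then obtain n where "n \<ge> 1" "a * real n \<le> site_count s n \<eta>" by blast
      then have "\<eta> \<in> G n" unfolding G_def by auto
      then show ?case by blast
    qed
    then show ?thesis using prob_eq_1[OF U] by blast
  qed
  ultimately have "(\<lambda>M. 1 - measure \<mu> (G M)) \<longlonglongrightarrow> 1 - 1" by (intro tendsto_diff tendsto_const) simp
  moreover have "measure \<mu> (- G M) = 1 - measure \<mu> (G M)" for M
    using prob_compl[of "G M", unfolded sets, OF G] unfolding sp Compl_eq_Diff_UNIV .
  ultimately have "(\<lambda>M. measure \<mu> (- G M)) \<longlonglongrightarrow> 0" by simp
  from tendsto_add[OF tendsto_const[of "measure \<mu> {\<eta>. \<eta> 0 = s}"] this]
  have "(\<lambda>M. measure \<mu> {\<eta>. \<eta> 0 = s} + measure \<mu> (- G M)) \<longlonglongrightarrow> measure \<mu> {\<eta>. \<eta> 0 = s}" by simp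
  then show ?thesis by (rule LIMSEQ_le_const) (use lim_L in blast)
qed

text \<open>The event \<open>B\<close> has measure zero or one. If it were null, almost every
  configuration would have an initial interval of average at least \<open>a\<close>, and
  \<open>covering_density_bound\<close> would force the density up to \<open>a\<close>.\<close>

lemma extremal_upper_density:
  assumes ext: "extremal_in (TIS b1 b2) \<mu>" and a: "measure \<mu> {\<eta>. \<eta> 0 = s} < a"
  shows "AE \<eta> in \<mu>. upper_density s \<eta> \<le> ereal a"
proof -
  have sets [measurable_cong]: "sets \<mu> = sets Conf" using conf by (simp add: conf_prob_def)
  have sp: "space \<mu> = UNIV" using sets_eq_imp_space_eq[OF sets] by simp
  define B where "B = {\<eta>. upper_density s \<eta> \<le> ereal a}"
  have "{\<eta> \<in> space Conf. upper_density s \<eta> \<le> ereal a} \<in> sets Conf"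
    unfolding upper_density_def by measurable
  then have B: "B \<in> sets Conf" by (simp add: B_def)
  have "measure \<mu> B = 0 \<or> measure \<mu> B = 1"
    by (rule extremal_invariant_event[OF ext B])
      (simp_all add: B_def upper_density_shift upper_density_s6v_step)
  moreover have "measure \<mu> B \<noteq> 0"
  proof
    assume "measure \<mu> B = 0"
    then have "AE \<eta> in \<mu>. \<eta> \<notin> B" using prob_eq_0[of B] B sets by simp
    then have ae: "AE \<eta> in \<mu>. \<exists>n\<ge>1. a * real n \<le> site_count s n \<eta>"
    proof eventually_elim
      case (elim \<eta>)
      show ?case
      proof (rule ccontr)
        assume *: "\<not> (\<exists>n\<ge>1. a * real n \<le> site_count s n \<eta>)"
        have "site_count s n \<eta> / n \<le> a" if "n \<ge> 1" for n
        proof -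
          have "site_count s n \<eta> < a * real n" using * that by (meson not_le)
          then show ?thesis using that by (simp add: divide_le_eq)
        qed
        then have "\<forall>\<^sub>F n in sequentially. ereal (site_count s n \<eta> / n) \<le> ereal a"
          by (auto simp: eventually_sequentially)
        then have "upper_density s \<eta> \<le> ereal a"
          unfolding upper_density_def by (rule Limsup_bounded)
        with elim show False by (simp add: B_def)
      qed
    qed
    have "0 \<le> a" using a measure_nonneg[of \<mu> "{\<eta>. \<eta> 0 = s}"] by linarith
    moreover have "a \<le> 1"
    proof -
      obtain \<eta> where "\<exists>n\<ge>1. a * real n \<le> site_count s n \<eta>"
        using ae eventually_happens' ae_filter_bot by blast
      then obtain n where n: "n \<ge> 1" "a * real n \<le> site_count s n \<eta>" by blast
      then have "a * real n \<le> 1 * real n" using site_count_bounds(2)[of s n \<eta>] by linarith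
      then show ?thesis by (rule mult_right_le_imp_le) (use n in simp)
    qed
    ultimately have "a \<le> measure \<mu> {\<eta>. \<eta> 0 = s}" using ae by (rule covering_density_bound)
    with a show False by simp
  qed
  ultimately have "measure \<mu> B = 1" by blast
  then have "AE \<eta> in \<mu>. \<eta> \<in> B" using prob_eq_1[of B] B sets by simp
  then show ?thesis by (simp add: B_def)
qed

text \<open>The upper bound for particles and the upper bound for holes squeeze the averages to the
  density almost surely; dominated convergence turns this into convergence in mean, the form needed
  under a coupling.\<close>

lemma extremal_mean_ergodic:
  assumes ext: "extremal_in (TIS b1 b2) \<mu>"
  shows "(\<lambda>n. \<integral>\<eta>. \<bar>site_count True n \<eta> / n - measure \<mu> {\<eta>. \<eta> 0}\<bar> \<partial>\<mu>) \<longlonglongrightarrow> 0"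
proof -
  have sets [measurable_cong]: "sets \<mu> = sets Conf" using conf by (simp add: conf_prob_def)
  have sp: "space \<mu> = UNIV" using sets_eq_imp_space_eq[OF sets] by simp
  define r where "r = measure \<mu> {\<eta>. \<eta> 0}"
  have "{\<eta> \<in> space \<mu>. \<eta> 0} \<in> events" by measurable
  then have rF: "measure \<mu> {\<eta>. \<not> \<eta> 0} = 1 - r"
    using prob_compl[of "{\<eta>. \<eta> 0}"] by (simp add: r_def sp Collect_neg_eq Compl_eq_Diff_UNIV)
  have r01: "0 \<le> r" "r \<le> 1" by (simp_all add: r_def)
  have "AE \<eta> in \<mu>. \<forall>k::nat. upper_density True \<eta> \<le> ereal (r + 1 / Suc k)"
    by (subst AE_all_countable, intro allI extremal_upper_density[OF ext]) (simp add: r_def)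
  moreover have "AE \<eta> in \<mu>. \<forall>k::nat. upper_density False \<eta> \<le> ereal (1 - r + 1 / Suc k)"
    by (subst AE_all_countable, intro allI extremal_upper_density[OF ext]) (simp add: rF)
  ultimately have "AE \<eta> in \<mu>. (\<lambda>n. site_count True n \<eta> / n) \<longlonglongrightarrow> r"
  proof eventually_elim
    case (elim \<eta>)
    show ?case
    proof (rule LIMSEQ_I)
      fix e :: real assume e: "0 < e"
      then obtain k :: nat where k: "1 / Suc k < e" using nat_approx_posE by blast
      have "upper_density True \<eta> < ereal (r + e)"
        using elim(1)[rule_format, of k] k by (meson add_strict_left_mono ereal_less_eq(3) le_less_trans less_ereal.simps(1))
      then have 1: "\<forall>\<^sub>F n in sequentially. ereal (site_count True n \<eta> / n) < ereal (r + e)"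
        unfolding upper_density_def by (rule Limsup_lessD)
      have "upper_density False \<eta> < ereal (1 - r + e)"
        using elim(2)[rule_format, of k] k by (meson add_strict_left_mono ereal_less_eq(3) le_less_trans less_ereal.simps(1))
      then have 2: "\<forall>\<^sub>F n in sequentially. ereal (site_count False n \<eta> / n) < ereal (1 - r + e)"
        unfolding upper_density_def by (rule Limsup_lessD)
      have "\<forall>\<^sub>F n in sequentially. norm (site_count True n \<eta> / n - r) < e"
        using 1 2 eventually_ge_at_top[of 1]
      proof eventually_elim
        case (elim n)
        have "site_count False n \<eta> / n = 1 - site_count True n \<eta> / n"
          using elim(3) by (simp add: site_count_False diff_divide_distrib)
        with elim show ?case by (simp add: abs_less_iff)
      qed
      then show "\<exists>N. \<forall>n\<ge>N. norm (site_count True n \<eta> / n - r) < e"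
        by (simp add: eventually_sequentially)
    qed
  qed
  then have ae: "AE \<eta> in \<mu>. (\<lambda>n. \<bar>site_count True n \<eta> / n - r\<bar>) \<longlonglongrightarrow> 0"
    by eventually_elim (auto intro: tendsto_rabs_zero simp: LIM_zero_iff)
  have "(\<lambda>n. \<integral>\<eta>. \<bar>site_count True n \<eta> / n - r\<bar> \<partial>\<mu>) \<longlonglongrightarrow> (\<integral>\<eta>. 0 \<partial>\<mu>)"
  proof (rule integral_dominated_convergence[where w="\<lambda>_. 1"])
    show "AE \<eta> in \<mu>. norm \<bar>site_count True n \<eta> / n - r\<bar> \<le> 1" for n
    proof (rule AE_I2)
      fix \<eta>
      have "0 \<le> site_count True n \<eta> / n" "site_count True n \<eta> / n \<le> 1"
        using site_count_bounds[of True n \<eta>] by (auto simp: divide_le_eq)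
      then show "norm \<bar>site_count True n \<eta> / n - r\<bar> \<le> 1" using r01 by (simp add: abs_le_iff)
    qed
  qed (use ae in auto)
  then show ?thesis by (simp add: r_def)
qed

end

section \<open>The law of large numbers for Bernoulli measures\<close>

lemma Upsilon_prob: "prob_space (Upsilon r)"
  unfolding Upsilon_def by (rule prob_space_PiM_pmf)

lemma sets_Upsilon [simp, measurable_cong]: "sets (Upsilon r) = sets Conf"
  by (simp add: Upsilon_def Conf_def)

lemma space_Upsilon [simp]: "space (Upsilon r) = UNIV"
  by (simp add: Upsilon_def)

lemma Upsilon_shift: "distr (Upsilon r) Conf (\<lambda>\<eta> x. \<eta> (x + m)) = Upsilon r"
  unfolding Upsilon_def Conf_def by (rule distr_iid_reindex) (simp add: inj_on_def)

text \<open>The centred occupation variables are orthogonal and bounded by one, so their sum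
  \<open>Y\<close> has second moment at most \<open>n\<close>. This bounds the mean absolute error
  by \<open>1 / sqrt n\<close>.\<close>

lemma Upsilon_mean_ergodic:
  assumes r: "0 \<le> r" "r \<le> 1"
  shows "(\<lambda>n. \<integral>\<eta>. \<bar>site_count True n \<eta> / n - r\<bar> \<partial>Upsilon r) \<longlonglongrightarrow> 0"
proof -
  interpret prob_space "Upsilon r" by (rule Upsilon_prob)
  have pU: "prob UNIV = 1" using prob_space by simp
  have cyl: "prob {\<eta>. \<forall>i\<in>J. \<eta> i = True} = r ^ card J" if "finite J" for J
    unfolding Upsilon_def using that r by (subst measure_PiM_pmf_cylinder) simp_all
  have ev: "{\<eta>. \<eta> i} \<in> events" "{\<eta>. \<eta> i \<and> \<eta> j} \<in> events" for i j
  proof -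
    have "{\<eta> \<in> space (Upsilon r). \<eta> i} \<in> events" "{\<eta> \<in> space (Upsilon r). \<eta> i \<and> \<eta> j} \<in> events"
      by measurable
    then show "{\<eta>. \<eta> i} \<in> events" "{\<eta>. \<eta> i \<and> \<eta> j} \<in> events" by simp_all
  qed
  have pr1: "prob {\<eta>. \<eta> i} = r" for i using cyl[of "{i}"] by simp
  have pr2: "prob {\<eta>. \<eta> i \<and> \<eta> j} = r\<^sup>2" if "i \<noteq> j" for i j
    using cyl[of "{i, j}"] that by (simp add: power2_eq_square)
  define X where "X k \<eta> = indicator {\<eta>. \<eta> (int k)} \<eta> - r" for k and \<eta> :: "int \<Rightarrow> bool"
  have Xm [measurable]: "X k \<in> borel_measurable (Upsilon r)" for k
    unfolding X_def using ev by measurable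
  have Xb: "\<bar>X k \<eta>\<bar> \<le> 1" for k \<eta> unfolding X_def using r by (auto simp: indicator_def)
  have XXb: "\<bar>X j \<eta> * X k \<eta>\<bar> \<le> 1" for j k \<eta>
    using mult_mono[OF Xb[of j \<eta>] Xb[of k \<eta>]] by (simp add: abs_mult)
  have XXint: "integrable (Upsilon r) (\<lambda>\<eta>. X j \<eta> * X k \<eta>)" for j k
    by (rule integrable_const_bound[where B=1]) (use XXb in auto)
  have cov: "expectation (\<lambda>\<eta>. X j \<eta> * X k \<eta>) = 0" if "j \<noteq> k" for j k
  proof -
    have "expectation (\<lambda>\<eta>. X j \<eta> * X k \<eta>)
      = expectation (\<lambda>\<eta>. indicator {\<eta>. \<eta> (int j) \<and> \<eta> (int k)} \<eta>
          - r * indicator {\<eta>. \<eta> (int j)} \<eta> - r * indicator {\<eta>. \<eta> (int k)} \<eta> + r\<^sup>2)"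
      by (intro Bochner_Integration.integral_cong refl)
        (auto simp: X_def indicator_def power2_eq_square algebra_simps)
    also have "\<dots> = prob {\<eta>. \<eta> (int j) \<and> \<eta> (int k)} - r * prob {\<eta>. \<eta> (int j)} - r * prob {\<eta>. \<eta> (int k)} + r\<^sup>2"
      using ev by (simp add: less_top[symmetric] pU)
    also have "\<dots> = 0" using that by (simp add: pr1 pr2 power2_eq_square)
    finally show ?thesis .
  qed
  have bound: "expectation (\<lambda>\<eta>. \<bar>site_count True n \<eta> / n - r\<bar>) \<le> 1 / sqrt n" if n: "n > 0" for n
  proof -
    define Y where "Y \<eta> = (\<Sum>k<n. X k \<eta>)" for \<eta>
    have Y_eq: "site_count True n \<eta> / n - r = Y \<eta> / n" for \<eta>
      using n unfolding Y_def X_def site_count_def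
      by (simp add: sum_subtractf field_simps indicator_def of_bool_def)
    have Y2: "(Y \<eta>)\<^sup>2 = (\<Sum>j<n. \<Sum>k<n. X j \<eta> * X k \<eta>)" for \<eta>
      by (simp add: Y_def power2_eq_square sum_product)
    have Y2int: "integrable (Upsilon r) (\<lambda>\<eta>. (Y \<eta>)\<^sup>2)"
      unfolding Y2 by (intro Bochner_Integration.integrable_sum XXint)
    have "expectation (\<lambda>\<eta>. (Y \<eta>)\<^sup>2) = (\<Sum>j<n. \<Sum>k<n. expectation (\<lambda>\<eta>. X j \<eta> * X k \<eta>))"
      unfolding Y2 by (simp add: Bochner_Integration.integral_sum Bochner_Integration.integrable_sum XXint)
    also have "\<dots> = (\<Sum>j<n. expectation (\<lambda>\<eta>. X j \<eta> * X j \<eta>))"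
    proof (intro sum.cong refl)
      fix j assume "j \<in> {..<n}"
      then have "(\<Sum>k<n. expectation (\<lambda>\<eta>. X j \<eta> * X k \<eta>))
        = (\<Sum>k<n. if k = j then expectation (\<lambda>\<eta>. X j \<eta> * X j \<eta>) else 0)"
        by (intro sum.cong) (auto simp: cov)
      then show "(\<Sum>k<n. expectation (\<lambda>\<eta>. X j \<eta> * X k \<eta>)) = expectation (\<lambda>\<eta>. X j \<eta> * X j \<eta>)"
        using \<open>j \<in> {..<n}\<close> by simp
    qed
    also have "\<dots> \<le> (\<Sum>j<n. 1)"
    proof (intro sum_mono)
      fix j
      have "X j \<eta> * X j \<eta> \<le> 1" for \<eta> using XXb[of j \<eta> j] by simp
      then show "expectation (\<lambda>\<eta>. X j \<eta> * X j \<eta>) \<le> 1"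
        by (intro integral_le_const XXint AE_I2)
    qed
    finally have EY: "expectation (\<lambda>\<eta>. (Y \<eta>)\<^sup>2) \<le> n" by simp
    have sq: "sqrt n > 0" "sqrt n * sqrt n = n" using n by auto
    \<comment> \<open>AM-GM with weight \<open>sqrt n\<close>\<close>
    have "\<bar>Y \<eta> / n\<bar> \<le> (1 / (2 * sqrt n)) + (Y \<eta>)\<^sup>2 / (2 * sqrt n * n)" for \<eta>
    proof -
      have "0 \<le> (\<bar>Y \<eta>\<bar> - sqrt n)\<^sup>2" by simp
      also have "\<dots> = (Y \<eta>)\<^sup>2 + n - 2 * sqrt n * \<bar>Y \<eta>\<bar>" by (simp add: power2_diff algebra_simps)
      finally have "2 * sqrt n * \<bar>Y \<eta>\<bar> \<le> n + (Y \<eta>)\<^sup>2" by simp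
      then have "2 * sqrt n * \<bar>Y \<eta>\<bar> / (2 * sqrt n * n) \<le> (n + (Y \<eta>)\<^sup>2) / (2 * sqrt n * n)"
        by (rule divide_right_mono) (use n in simp)
      then show ?thesis using n by (simp add: add_divide_distrib abs_divide)
    qed
    then have "expectation (\<lambda>\<eta>. \<bar>Y \<eta> / n\<bar>)
        \<le> expectation (\<lambda>\<eta>. 1 / (2 * sqrt n) + (Y \<eta>)\<^sup>2 / (2 * sqrt n * n))"
      using Y2int by (intro integral_mono' Bochner_Integration.integrable_add) auto
    also have "\<dots> = 1 / (2 * sqrt n) + expectation (\<lambda>\<eta>. (Y \<eta>)\<^sup>2) / (2 * sqrt n * n)"
      using Y2int by (subst Bochner_Integration.integral_add) (auto simp: pU)
    also have "\<dots> \<le> 1 / (2 * sqrt n) + real n / (2 * sqrt n * n)"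
      using EY n by (intro add_left_mono divide_right_mono) auto
    also have "\<dots> = 1 / sqrt n" using n by (simp add: field_simps)
    finally show ?thesis unfolding Y_eq .
  qed
  have lim: "(\<lambda>n. 1 / sqrt (real n)) \<longlonglongrightarrow> 0"
    using tendsto_real_sqrt[OF lim_1_over_n] by (simp add: real_sqrt_divide)
  have "\<forall>\<^sub>F n in sequentially. norm (expectation (\<lambda>\<eta>. \<bar>site_count True n \<eta> / n - r\<bar>)) \<le> 1 / sqrt n"
    using eventually_gt_at_top[of 0]
  proof eventually_elim
    case (elim n)
    have "0 \<le> expectation (\<lambda>\<eta>. \<bar>site_count True n \<eta> / n - r\<bar>)" by (rule integral_nonneg_AE) simp
    with bound[OF elim] show ?case by simp
  qed
  then show ?thesis using lim by (rule Lim_null_comparison)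
qed

section \<open>Coupled evolution and discrepancies\<close>

abbreviation shift2 :: "int \<Rightarrow> (int \<Rightarrow> bool) \<times> (int \<Rightarrow> bool) \<Rightarrow> (int \<Rightarrow> bool) \<times> (int \<Rightarrow> bool)" where
  "shift2 m p \<equiv> (\<lambda>x. fst p (x + m), \<lambda>x. snd p (x + m))"

text \<open>Only the marginals and joint shift invariance are fixed, so the product measure
  qualifies, and so does the image of a coupling under a joint step when the marginals are
  preserved. Shift invariance makes the discrepancy probability the same at every site, which
  justifies \<open>discrep\<close> looking at the origin.\<close>

definition couplings ::
  "(int \<Rightarrow> bool) measure \<Rightarrow> (int \<Rightarrow> bool) measure \<Rightarrow> ((int \<Rightarrow> bool) \<times> (int \<Rightarrow> bool)) measure set" where
  "couplings \<mu> \<mu>' = {\<nu>. prob_space \<nu> \<and> sets \<nu> = sets (Conf \<Otimes>\<^sub>M Conf) \<and>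
     distr \<nu> Conf fst = \<mu> \<and> distr \<nu> Conf snd = \<mu>' \<and>
     (\<forall>m. distr \<nu> (Conf \<Otimes>\<^sub>M Conf) (shift2 m) = \<nu>)}"

definition discrep :: "((int \<Rightarrow> bool) \<times> (int \<Rightarrow> bool)) measure \<Rightarrow> real" where
  "discrep \<nu> = measure \<nu> {p. fst p 0 \<noteq> snd p 0}"

definition joint_step ::
  "((int \<Rightarrow> bool) \<times> (int \<Rightarrow> bool)) \<times> (int \<Rightarrow> bool \<times> bool) \<Rightarrow> (int \<Rightarrow> bool) \<times> (int \<Rightarrow> bool)" where
  "joint_step q = (vstep (fst (fst q)) (snd q), vstep (snd (fst q)) (snd q))"

definition coupled_step ::
  "real \<Rightarrow> real \<Rightarrow> ((int \<Rightarrow> bool) \<times> (int \<Rightarrow> bool)) measure \<Rightarrow> ((int \<Rightarrow> bool) \<times> (int \<Rightarrow> bool)) measure" where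
  "coupled_step b1 b2 \<nu> = distr (\<nu> \<Otimes>\<^sub>M vnoise b1 b2) (Conf \<Otimes>\<^sub>M Conf) joint_step"

lemma measurable_shift2: "shift2 m \<in> Conf \<Otimes>\<^sub>M Conf \<rightarrow>\<^sub>M Conf \<Otimes>\<^sub>M Conf"
proof (rule measurable_Pair)
  show "(\<lambda>p x. fst p (x + m)) \<in> Conf \<Otimes>\<^sub>M Conf \<rightarrow>\<^sub>M Conf"
    by (rule measurable_compose[OF measurable_fst measurable_shift])
  show "(\<lambda>p x. snd p (x + m)) \<in> Conf \<Otimes>\<^sub>M Conf \<rightarrow>\<^sub>M Conf"
    by (rule measurable_compose[OF measurable_snd measurable_shift])
qed

lemma measurable_joint_step: "joint_step \<in> (Conf \<Otimes>\<^sub>M Conf) \<Otimes>\<^sub>M discrete_fun_space \<rightarrow>\<^sub>M Conf \<Otimes>\<^sub>M Conf"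
  unfolding joint_step_def by measurable

lemma pair_ev: "Measurable.pred (Conf \<Otimes>\<^sub>M Conf) P \<Longrightarrow> {p. P p} \<in> sets (Conf \<Otimes>\<^sub>M Conf)"
  unfolding pred_def by (simp add: space_pair_measure)

lemma sets_discrepancy: "{p. fst p x \<noteq> snd p x} \<in> sets (Conf \<Otimes>\<^sub>M Conf)"
  by (rule pair_ev) measurable

text \<open>As raw rules these two match every predicate, which makes the measurability prover diverge on
  the larger events below.\<close>

declare measurable_site [measurable del] measurable_coord [measurable del]

text \<open>Two consecutive discrepancies of opposite signs, the left one being a surplus of the
  first configuration iff \<open>s\<close> holds. Excluding discrepancies in between is what lets a
  single prescribed noise pattern annihilate the pair.\<close>

definition opposite :: "bool \<Rightarrow> int \<Rightarrow> int \<Rightarrow> ((int \<Rightarrow> bool) \<times> (int \<Rightarrow> bool)) set" where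
  "opposite s x y = {p. fst p x = s \<and> snd p x = (\<not> s) \<and>
     (\<forall>z. x < z \<and> z < y \<longrightarrow> fst p z = snd p z) \<and> fst p y = (\<not> s) \<and> snd p y = s}"

text \<open>Noise on \<open>{x..y}\<close> that carries the discrepancy at \<open>x\<close> horizontally to \<open>y\<close>, where it cancels the
  opposite one, whatever enters \<open>x\<close> from the left.\<close>

definition annih_noise :: "int \<Rightarrow> int \<Rightarrow> int \<Rightarrow> bool \<times> bool" where
  "annih_noise x y z = (if z = x then (False, False) else if z = y then (False, True) else (True, True))"

definition annih_prob :: "real \<Rightarrow> real \<Rightarrow> int \<Rightarrow> int \<Rightarrow> real" where
  "annih_prob b1 b2 x y = (\<Prod>z\<in>{x..y}. pmf (vsite b1 b2) (annih_noise x y z))"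

lemma annih_prob_pos: "0 < b1 \<Longrightarrow> b1 < 1 \<Longrightarrow> 0 < b2 \<Longrightarrow> b2 < 1 \<Longrightarrow> 0 < annih_prob b1 b2 x y"
  unfolding annih_prob_def by (rule prod_pos) (auto simp: annih_noise_def pmf_pair)

lemma pred_const_eq: "Measurable.pred M P \<Longrightarrow> Measurable.pred M (\<lambda>q. P q = c)"
  by (cases c) simp_all

lemma opposite_sets: "opposite s x y \<in> sets (Conf \<Otimes>\<^sub>M Conf)"
  unfolding opposite_def
proof (rule pair_ev)
  have f: "Measurable.pred (Conf \<Otimes>\<^sub>M Conf) (\<lambda>p. fst p z)" "Measurable.pred (Conf \<Otimes>\<^sub>M Conf) (\<lambda>p. snd p z)" for z
    by (rule measurable_site[OF measurable_fst], rule measurable_site[OF measurable_snd])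
  show "Measurable.pred (Conf \<Otimes>\<^sub>M Conf) (\<lambda>p. fst p x = s \<and> snd p x = (\<not> s) \<and>
     (\<forall>z. x < z \<and> z < y \<longrightarrow> fst p z = snd p z) \<and> fst p y = (\<not> s) \<and> snd p y = s)"
    by (intro pred_intros_logic pred_intros_countable f pred_const_eq) simp_all
qed

lemma triple_preds:
  fixes x :: int
  defines "R \<equiv> (Conf \<Otimes>\<^sub>M Conf) \<Otimes>\<^sub>M (discrete_fun_space :: (int \<Rightarrow> bool \<times> bool) measure)"
  shows "Measurable.pred R (\<lambda>q. fst (fst q) x)" "Measurable.pred R (\<lambda>q. snd (fst q) x)"
    "Measurable.pred R (\<lambda>q. hflux (fst (fst q)) (snd q) x)" "Measurable.pred R (\<lambda>q. hflux (snd (fst q)) (snd q) x)"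
    "Measurable.pred R (\<lambda>q. vstep (fst (fst q)) (snd q) x)" "Measurable.pred R (\<lambda>q. vstep (snd (fst q)) (snd q) x)"
    "Measurable.pred R (\<lambda>q. snd q x = z)"
proof -
  have f: "(\<lambda>q. fst (fst q)) \<in> R \<rightarrow>\<^sub>M Conf" and g: "(\<lambda>q. snd (fst q)) \<in> R \<rightarrow>\<^sub>M Conf"
    and u: "(\<lambda>q. snd q) \<in> R \<rightarrow>\<^sub>M discrete_fun_space"
    unfolding R_def by measurable
  show "Measurable.pred R (\<lambda>q. fst (fst q) x)" "Measurable.pred R (\<lambda>q. snd (fst q) x)"
    by (rule measurable_site[OF f], rule measurable_site[OF g])
  show "Measurable.pred R (\<lambda>q. hflux (fst (fst q)) (snd q) x)" "Measurable.pred R (\<lambda>q. hflux (snd (fst q)) (snd q) x)"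
    by (rule measurable_hflux[OF f u], rule measurable_hflux[OF g u])
  show "Measurable.pred R (\<lambda>q. vstep (fst (fst q)) (snd q) x)" "Measurable.pred R (\<lambda>q. vstep (snd (fst q)) (snd q) x)"
    by (rule measurable_site[OF measurable_vstep[OF f u]], rule measurable_site[OF measurable_vstep[OF g u]])
  show "Measurable.pred R (\<lambda>q. snd q x = z)"
    using measurable_coord[OF u, of x] by measurable
qed

section \<open>Loss of discrepancies in one coupled step\<close>

context
  fixes \<nu> :: "((int \<Rightarrow> bool) \<times> (int \<Rightarrow> bool)) measure" and b1 b2 :: real
  assumes prob: "prob_space \<nu>" and sets_nu: "sets \<nu> = sets (Conf \<Otimes>\<^sub>M Conf)"
    and ti: "\<And>m. distr \<nu> (Conf \<Otimes>\<^sub>M Conf) (shift2 m) = \<nu>"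
begin

private abbreviation Q where "Q \<equiv> \<nu> \<Otimes>\<^sub>M vnoise b1 b2"

private lemma sets_Q: "sets Q = sets ((Conf \<Otimes>\<^sub>M Conf) \<Otimes>\<^sub>M discrete_fun_space)"
  by (rule sets_pair_measure_cong[OF sets_nu sets_PiM_pmf])

private lemma space_nu: "space \<nu> = UNIV"
  using sets_eq_imp_space_eq[OF sets_nu] by (simp add: space_pair_measure)

private lemma space_Q: "space Q = UNIV"
  by (simp add: space_pair_measure space_nu)

private lemma measurable_Q: "f \<in> Q \<rightarrow>\<^sub>M N \<longleftrightarrow> f \<in> (Conf \<Otimes>\<^sub>M Conf) \<Otimes>\<^sub>M discrete_fun_space \<rightarrow>\<^sub>M N"
  using measurable_cong_sets[OF sets_Q refl] by blast

private lemma measurable_nu: "f \<in> \<nu> \<rightarrow>\<^sub>M N \<longleftrightarrow> f \<in> Conf \<Otimes>\<^sub>M Conf \<rightarrow>\<^sub>M N"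
  using measurable_cong_sets[OF sets_nu refl] by blast

private lemma Q_prob: "prob_space Q"
proof -
  interpret n: prob_space \<nu> by (rule prob)
  interpret v: prob_space "vnoise b1 b2" by (rule prob_space_PiM_pmf)
  interpret pair_prob_space \<nu> "vnoise b1 b2" by unfold_locales
  show ?thesis by (rule prob_space_axioms)
qed

private lemma Q_ev: "Measurable.pred ((Conf \<Otimes>\<^sub>M Conf) \<Otimes>\<^sub>M discrete_fun_space) P \<Longrightarrow> {q. P q} \<in> sets Q"
  unfolding sets_Q pred_def by (simp add: space_pair_measure)

private abbreviation shiftQ where
  "shiftQ m q \<equiv> (shift2 m (fst q), (\<lambda>x. snd q (x + m)) :: int \<Rightarrow> bool \<times> bool)"

private lemma measurable_noise_shift: "(\<lambda>u x. u (x + m)) \<in> vnoise b1 b2 \<rightarrow>\<^sub>M discrete_fun_space"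
  by (rule measurable_discreteI) (rule measurable_coord[OF measurable_ident_sets], simp)

private lemma Q_shift: "distr Q ((Conf \<Otimes>\<^sub>M Conf) \<Otimes>\<^sub>M discrete_fun_space) (shiftQ m) = Q"
proof -
  have vs: "distr (vnoise b1 b2) discrete_fun_space (\<lambda>u x. u (x + m)) = vnoise b1 b2"
    by (rule distr_iid_reindex) (simp add: inj_on_def)
  have "sigma_finite_measure (vnoise b1 b2)"
    by (rule prob_space_imp_sigma_finite) (rule prob_space_PiM_pmf)
  then have "distr \<nu> (Conf \<Otimes>\<^sub>M Conf) (shift2 m) \<Otimes>\<^sub>M distr (vnoise b1 b2) discrete_fun_space (\<lambda>u x. u (x + m))
    = distr Q ((Conf \<Otimes>\<^sub>M Conf) \<Otimes>\<^sub>M discrete_fun_space) (\<lambda>(p, u). (shift2 m p, \<lambda>x. u (x + m)))"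
    using measurable_shift2 measurable_noise_shift
    by (intro pair_measure_distr) (simp_all only: vs measurable_nu)
  then show ?thesis unfolding ti vs split_beta by (rule sym)
qed

private lemma measurable_shiftQ: "shiftQ m \<in> Q \<rightarrow>\<^sub>M (Conf \<Otimes>\<^sub>M Conf) \<Otimes>\<^sub>M discrete_fun_space"
  unfolding measurable_Q
proof (rule measurable_Pair)
  show "(\<lambda>q. shift2 m (fst q)) \<in> (Conf \<Otimes>\<^sub>M Conf) \<Otimes>\<^sub>M discrete_fun_space \<rightarrow>\<^sub>M Conf \<Otimes>\<^sub>M Conf"
    by (rule measurable_compose[OF measurable_fst measurable_shift2])
  show "(\<lambda>q x. snd q (x + m)) \<in> (Conf \<Otimes>\<^sub>M Conf) \<Otimes>\<^sub>M discrete_fun_space \<rightarrow>\<^sub>M (discrete_fun_space :: (int \<Rightarrow> bool \<times> bool) measure)"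
    by (rule measurable_discreteI) (rule measurable_coord[OF measurable_snd])
qed

private lemma measure_Q_shift:
  assumes "A \<in> sets Q" shows "measure Q {q. shiftQ m q \<in> A} = measure Q A"
proof -
  have "measure Q A = measure (distr Q ((Conf \<Otimes>\<^sub>M Conf) \<Otimes>\<^sub>M discrete_fun_space) (shiftQ m)) A"
    by (simp only: Q_shift)
  also have "\<dots> = measure Q (shiftQ m -` A \<inter> space Q)"
    by (rule measure_distr[OF measurable_shiftQ assms[unfolded sets_Q]])
  finally show ?thesis by (simp only: space_Q Int_UNIV_right vimage_def)
qed

lemma measure_discrepancy: "measure \<nu> {p. fst p x \<noteq> snd p x} = discrep \<nu>"
proof -
  have m: "shift2 x \<in> \<nu> \<rightarrow>\<^sub>M Conf \<Otimes>\<^sub>M Conf" unfolding measurable_nu by (rule measurable_shift2)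
  have "discrep \<nu> = measure (distr \<nu> (Conf \<Otimes>\<^sub>M Conf) (shift2 x)) {p. fst p 0 \<noteq> snd p 0}"
    by (simp only: ti discrep_def)
  also have "\<dots> = measure \<nu> (shift2 x -` {p. fst p 0 \<noteq> snd p 0} \<inter> space \<nu>)"
    by (rule measure_distr[OF m sets_discrepancy])
  finally show ?thesis by (simp add: space_nu vimage_def)
qed

lemma joint_step_measurable_nu: "joint_step \<in> \<nu> \<Otimes>\<^sub>M vnoise b1 b2 \<rightarrow>\<^sub>M Conf \<Otimes>\<^sub>M Conf"
  unfolding measurable_Q by (rule measurable_joint_step)

lemma coupled_step_prob: "prob_space (coupled_step b1 b2 \<nu>)"
  unfolding coupled_step_def by (rule prob_space.prob_space_distr[OF Q_prob joint_step_measurable_nu])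

lemma coupled_step_shift: "distr (coupled_step b1 b2 \<nu>) (Conf \<Otimes>\<^sub>M Conf) (shift2 m) = coupled_step b1 b2 \<nu>"
proof -
  have comm: "shift2 m \<circ> joint_step = joint_step \<circ> shiftQ m"
    by (rule ext) (simp add: joint_step_def vstep_shift)
  have "distr (coupled_step b1 b2 \<nu>) (Conf \<Otimes>\<^sub>M Conf) (shift2 m) = distr Q (Conf \<Otimes>\<^sub>M Conf) (shift2 m \<circ> joint_step)"
    unfolding coupled_step_def by (rule distr_distr[OF measurable_shift2 joint_step_measurable_nu])
  also have "\<dots> = distr (distr Q ((Conf \<Otimes>\<^sub>M Conf) \<Otimes>\<^sub>M discrete_fun_space) (shiftQ m)) (Conf \<Otimes>\<^sub>M Conf) joint_step"
    unfolding comm by (rule distr_distr[symmetric, OF measurable_joint_step measurable_shiftQ])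
  finally show ?thesis unfolding Q_shift coupled_step_def .
qed

lemma coupled_step_marginal:
  assumes pr: "pr \<in> Conf \<Otimes>\<^sub>M Conf \<rightarrow>\<^sub>M Conf" and eqv: "\<And>q. pr (joint_step q) = vstep (pr (fst q)) (snd q)"
  shows "distr (coupled_step b1 b2 \<nu>) Conf pr = distr (distr \<nu> Conf pr \<Otimes>\<^sub>M vnoise b1 b2) Conf (\<lambda>(\<eta>, u). vstep \<eta> u)"
proof -
  have fm: "pr \<in> \<nu> \<rightarrow>\<^sub>M Conf" unfolding measurable_nu by (rule pr)
  have idd: "distr (vnoise b1 b2) discrete_fun_space (\<lambda>u. u) = vnoise b1 b2"
    by (rule distr_id2) simp
  have im: "(\<lambda>u. u) \<in> vnoise b1 b2 \<rightarrow>\<^sub>M discrete_fun_space" by (rule measurable_ident_sets) simp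
  have sf: "sigma_finite_measure (distr (vnoise b1 b2) discrete_fun_space (\<lambda>u. u))"
    unfolding idd by (rule prob_space_imp_sigma_finite) (rule prob_space_PiM_pmf)
  have eq: "distr \<nu> Conf pr \<Otimes>\<^sub>M vnoise b1 b2 = distr Q (Conf \<Otimes>\<^sub>M discrete_fun_space) (\<lambda>(p, u). (pr p, u))"
    using pair_measure_distr[OF fm im sf] unfolding idd .
  have m1: "(\<lambda>(p, u). (pr p, u)) \<in> Q \<rightarrow>\<^sub>M Conf \<Otimes>\<^sub>M discrete_fun_space"
    unfolding measurable_Q split_beta
    by (intro measurable_Pair measurable_compose[OF measurable_fst pr] measurable_snd)
  have m2: "(\<lambda>(\<eta>, u). vstep \<eta> u) \<in> Conf \<Otimes>\<^sub>M discrete_fun_space \<rightarrow>\<^sub>M Conf"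
    unfolding split_beta by measurable
  have c: "pr \<circ> joint_step = (\<lambda>(\<eta>, u). vstep \<eta> u) \<circ> (\<lambda>(p, u). (pr p, u))"
    by (rule ext) (simp add: eqv split_beta)
  show ?thesis unfolding eq distr_distr[OF m2 m1] coupled_step_def
    distr_distr[OF pr joint_step_measurable_nu] c ..
qed

text \<open>A horizontal discrepancy of sign \<open>s\<close> meets a vertical one of the opposite
  sign at \<open>y\<close>. With the coins \<open>(False, True)\<close> the lone vertical path turns
  right and the lone horizontal path goes on, so both configurations emit a single horizontal path
  and no discrepancy is left.\<close>

private definition annih :: "bool \<Rightarrow> int \<Rightarrow> (((int \<Rightarrow> bool) \<times> (int \<Rightarrow> bool)) \<times> (int \<Rightarrow> bool \<times> bool)) set" where
  "annih s y = {q. fst (fst q) y = (\<not> s) \<and> snd (fst q) y = s \<and>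
     hflux (fst (fst q)) (snd q) (y - 1) = s \<and> hflux (snd (fst q)) (snd q) (y - 1) = (\<not> s) \<and>
     snd q y = (False, True)}"

private lemma annih_sets: "annih s y \<in> sets Q"
  unfolding annih_def by (rule Q_ev) (intro pred_intros_logic pred_const_eq triple_preds)

text \<open>Counting discrepancies on the four edges at \<open>y\<close>: those going out, plus two
  for an annihilation, are at most those coming in. In expectation the horizontal edges on the two
  sides cancel by shift invariance.\<close>

private lemma discrep_coupled_step:
  "discrep (coupled_step b1 b2 \<nu>) + 2 * measure Q (annih s y) \<le> discrep \<nu>"
proof -
  interpret q: prob_space Q by (rule Q_prob)
  define A where "A = {q. vstep (fst (fst q)) (snd q) y \<noteq> vstep (snd (fst q)) (snd q) y}"
  define B where "B = {q :: ((int \<Rightarrow> bool) \<times> (int \<Rightarrow> bool)) \<times> (int \<Rightarrow> bool \<times> bool). fst (fst q) y \<noteq> snd (fst q) y}"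
  define D where "D x = {q. hflux (fst (fst q)) (snd q) x \<noteq> hflux (snd (fst q)) (snd q) x}" for x
  have ev: "A \<in> sets Q" "B \<in> sets Q" "\<And>x. D x \<in> sets Q" "annih s y \<in> sets Q"
    unfolding A_def B_def D_def
    by (rule Q_ev, intro pred_intros_logic triple_preds)+ (rule annih_sets)
  \<comment> \<open>A finite check over the two vertical inputs, the two horizontal inputs, the
    coins and the sign.\<close>
  have ptw: "indicator A q + indicator (D y) q + 2 * indicator (annih s y) q
      \<le> indicator B q + (indicator (D (y - 1)) q :: real)" for q
  proof -
    define \<eta> \<xi> u where "\<eta> = fst (fst q)" "\<xi> = snd (fst q)" "u = snd q"
    show ?thesis
      unfolding A_def B_def D_def annih_def indicator_def mem_Collect_eq \<eta>_\<xi>_u_def[symmetric] vstep_def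
      by (subst hflux_rec[of \<eta> u y], subst hflux_rec[of \<xi> u y])
        (cases "\<eta> y"; cases "\<xi> y"; cases "hflux \<eta> u (y - 1)"; cases "hflux \<xi> u (y - 1)"; cases "u y"; cases s; simp)
  qed
  have int: "integrable Q (indicator X :: _ \<Rightarrow> real)" if "X \<in> sets Q" for X
    using that by (rule integrable_real_indicator) (simp add: q.emeasure_eq_measure)
  have ind: "q.expectation (indicator X) = measure Q X" if "X \<in> sets Q" for X
    using that by (simp add: space_Q)
  have "measure Q A + measure Q (D y) + 2 * measure Q (annih s y)
    = q.expectation (\<lambda>q. indicator A q + indicator (D y) q + 2 * indicator (annih s y) q)"
    using ev int ind by simp
  also have "\<dots> \<le> q.expectation (\<lambda>q. indicator B q + indicator (D (y - 1)) q)"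
    using ev int ptw by (intro integral_mono) auto
  also have "\<dots> = measure Q B + measure Q (D (y - 1))"
    using ev int ind by simp
  finally have main: "measure Q A + measure Q (D y) + 2 * measure Q (annih s y) \<le> measure Q B + measure Q (D (y - 1))" .
  \<comment> \<open>Shift invariance of the coupled system makes the horizontal discrepancies at
    \<open>y - 1\<close> and at \<open>y\<close> equally likely.\<close>
  have "measure Q (D (y - 1)) = measure Q {q. shiftQ (-1) q \<in> D y}"
  proof (rule arg_cong[where f="measure Q"])
    show "D (y - 1) = {q. shiftQ (-1) q \<in> D y}"
      unfolding D_def using hflux_shift[of _ "-1" _ y] by simp
  qed
  also have "\<dots> = measure Q (D y)" by (rule measure_Q_shift[OF ev(3)])
  finally have Dy: "measure Q (D (y - 1)) = measure Q (D y)" .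
  have "measure Q B = measure \<nu> {p. fst p y \<noteq> snd p y}"
  proof -
    have "B = {p. fst p y \<noteq> snd p y} \<times> UNIV" unfolding B_def by auto
    moreover have "measure Q ({p. fst p y \<noteq> snd p y} \<times> space (vnoise b1 b2))
      = measure \<nu> {p. fst p y \<noteq> snd p y} * measure (vnoise b1 b2) (space (vnoise b1 b2))"
      by (rule measure_pair_Times[OF prob_space_PiM_pmf _ sets.top]) (simp only: sets_nu sets_discrepancy)
    moreover have "measure (vnoise b1 b2) (space (vnoise b1 b2)) = 1"
      by (rule prob_space.prob_space) (rule prob_space_PiM_pmf)
    ultimately show ?thesis by (simp only: space_PiM_pmf mult_1_right)
  qed
  then have B: "measure Q B = discrep \<nu>" by (simp only: measure_discrepancy)
  have "discrep (coupled_step b1 b2 \<nu>) = measure (coupled_step b1 b2 \<nu>) {p. fst p y \<noteq> snd p y}"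
  proof -
    have m: "shift2 y \<in> coupled_step b1 b2 \<nu> \<rightarrow>\<^sub>M Conf \<Otimes>\<^sub>M Conf"
      unfolding coupled_step_def by (simp add: measurable_shift2)
    have "discrep (coupled_step b1 b2 \<nu>)
      = measure (distr (coupled_step b1 b2 \<nu>) (Conf \<Otimes>\<^sub>M Conf) (shift2 y)) {p. fst p 0 \<noteq> snd p 0}"
      by (simp only: coupled_step_shift discrep_def)
    also have "\<dots> = measure (coupled_step b1 b2 \<nu>) (shift2 y -` {p. fst p 0 \<noteq> snd p 0} \<inter> space (coupled_step b1 b2 \<nu>))"
      by (rule measure_distr[OF m sets_discrepancy])
    finally show ?thesis by (simp add: coupled_step_def space_pair_measure vimage_def)
  qed
  also have "\<dots> = measure Q (joint_step -` {p. fst p y \<noteq> snd p y} \<inter> space Q)"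
    unfolding coupled_step_def by (rule measure_distr[OF joint_step_measurable_nu sets_discrepancy])
  also have "joint_step -` {p. fst p y \<noteq> snd p y} \<inter> space Q = A"
    by (simp add: space_Q A_def joint_step_def vimage_def)
  finally have A: "discrep (coupled_step b1 b2 \<nu>) = measure Q A" .
  show ?thesis using main Dy A B by linarith
qed

text \<open>An opposite pair is an event of the configurations and the noise pattern one of the
  independent noise, so their probabilities multiply. When both occur, an annihilation takes place
  at \<open>y\<close>, and the loss in \<open>discrep\<close> is at least its probability.\<close>

lemma opposite_bound:
  assumes "x < y"
  shows "annih_prob b1 b2 x y * measure \<nu> (opposite s x y) \<le> discrep \<nu> - discrep (coupled_step b1 b2 \<nu>)"
proof -
  interpret q: prob_space Q by (rule Q_prob)
  define U where "U = {u :: int \<Rightarrow> bool \<times> bool. \<forall>z\<in>{x..y}. u z = annih_noise x y z}"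
  have U_sets: "U \<in> sets (vnoise b1 b2)"
    unfolding U_def sets_PiM_pmf by (rule sets_discrete_cylinder) simp
  have O_sets: "opposite s x y \<in> sets \<nu>"
    unfolding sets_nu by (rule opposite_sets)
  have sub: "opposite s x y \<times> U \<subseteq> annih s y"
  proof
    fix q assume q: "q \<in> opposite s x y \<times> U"
    define \<eta> \<xi> u where "\<eta> = fst (fst q)" "\<xi> = snd (fst q)" "u = snd q"
    note qdef = \<eta>_\<xi>_u_def
    have o: "\<eta> x = s" "\<xi> x = (\<not> s)" "\<And>z. x < z \<Longrightarrow> z < y \<Longrightarrow> \<eta> z = \<xi> z" "\<eta> y = (\<not> s)" "\<xi> y = s"
      using q unfolding opposite_def qdef by auto
    have u: "u z = annih_noise x y z" if "x \<le> z" "z \<le> y" for z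
      using q that unfolding U_def qdef by auto
    \<comment> \<open>At \<open>x\<close> both coins are False: an occupied site emits a horizontal
      path and an empty one absorbs any arriving path, so the flux out of \<open>x\<close> does not
      depend on what comes in. Strictly between \<open>x\<close> and \<open>y\<close> the coins are
      True and the configurations agree, so both fluxes pass unchanged.\<close>
    have "z < y \<longrightarrow> hflux \<eta> u z = s \<and> hflux \<xi> u z = (\<not> s)" if "x \<le> z" for z
      using that
    proof (induction z rule: int_ge_induct)
      case base
      have "u x = (False, False)" using u[of x] assms by (simp add: annih_noise_def)
      then show ?case using o(1,2) by (subst (1 2) hflux_rec) (cases s; simp)
    next
      case (step z)
      show ?case
      proof
        assume z: "z + 1 < y"
        then have IH: "hflux \<eta> u z = s" "hflux \<xi> u z = (\<not> s)" using step by auto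
        have "u (z + 1) = (True, True)" using u[of "z + 1"] z step(1) by (simp add: annih_noise_def)
        moreover have "\<eta> (z + 1) = \<xi> (z + 1)" using o(3)[of "z + 1"] z step(1) by simp
        ultimately show "hflux \<eta> u (z + 1) = s \<and> hflux \<xi> u (z + 1) = (\<not> s)"
          using IH by (subst (1 2) hflux_rec) (cases s; simp)
      qed
    qed
    from this[of "y - 1"] have "hflux \<eta> u (y - 1) = s" "hflux \<xi> u (y - 1) = (\<not> s)" using assms by auto
    moreover have "u y = (False, True)" using u[of y] assms by (simp add: annih_noise_def)
    ultimately show "q \<in> annih s y" using o(4,5) unfolding annih_def qdef by simp
  qed
  have "annih_prob b1 b2 x y * measure \<nu> (opposite s x y) = measure \<nu> (opposite s x y) * measure (vnoise b1 b2) U"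
    unfolding U_def annih_prob_def by (subst measure_PiM_pmf_cylinder) simp_all
  also have "\<dots> = measure Q (opposite s x y \<times> U)"
    by (rule measure_pair_Times[symmetric, OF prob_space_PiM_pmf O_sets U_sets])
  also have "\<dots> \<le> measure Q (annih s y)"
    by (rule q.finite_measure_mono[OF sub annih_sets])
  also have "\<dots> \<le> discrep \<nu> - discrep (coupled_step b1 b2 \<nu>)"
    using discrep_coupled_step[of s y] measure_nonneg[of Q "annih s y"] by linarith
  finally show ?thesis .
qed

end

section \<open>The set of couplings and estimates on a finite block\<close>

lemma couplingsD:
  assumes "\<nu> \<in> couplings \<mu> \<mu>'"
  shows "prob_space \<nu>" "sets \<nu> = sets (Conf \<Otimes>\<^sub>M Conf)" "distr \<nu> Conf fst = \<mu>" "distr \<nu> Conf snd = \<mu>'"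
    "\<And>m. distr \<nu> (Conf \<Otimes>\<^sub>M Conf) (shift2 m) = \<nu>"
  using assms by (auto simp: couplings_def)

lemma coupled_step_couplings:
  assumes \<nu>: "\<nu> \<in> couplings \<mu> \<mu>'"
    and "distr (\<mu> \<Otimes>\<^sub>M vnoise b1 b2) Conf (\<lambda>(\<eta>, u). vstep \<eta> u) = \<mu>"
    and "distr (\<mu>' \<Otimes>\<^sub>M vnoise b1 b2) Conf (\<lambda>(\<eta>, u). vstep \<eta> u) = \<mu>'"
  shows "coupled_step b1 b2 \<nu> \<in> couplings \<mu> \<mu>'"
proof -
  note D = couplingsD[OF \<nu>]
  have "distr (coupled_step b1 b2 \<nu>) Conf fst = \<mu>"
    using coupled_step_marginal[OF D(1,2,5) measurable_fst] assms(2)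
    by (simp add: joint_step_def D(3))
  moreover have "distr (coupled_step b1 b2 \<nu>) Conf snd = \<mu>'"
    using coupled_step_marginal[OF D(1,2,5) measurable_snd] assms(3)
    by (simp add: joint_step_def D(4))
  moreover have "sets (coupled_step b1 b2 \<nu>) = sets (Conf \<Otimes>\<^sub>M Conf)"
    unfolding coupled_step_def by simp
  ultimately show ?thesis
    using coupled_step_prob[OF D(1,2,5)] coupled_step_shift[OF D(1,2,5)]
    by (simp add: couplings_def)
qed

text \<open>This provides a member of the set over which the discrepancy density is
  minimised.\<close>

lemma product_couplings:
  assumes \<mu>: "prob_space \<mu>" "sets \<mu> = sets Conf" and \<mu>': "prob_space \<mu>'" "sets \<mu>' = sets Conf"
    and ti: "\<And>m. distr \<mu> Conf (\<lambda>\<eta> x. \<eta> (x + m)) = \<mu>" "\<And>m. distr \<mu>' Conf (\<lambda>\<eta> x. \<eta> (x + m)) = \<mu>'"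
  shows "\<mu> \<Otimes>\<^sub>M \<mu>' \<in> couplings \<mu> \<mu>'"
proof -
  interpret m: prob_space \<mu> by fact
  interpret m': prob_space \<mu>' by fact
  interpret P: pair_prob_space \<mu> \<mu>' by unfold_locales
  have sp: "space \<mu> = UNIV" "space \<mu>' = UNIV"
    using sets_eq_imp_space_eq[OF \<mu>(2)] sets_eq_imp_space_eq[OF \<mu>'(2)] by simp_all
  have sets: "sets (\<mu> \<Otimes>\<^sub>M \<mu>') = sets (Conf \<Otimes>\<^sub>M Conf)"
    by (rule sets_pair_measure_cong[OF \<mu>(2) \<mu>'(2)])
  have "distr (\<mu> \<Otimes>\<^sub>M \<mu>') Conf fst = distr (\<mu> \<Otimes>\<^sub>M \<mu>') \<mu> fst"
    by (rule distr_cong) (simp_all add: \<mu>(2))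
  then have fst: "distr (\<mu> \<Otimes>\<^sub>M \<mu>') Conf fst = \<mu>" by (simp add: m'.distr_pair_fst)
  have snd: "distr (\<mu> \<Otimes>\<^sub>M \<mu>') Conf snd = \<mu>'"
  proof (rule measure_eqI)
    have sm: "snd \<in> \<mu> \<Otimes>\<^sub>M \<mu>' \<rightarrow>\<^sub>M Conf"
      using measurable_cong_sets[OF sets refl, of Conf] measurable_snd[of Conf Conf] by blast
    fix X assume "X \<in> sets (distr (\<mu> \<Otimes>\<^sub>M \<mu>') Conf snd)"
    then have X: "X \<in> sets Conf" by simp
    have "emeasure (distr (\<mu> \<Otimes>\<^sub>M \<mu>') Conf snd) X = emeasure (\<mu> \<Otimes>\<^sub>M \<mu>') (snd -` X \<inter> space (\<mu> \<Otimes>\<^sub>M \<mu>'))"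
      by (rule emeasure_distr[OF sm X])
    also have "snd -` X \<inter> space (\<mu> \<Otimes>\<^sub>M \<mu>') = space \<mu> \<times> X"
      by (auto simp: space_pair_measure sp)
    also have "emeasure (\<mu> \<Otimes>\<^sub>M \<mu>') (space \<mu> \<times> X) = emeasure \<mu> (space \<mu>) * emeasure \<mu>' X"
      by (rule m'.emeasure_pair_measure_Times[OF sets.top]) (simp only: X \<mu>'(2))
    finally show "emeasure (distr (\<mu> \<Otimes>\<^sub>M \<mu>') Conf snd) X = emeasure \<mu>' X"
      by (simp only: m.emeasure_space_1 mult_1)
  qed (simp add: \<mu>'(2))
  have "distr (\<mu> \<Otimes>\<^sub>M \<mu>') (Conf \<Otimes>\<^sub>M Conf) (shift2 m) = \<mu> \<Otimes>\<^sub>M \<mu>'" for m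
  proof -
    have m1: "(\<lambda>\<eta> x. \<eta> (x + m)) \<in> \<mu> \<rightarrow>\<^sub>M Conf" and m2: "(\<lambda>\<eta> x. \<eta> (x + m)) \<in> \<mu>' \<rightarrow>\<^sub>M Conf"
      using measurable_cong_sets[OF \<mu>(2) refl, of Conf] measurable_cong_sets[OF \<mu>'(2) refl, of Conf]
        measurable_shift by blast+
    have "sigma_finite_measure (distr \<mu>' Conf (\<lambda>\<eta> x. \<eta> (x + m)))"
      unfolding ti by (rule prob_space_imp_sigma_finite[OF \<mu>'(1)])
    from pair_measure_distr[OF m1 m2 this] show ?thesis
      unfolding ti split_beta by (rule sym)
  qed
  then show ?thesis
    using fst snd sets P.prob_space_axioms by (simp add: couplings_def)
qed

text \<open>A discrepancy strictly between \<open>i\<close> and \<open>j\<close> has a sign opposite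
  to that of one of the two ends, so one of the two subintervals again has opposite ends; descent
  stops at a consecutive pair.\<close>

lemma opposite_exists:
  assumes "i < j" "fst p i = s" "snd p i = (\<not> s)" "fst p j = (\<not> s)" "snd p j = s"
  obtains s' x y where "i \<le> x" "x < y" "y \<le> j" "p \<in> opposite s' x y"
proof -
  have "\<exists>s' x y. i \<le> x \<and> x < y \<and> y \<le> j \<and> p \<in> opposite s' x y"
    using assms
  proof (induction "nat (j - i)" arbitrary: i j rule: less_induct)
    case less
    show ?case
    proof (cases "\<exists>z. i < z \<and> z < j \<and> fst p z \<noteq> snd p z")
      case False
      then have "p \<in> opposite s i j" using less.prems by (auto simp: opposite_def)
      then show ?thesis using less.prems(1) by blast
    next
      case True
      then obtain z where z: "i < z" "z < j" "fst p z \<noteq> snd p z" by blast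
      show ?thesis
      proof (cases "fst p z = s")
        case True
        then have "snd p z = (\<not> s)" using z by auto
        then obtain s' x y where "z \<le> x" "x < y" "y \<le> j" "p \<in> opposite s' x y"
          using less.hyps[of j z] True z less.prems by auto
        then show ?thesis using z by (intro exI[of _ s'] exI[of _ x] exI[of _ y]) simp
      next
        case False
        then have "fst p z = (\<not> s)" "snd p z = s" using z by auto
        then obtain s' x y where "i \<le> x" "x < y" "y \<le> z" "p \<in> opposite s' x y"
          using less.hyps[of z i] z less.prems by auto
        then show ?thesis using z by (intro exI[of _ s'] exI[of _ x] exI[of _ y]) simp
      qed
    qed
  qed
  then show thesis using that by blast
qed

text \<open>If some opposite pair lies in the block, its indicator with the factor \<open>L\<close>
  already exceeds the trivial bound on the left. Otherwise all discrepancies have one sign and the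
  difference of counts is their exact number up to sign.\<close>

lemma block_estimate:
  fixes L :: nat
  defines "I \<equiv> {(s, x, y). x < y \<and> 0 \<le> x \<and> y < int L} :: (bool \<times> int \<times> int) set"
  shows "(\<Sum>k<L. of_bool (fst p (int k) \<noteq> snd p (int k)) :: real)
    \<le> \<bar>site_count True L (fst p) - site_count True L (snd p)\<bar>
      + real L * (\<Sum>(s, x, y)\<in>I. indicator (opposite s x y) p)"
proof -
  let ?D = "\<Sum>k<L. of_bool (fst p (int k) \<noteq> snd p (int k)) :: real"
  have finI: "finite I"
    by (rule finite_subset[of _ "UNIV \<times> {0..<int L} \<times> {0..<int L}"]) (auto simp: I_def)
  have nn: "0 \<le> (\<Sum>(s, x, y)\<in>I. indicator (opposite s x y) p :: real)"
    by (intro sum_nonneg) auto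
  have diff: "site_count True L (fst p) - site_count True L (snd p)
      = (\<Sum>k<L. of_bool (fst p (int k)) - of_bool (snd p (int k)))"
    by (simp add: site_count_def sum_subtractf)
  show ?thesis
  proof (cases "\<exists>i\<in>I. p \<in> opposite (fst i) (fst (snd i)) (snd (snd i))")
    case True
    then obtain i where i: "i \<in> I" "p \<in> opposite (fst i) (fst (snd i)) (snd (snd i))" by blast
    have "(1::real) = (case i of (s, x, y) \<Rightarrow> indicator (opposite s x y) p)"
      using i by (simp add: split_beta)
    also have "\<dots> \<le> (\<Sum>(s, x, y)\<in>I. indicator (opposite s x y) p :: real)"
      using i finI by (intro member_le_sum) (auto simp: split_beta)
    finally have "real L * 1 \<le> real L * (\<Sum>(s, x, y)\<in>I. indicator (opposite s x y) p)"
      by (intro mult_left_mono) simp_all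
    moreover have "?D \<le> (\<Sum>k<L. 1)" by (intro sum_mono) simp
    ultimately show ?thesis by simp
  next
    case False
    have no: False if h: "i < L" "j < L" "fst p (int i)" "\<not> snd p (int i)" "\<not> fst p (int j)" "snd p (int j)" for i j
    proof -
      have "i \<noteq> j" using h by auto
      then consider "int i < int j" | "int j < int i" by linarith
      then obtain s' x y where "0 \<le> x" "x < y" "y < int L" "p \<in> opposite s' x y"
      proof cases
        case 1
        obtain s' x y where "int i \<le> x" "x < y" "y \<le> int j" "p \<in> opposite s' x y"
          by (rule opposite_exists[OF 1, of p True]) (use h in auto)
        then show thesis using h by (intro that[of x y s']) auto
      next
        case 2
        obtain s' x y where "int j \<le> x" "x < y" "y \<le> int i" "p \<in> opposite s' x y"
          by (rule opposite_exists[OF 2, of p False]) (use h in auto)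
        then show thesis using h by (intro that[of x y s']) auto
      qed
      then have "(s', x, y) \<in> I" by (simp add: I_def)
      with \<open>p \<in> opposite s' x y\<close> False show False by force
    qed
    have "?D = \<bar>\<Sum>k<L. of_bool (fst p (int k)) - of_bool (snd p (int k)) :: real\<bar>"
    proof (cases "\<exists>i<L. fst p (int i) \<and> \<not> snd p (int i)")
      case True
      have "?D = (\<Sum>k<L. of_bool (fst p (int k)) - of_bool (snd p (int k)))"
        using True no by (intro sum.cong refl) (force simp: of_bool_def)
      moreover have "0 \<le> ?D" by (intro sum_nonneg) simp
      ultimately show ?thesis by simp
    next
      case False
      have "?D = (\<Sum>k<L. - (of_bool (fst p (int k)) - of_bool (snd p (int k))))"
        using False by (intro sum.cong refl) (force simp: of_bool_def)
      then have "?D = - (\<Sum>k<L. of_bool (fst p (int k)) - of_bool (snd p (int k)))"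
        by (simp only: sum_negf)
      moreover have "0 \<le> ?D" by (intro sum_nonneg) simp
      ultimately show ?thesis by simp
    qed
    then show ?thesis unfolding diff using nn by simp
  qed
qed

text \<open>The expectation of \<open>block_estimate\<close> divided by \<open>L\<close>. The
  difference of counts is split by the triangle inequality through the common density
  \<open>r\<close>, so that each term depends on one marginal only and not on the coupling.\<close>

lemma discrep_le_block:
  fixes L :: nat and r :: real
  defines "I \<equiv> {(s, x, y). x < y \<and> 0 \<le> x \<and> y < int L} :: (bool \<times> int \<times> int) set"
  assumes \<nu>: "\<nu> \<in> couplings \<mu> \<mu>'" and L: "L > 0"
  shows "discrep \<nu> \<le> (\<integral>\<eta>. \<bar>site_count True L \<eta> / L - r\<bar> \<partial>\<mu>) + (\<integral>\<eta>. \<bar>site_count True L \<eta> / L - r\<bar> \<partial>\<mu>')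
    + (\<Sum>(s, x, y)\<in>I. measure \<nu> (opposite s x y))"
proof -
  note D = couplingsD[OF \<nu>]
  interpret prob_space \<nu> by (rule D(1))
  have space: "space \<nu> = UNIV" using sets_eq_imp_space_eq[OF D(2)] by (simp add: space_pair_measure)
  have finI: "finite I"
    by (rule finite_subset[of _ "UNIV \<times> {0..<int L} \<times> {0..<int L}"]) (auto simp: I_def)
  let ?d = "\<lambda>\<eta>. \<bar>site_count True L \<eta> / L - r\<bar>"
  have dm: "?d \<in> borel_measurable Conf" by measurable
  have fm: "fst \<in> \<nu> \<rightarrow>\<^sub>M Conf" and sm: "snd \<in> \<nu> \<rightarrow>\<^sub>M Conf"
    using measurable_cong_sets[OF D(2) refl, of Conf] measurable_fst[of Conf Conf] measurable_snd[of Conf Conf] by blast+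
  have db: "norm (?d \<eta>) \<le> 1 + \<bar>r\<bar>" for \<eta>
  proof -
    have "0 \<le> site_count True L \<eta> / L" "site_count True L \<eta> / L \<le> 1"
      using site_count_bounds[of True L \<eta>] L by auto
    then show ?thesis by simp
  qed
  have int1: "integrable \<nu> (\<lambda>p. ?d (fst p))"
    by (rule integrable_const_bound[OF AE_I2[OF db]]) (rule measurable_compose[OF fm dm])
  have int2: "integrable \<nu> (\<lambda>p. ?d (snd p))"
    by (rule integrable_const_bound[OF AE_I2[OF db]]) (rule measurable_compose[OF sm dm])
  have i1: "(\<integral>\<eta>. ?d \<eta> \<partial>\<mu>) = expectation (\<lambda>p. ?d (fst p))"
    unfolding D(3)[symmetric] by (rule integral_distr[OF fm dm])
  have i2: "(\<integral>\<eta>. ?d \<eta> \<partial>\<mu>') = expectation (\<lambda>p. ?d (snd p))"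
    unfolding D(4)[symmetric] by (rule integral_distr[OF sm dm])
  have indint: "integrable \<nu> (indicator X :: _ \<Rightarrow> real)" if "X \<in> sets \<nu>" for X
    using that by (rule integrable_real_indicator) (simp add: emeasure_eq_measure)
  have indexp: "expectation (indicator X) = measure \<nu> X" if "X \<in> sets \<nu>" for X
    using that by (simp add: space)
  have disc: "{p. fst p x \<noteq> snd p x} \<in> sets \<nu>" for x unfolding D(2) by (rule sets_discrepancy)
  have opp: "opposite s x y \<in> sets \<nu>" for s x y unfolding D(2) by (rule opposite_sets)
  have oppint: "integrable \<nu> (\<lambda>p. \<Sum>i\<in>I. indicator (opposite (fst i) (fst (snd i)) (snd (snd i))) p :: real)"
    by (intro Bochner_Integration.integrable_sum indint opp)
  have "real L * discrep \<nu> = (\<Sum>k<L. measure \<nu> {p. fst p (int k) \<noteq> snd p (int k)})"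
    unfolding measure_discrepancy[OF D(1,2,5)] by simp
  also have "\<dots> = expectation (\<lambda>p. \<Sum>k<L. indicator {p. fst p (int k) \<noteq> snd p (int k)} p)"
    by (subst Bochner_Integration.integral_sum[OF indint[OF disc]]) (simp only: indexp[OF disc])
  also have "\<dots> \<le> expectation (\<lambda>p. (real L * ?d (fst p) + real L * ?d (snd p))
      + real L * (\<Sum>i\<in>I. indicator (opposite (fst i) (fst (snd i)) (snd (snd i))) p))"
  proof (rule integral_mono)
    show "integrable \<nu> (\<lambda>p. \<Sum>k<L. indicator {p. fst p (int k) \<noteq> snd p (int k)} p :: real)"
      by (intro Bochner_Integration.integrable_sum indint disc)
    show "integrable \<nu> (\<lambda>p. (real L * ?d (fst p) + real L * ?d (snd p))
      + real L * (\<Sum>i\<in>I. indicator (opposite (fst i) (fst (snd i)) (snd (snd i))) p))"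
      by (intro Bochner_Integration.integrable_add integrable_mult_right int1 int2 oppint)
    fix p
    have sc: "real L * ?d \<eta> = \<bar>site_count True L \<eta> - real L * r\<bar>" for \<eta>
    proof -
      have "real L * ?d \<eta> = \<bar>real L * (site_count True L \<eta> / L - r)\<bar>" by (simp add: abs_mult)
      also have "real L * (site_count True L \<eta> / L - r) = site_count True L \<eta> - real L * r"
        using L by (simp add: right_diff_distrib)
      finally show ?thesis .
    qed
    have "\<bar>site_count True L (fst p) - site_count True L (snd p)\<bar> \<le> real L * ?d (fst p) + real L * ?d (snd p)"
      unfolding sc by linarith
    then show "(\<Sum>k<L. indicator {p. fst p (int k) \<noteq> snd p (int k)} p) \<le> (real L * ?d (fst p) + real L * ?d (snd p))
      + real L * (\<Sum>i\<in>I. indicator (opposite (fst i) (fst (snd i)) (snd (snd i))) p)"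
      using block_estimate[where p=p and L=L, folded I_def]
      by (simp add: indicator_def of_bool_def split_beta)
  qed
  also have "\<dots> = real L * (expectation (\<lambda>p. ?d (fst p)) + expectation (\<lambda>p. ?d (snd p))
      + (\<Sum>i\<in>I. measure \<nu> (opposite (fst i) (fst (snd i)) (snd (snd i)))))"
  proof -
    have "expectation (\<lambda>p. \<Sum>i\<in>I. indicator (opposite (fst i) (fst (snd i)) (snd (snd i))) p)
        = (\<Sum>i\<in>I. measure \<nu> (opposite (fst i) (fst (snd i)) (snd (snd i))))"
      by (subst Bochner_Integration.integral_sum[OF indint[OF opp]]) (simp only: indexp[OF opp])
    then show ?thesis
      using int1 int2 oppint by (simp add: distrib_left)
  qed
  finally have "discrep \<nu> \<le> expectation (\<lambda>p. ?d (fst p)) + expectation (\<lambda>p. ?d (snd p))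
      + (\<Sum>i\<in>I. measure \<nu> (opposite (fst i) (fst (snd i)) (snd (snd i))))"
    using L by simp
  then show ?thesis unfolding i1 i2 by (simp add: split_beta)
qed

text \<open>The coupling inequality: the two events can differ only if there is a discrepancy at one
  of the sites in \<open>J\<close>, and a union bound applies.\<close>

lemma couplings_cylinder_bound:
  assumes \<nu>: "\<nu> \<in> couplings \<mu> \<mu>'" and J: "finite J"
  shows "\<bar>measure \<mu> {\<eta>. \<forall>i\<in>J. \<eta> i = a i} - measure \<mu>' {\<eta>. \<forall>i\<in>J. \<eta> i = a i}\<bar> \<le> card J * discrep \<nu>"
proof -
  note D = couplingsD[OF \<nu>]
  interpret prob_space \<nu> by (rule D(1))
  have space: "space \<nu> = UNIV" using sets_eq_imp_space_eq[OF D(2)] by (simp add: space_pair_measure)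
  have fm: "fst \<in> \<nu> \<rightarrow>\<^sub>M Conf" and sm: "snd \<in> \<nu> \<rightarrow>\<^sub>M Conf"
    using measurable_cong_sets[OF D(2) refl, of Conf] measurable_fst[of Conf Conf] measurable_snd[of Conf Conf] by blast+
  let ?C = "{\<eta>::int \<Rightarrow> bool. \<forall>i\<in>J. \<eta> i = a i}"
  have C: "?C \<in> sets Conf" unfolding Conf_def by (rule sets_discrete_cylinder[OF J])
  have ef: "fst -` ?C \<inter> space \<nu> \<in> sets \<nu>" and es: "snd -` ?C \<inter> space \<nu> \<in> sets \<nu>"
    by (rule measurable_sets[OF fm C], rule measurable_sets[OF sm C])
  have mf: "measure \<mu> ?C = measure \<nu> (fst -` ?C \<inter> space \<nu>)"
    unfolding D(3)[symmetric] by (rule measure_distr[OF fm C])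
  have ms: "measure \<mu>' ?C = measure \<nu> (snd -` ?C \<inter> space \<nu>)"
    unfolding D(4)[symmetric] by (rule measure_distr[OF sm C])
  let ?E = "\<Union>i\<in>J. {p. fst p i \<noteq> snd p i}"
  have disc: "{p. fst p x \<noteq> snd p x} \<in> sets \<nu>" for x unfolding D(2) by (rule sets_discrepancy)
  have E: "?E \<in> sets \<nu>" by (rule sets.finite_UN[OF J disc])
  have "measure \<nu> ?E \<le> (\<Sum>i\<in>J. measure \<nu> {p. fst p i \<noteq> snd p i})"
    using J disc by (intro finite_measure_subadditive_finite) auto
  also have "\<dots> = card J * discrep \<nu>" unfolding measure_discrepancy[OF D(1,2,5)] by simp
  finally have mE: "measure \<nu> ?E \<le> card J * discrep \<nu>" .
  have "measure \<nu> (fst -` ?C \<inter> space \<nu>) \<le> measure \<nu> ((snd -` ?C \<inter> space \<nu>) \<union> ?E)"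
    by (rule finite_measure_mono[OF _ sets.Un[OF es E]]) (auto simp: space)
  also have "\<dots> \<le> measure \<nu> (snd -` ?C \<inter> space \<nu>) + measure \<nu> ?E"
    by (rule measure_Un_le[OF es E])
  finally have 1: "measure \<mu> ?C \<le> measure \<mu>' ?C + measure \<nu> ?E" unfolding mf ms .
  have "measure \<nu> (snd -` ?C \<inter> space \<nu>) \<le> measure \<nu> ((fst -` ?C \<inter> space \<nu>) \<union> ?E)"
    by (rule finite_measure_mono[OF _ sets.Un[OF ef E]]) (auto simp: space)
  also have "\<dots> \<le> measure \<nu> (fst -` ?C \<inter> space \<nu>) + measure \<nu> ?E"
    by (rule measure_Un_le[OF ef E])
  finally have 2: "measure \<mu>' ?C \<le> measure \<mu> ?C + measure \<nu> ?E" unfolding mf ms .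
  show ?thesis using 1 2 mE by linarith
qed

text \<open>For each block length \<open>L\<close> the infimum \<open>d\<close> is shown to be at
  most the error \<open>e L\<close> of the two laws of large numbers. Since \<open>d\<close> does
  not depend on \<open>L\<close>, it vanishes.\<close>

lemma small_discrepancy_couplings:
  assumes b: "0 < b1" "b1 < 1" "0 < b2" "b2 < 1"
    and ne: "couplings \<mu> \<mu>' \<noteq> {}"
    and st: "distr (\<mu> \<Otimes>\<^sub>M vnoise b1 b2) Conf (\<lambda>(\<eta>, u). vstep \<eta> u) = \<mu>"
      "distr (\<mu>' \<Otimes>\<^sub>M vnoise b1 b2) Conf (\<lambda>(\<eta>, u). vstep \<eta> u) = \<mu>'"
    and erg: "(\<lambda>n. \<integral>\<eta>. \<bar>site_count True n \<eta> / n - r\<bar> \<partial>\<mu>) \<longlonglongrightarrow> 0"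
      "(\<lambda>n. \<integral>\<eta>. \<bar>site_count True n \<eta> / n - r\<bar> \<partial>\<mu>') \<longlonglongrightarrow> 0"
    and \<epsilon>: "0 < \<epsilon>"
  obtains \<nu> where "\<nu> \<in> couplings \<mu> \<mu>'" "discrep \<nu> < \<epsilon>"
proof -
  define d where "d = Inf (discrep ` couplings \<mu> \<mu>')"
  have bdd: "bdd_below (discrep ` couplings \<mu> \<mu>')"
    by (rule bdd_belowI[of _ 0]) (auto simp: discrep_def)
  have d_le: "d \<le> discrep \<nu>" if "\<nu> \<in> couplings \<mu> \<mu>'" for \<nu>
    unfolding d_def using bdd that by (intro cInf_lower) auto
  have d_app: "\<exists>\<nu>\<in>couplings \<mu> \<mu>'. discrep \<nu> < e" if "d < e" for e
    using cInf_lessD[of "discrep ` couplings \<mu> \<mu>'" e] ne that unfolding d_def by auto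
  define e where "e L = (\<integral>\<eta>. \<bar>site_count True L \<eta> / L - r\<bar> \<partial>\<mu>) + (\<integral>\<eta>. \<bar>site_count True L \<eta> / L - r\<bar> \<partial>\<mu>')" for L
  have d_e: "d \<le> e L" if L: "L > 0" for L
  proof -
    define I where "I = ({(s, x, y). x < y \<and> 0 \<le> x \<and> y < int L} :: (bool \<times> int \<times> int) set)"
    \<comment> \<open>The constant depends on \<open>L\<close> and the parameters but not on the
      coupling, so it can be beaten by taking a coupling close enough to the infimum.\<close>
    define C where "C = (\<Sum>(s, x, y)\<in>I. 1 / annih_prob b1 b2 x y)"
    have C0: "0 \<le> C" unfolding C_def using annih_prob_pos[OF b] by (intro sum_nonneg) (auto simp: less_imp_le)
    have approx: "d \<le> e L + C * t" if t: "t > 0" for t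
    proof -
      \<comment> \<open>The stepped coupling is again a competitor, so its discrepancy density is at
        least \<open>d\<close>. A coupling within \<open>t\<close> of the infimum can thus lose at
        most \<open>t\<close>.\<close>
      obtain \<nu> where \<nu>: "\<nu> \<in> couplings \<mu> \<mu>'" "discrep \<nu> < d + t" using d_app[of "d + t"] t by auto
      note D = couplingsD[OF \<nu>(1)]
      have "d \<le> discrep (coupled_step b1 b2 \<nu>)"
        by (rule d_le[OF coupled_step_couplings[OF \<nu>(1) st]])
      then have gap: "discrep \<nu> - discrep (coupled_step b1 b2 \<nu>) \<le> t" using \<nu>(2) by linarith
      have "(case i of (s, x, y) \<Rightarrow> measure \<nu> (opposite s x y)) \<le> (case i of (s, x, y) \<Rightarrow> 1 / annih_prob b1 b2 x y) * t"
        if "i \<in> I" for i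
      proof -
        obtain s x y where i: "i = (s, x, y)" by (cases i)
        have "x < y" using that by (simp add: i I_def)
        then have "annih_prob b1 b2 x y * measure \<nu> (opposite s x y) \<le> t"
          using opposite_bound[OF D(1,2,5)] gap by (meson order_trans)
        then show ?thesis using annih_prob_pos[OF b, of x y] by (simp add: i field_simps)
      qed
      then have "(\<Sum>(s, x, y)\<in>I. measure \<nu> (opposite s x y)) \<le> (\<Sum>i\<in>I. (case i of (s, x, y) \<Rightarrow> 1 / annih_prob b1 b2 x y) * t)"
        by (rule sum_mono)
      also have "\<dots> = C * t" unfolding C_def sum_distrib_right ..
      finally have "discrep \<nu> \<le> e L + C * t"
        using discrep_le_block[OF \<nu>(1) L, of r, folded I_def] unfolding e_def by linarith
      then show ?thesis using d_le[OF \<nu>(1)] by linarith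
    qed
    \<comment> \<open>Rescaling by \<open>C + 1\<close> instead of \<open>C\<close> avoids a
      division by zero when the block contains no pair of sites.\<close>
    have app: "d \<le> e L + C * (t / (C + 1))" if "t > 0" for t
      by (rule approx) (use that C0 in simp)
    show ?thesis
    proof (rule field_le_epsilon)
      fix t :: real assume t: "0 < t"
      have "C * (t / (C + 1)) \<le> t" using C0 t by (simp add: field_simps)
      with app[OF t] show "d \<le> e L + t" by linarith
    qed
  qed
  have "e \<longlonglongrightarrow> 0" unfolding e_def using tendsto_add[OF erg] by simp
  then have "d \<le> 0" by (rule LIMSEQ_le_const) (use d_e in \<open>auto intro!: exI[of _ 1]\<close>)
  then show thesis using d_app[of \<epsilon>] \<epsilon> that by force
qed

theorem theorem3p6:
  fixes b1 b2 :: real and \<mu> :: "(int \<Rightarrow> bool) measure"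
  assumes "0 < b1" "b1 < b2" "b2 < 1"
    and "conf_prob \<mu>"
    and "translation_invariant \<mu>"
    and "stationary b1 b2 \<mu>"
    and "extremal_in (TIS b1 b2) \<mu>"
  shows "\<exists>\<rho>\<in>{0..1}. \<mu> = Upsilon \<rho>"
proof -
  have b: "0 < b1" "b1 < 1" "0 < b2" "b2 < 1" using assms by linarith+
  have prob: "prob_space \<mu>" and sets: "sets \<mu> = sets Conf" using assms(4) by (simp_all add: conf_prob_def)
  interpret prob_space \<mu> by (rule prob)
  \<comment> \<open>The density is forced: by \<open>couplings_cylinder_bound\<close> with a single
    site, couplings of arbitrarily small discrepancy exist only between measures of equal
    density.\<close>
  define r where "r = measure \<mu> {\<eta>. \<eta> 0}"
  have r: "0 \<le> r" "r \<le> 1" by (simp_all add: r_def)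
  have ti: "distr \<mu> Conf (\<lambda>\<eta> x. \<eta> (x + m)) = \<mu>" for m
    using assms(5) by (simp add: translation_invariant_def S_m_def)
  have "M_t b1 b2 1 \<mu> = \<mu>" using assms(6) unfolding stationary_def by blast
  then have st: "distr (\<mu> \<Otimes>\<^sub>M vnoise b1 b2) Conf (\<lambda>(\<eta>, u). vstep \<eta> u) = \<mu>"
    unfolding M_t_1_eq_vstep[OF b(3,4) sets] .
  have ne: "couplings \<mu> (Upsilon r) \<noteq> {}"
    using product_couplings[OF prob sets Upsilon_prob sets_Upsilon ti Upsilon_shift] by blast
  have erg: "(\<lambda>n. \<integral>\<eta>. \<bar>site_count True n \<eta> / n - r\<bar> \<partial>\<mu>) \<longlonglongrightarrow> 0"
    unfolding r_def by (rule extremal_mean_ergodic[OF assms(4,5,7)])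
  have "\<mu> = Upsilon r"
  proof (rule discrete_fun_space_measure_eqI[OF prob Upsilon_prob])
    show "sets \<mu> = sets discrete_fun_space" "sets (Upsilon r) = sets discrete_fun_space"
      by (simp_all only: sets sets_Upsilon Conf_def)
    fix J :: "int set" and a :: "int \<Rightarrow> bool" assume J: "finite J"
    let ?x = "\<bar>measure \<mu> {\<eta>. \<forall>i\<in>J. \<eta> i = a i} - measure (Upsilon r) {\<eta>. \<forall>i\<in>J. \<eta> i = a i}\<bar>"
    have "?x \<le> 0"
    proof (rule field_le_epsilon)
      fix t :: real assume t: "0 < t"
      \<comment> \<open>The added one keeps the tolerance meaningful for empty
        \<open>J\<close>.\<close>
      then have "0 < t / (card J + 1)" by simp
      then obtain \<nu> where \<nu>: "\<nu> \<in> couplings \<mu> (Upsilon r)" "discrep \<nu> < t / (card J + 1)"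
        by (rule small_discrepancy_couplings[OF b ne st vstep_Upsilon[OF b r] erg Upsilon_mean_ergodic[OF r]])
      have "?x \<le> card J * discrep \<nu>" by (rule couplings_cylinder_bound[OF \<nu>(1) J])
      also have "\<dots> \<le> card J * (t / (card J + 1))" using \<nu>(2) by (intro mult_left_mono) simp_all
      also have "\<dots> \<le> t" using t by (simp add: field_simps)
      finally show "?x \<le> 0 + t" by simp
    qed
    then show "measure \<mu> {\<eta>. \<forall>i\<in>J. \<eta> i = a i} = measure (Upsilon r) {\<eta>. \<forall>i\<in>J. \<eta> i = a i}" by simp
  qed
  then show ?thesis using r by auto
qed

end
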